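(* Let $\mathcal{Q}$ be a small quantaloid. The quantaloid homomorphism $$\mathcal{K}_{\mathrm{reg}}:\big(\mathbf{D}(\mathcal{Q}\text{-}\mathbf{Dist})_{\mathrm{reg}}\big)^{\mathrm{op}}\to(\mathcal{Q}\text{-}\mathbf{Sup})_{\mathrm{ccd}},$$ which sends a regular $\mathcal{Q}$-distributor $\phi$ to $\mathcal{K}\phi$ and the class of $(\zeta,\eta):\phi\to\psi$ to $\mathcal{K}(\zeta,\eta):\mathcal{K}\psi\to\mathcal{K}\phi$, is an equivalence of quantaloids. Hence, $\mathbf{D}(\mathcal{Q}\text{-}\mathbf{Dist})_{\mathrm{reg}}$ and $(\mathcal{Q}\text{-}\mathbf{Sup})_{\mathrm{ccd}}$ are dually equivalent quantaloids.
   Context: A quantaloid is a category whose hom-sets are complete lattices and whose composition preserves arbitrary joins in each variable; it is small if it has a set of objects. A quantaloid homomorphism is a functor preserving joins of arrows in each hom-set; an equivalence of quantaloids is a quantaloid homomorphism that is fully faithful and essentially surjective. For arrows $f:X\to Y$, $g:Y\to Z$, $h:X\to Z$ the residuals $h\swarrow f:Y\to Z$ and $g\searrow h:X\to Y$ are determined by $g\circ f\le h\iff g\le h\swarrow f\iff f\le g\searrow h$. A (small) $\mathcal{Q}$-category $\mathbb{A}$ consists of a set $\mathbb{A}_0$ of objects, a type map $t:\mathbb{A}_0\to\mathrm{ob}\,\mathcal{Q}$ and hom-arrows $\mathbb{A}(x,y)\in\mathcal{Q}(tx,ty)$ with $1_{tx}\le\mathbb{A}(x,x)$ and $\mathbb{A}(y,z)\circ\mathbb{A}(x,y)\le\mathbb{A}(x,z)$.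 Its underlying order: $x\le y$ iff $tx=ty$ and $1_{tx}\le\mathbb{A}(x,y)$; $\mathbb{A}$ is skeletal if $x\le y$ and $y\le x$ imply $x=y$. A $\mathcal{Q}$-functor $F:\mathbb{A}\to\mathbb{B}$ is a type-preserving map on objects with $\mathbb{A}(x,y)\le\mathbb{B}(Fx,Fy)$; $\mathcal{Q}$-functors are ordered pointwise by the underlying order, giving a 2-category $\mathcal{Q}\text{-}\mathbf{Cat}$ in which adjunctions are taken ($F\dashv G$ iff $1\le GF$ and $FG\le 1$). A $\mathcal{Q}$-distributor $\phi:\mathbb{A}\nrightarrow\mathbb{B}$ assigns to each $(x,y)\in\mathbb{A}_0\times\mathbb{B}_0$ an arrow $\phi(x,y)\in\mathcal{Q}(tx,ty)$ with $\mathbb{B}(y,y')\circ\phi(x,y)\circ\mathbb{A}(x',x)\le\phi(x',y')$. With composition $(\psi\circ\phi)(x,z)=\bigvee_{y}\psi(y,z)\circ\phi(x,y)$, identities given by the hom-arrows, and pointwise order, $\mathcal{Q}$-categories and $\mathcal{Q}$-distributors form a quantaloid $\mathcal{Q}\text{-}\mathbf{Dist}$ (with residuals also denoted $\swarrow,\searrow$). $\phi:\mathbb{A}\nrightarrow\mathbb{B}$ is regular if there is $\psi:\mathbb{B}\nrightarrow\mathbb{A}$ with $\phi\circ\psi\circ\phi=\phi$. For $X\in\mathrm{ob}\,\mathcal{Q}$ let $\star_X$ be the $\mathcal{Q}$-category with a single object of type $X$ and hom-arrow $1_X$. The presheaf $\mathcal{Q}$-category $\mathcal{P}\mathbb{A}$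 has as objects of type $X$ the $\mathcal{Q}$-distributors $\mu:\mathbb{A}\nrightarrow\star_X$, with $\mathcal{P}\mathbb{A}(\mu,\mu')=\mu'\swarrow\mu$. $\mathbb{A}$ is complete if the Yoneda embedding $\mathsf{Y}_{\mathbb{A}}:\mathbb{A}\to\mathcal{P}\mathbb{A}$, $x\mapsto\mathbb{A}(-,x)$, has a left adjoint $\sup_{\mathbb{A}}$ in $\mathcal{Q}\text{-}\mathbf{Cat}$, and (ccd) if moreover $\sup_{\mathbb{A}}$ has a left adjoint in $\mathcal{Q}\text{-}\mathbf{Cat}$. $\mathcal{Q}\text{-}\mathbf{Sup}$ is the quantaloid of skeletal complete $\mathcal{Q}$-categories and left adjoint (equivalently, sup-preserving) $\mathcal{Q}$-functors, with pointwise local order; $(\mathcal{Q}\text{-}\mathbf{Sup})_{\mathrm{ccd}}$ is its full subquantaloid on the (ccd) $\mathcal{Q}$-categories. For $\phi:\mathbb{A}\nrightarrow\mathbb{B}$ let $\phi^*:\mathcal{P}\mathbb{B}\to\mathcal{P}\mathbb{A}$, $\lambda\mapsto\lambda\circ\phi$, and $\phi_*:\mathcal{P}\mathbb{A}\to\mathcal{P}\mathbb{B}$, $\mu\mapsto\mu\swarrow\phi$. $\mathcal{K}\phi:=\{\lambda\in\mathcal{P}\mathbb{B}\mid\phi_*\phi^*\lambda=\lambda\}$, a $\mathcal{Q}$-subcategory of $\mathcal{P}\mathbb{B}$; it is skeletal and complete. For a quantaloid $\mathcal{C}$, the arrow quantaloid $\mathbf{Arr}(\mathcal{C})$ has as objects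 the arrows of $\mathcal{C}$; an arrow from $f:X_1\to Y_1$ to $g:X_2\to Y_2$ is a pair $(u:X_1\to X_2,\ v:Y_1\to Y_2)$ with $g\circ u=v\circ f$; the order is componentwise. Put $(u,v)\sim(u',v')$ iff $g\circ u=v\circ f=g\circ u'=v'\circ f$. This is a congruence, and the quotient quantaloid $\mathbf{D}(\mathcal{C})=\mathbf{Arr}(\mathcal{C})/{\sim}$ is the quantaloid of diagonals in $\mathcal{C}$ (joins are computed on representatives). $\mathbf{D}(\mathcal{Q}\text{-}\mathbf{Dist})_{\mathrm{reg}}$ is the full subquantaloid of $\mathbf{D}(\mathcal{Q}\text{-}\mathbf{Dist})$ whose objects are the regular $\mathcal{Q}$-distributors. For an arrow $(\zeta,\eta):(\phi:\mathbb{A}\nrightarrow\mathbb{B})\to(\psi:\mathbb{A}'\nrightarrow\mathbb{B}')$ in $\mathbf{Arr}(\mathcal{Q}\text{-}\mathbf{Dist})$ (so $\zeta:\mathbb{A}\nrightarrow\mathbb{A}'$, $\eta:\mathbb{B}\nrightarrow\mathbb{B}'$, $\psi\circ\zeta=\eta\circ\phi$), the $\mathcal{Q}$-functor $\mathcal{K}(\zeta,\eta):\mathcal{K}\psi\to\mathcal{K}\phi$ is $\lambda'\mapsto\phi_*\phi^*\eta^*\lambda'=((\lambda'\circ\eta\circ\phi)\swarrow\phi)$; it depends only on the $\sim$-class of $(\zeta,\eta)$. *)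

theory Defs
  imports Main "HOL-Library.FuncSet" "HOL-Library.Equipollence" "HOL-Algebra.Complete_Lattice"
begin

section \<open>Quantaloids\<close>

text \<open>Hom-sets are families indexed by pairs of objects and need not be disjoint; hence
  composition carries the objects as arguments: \<open>Cmp Q X Y Z g f\<close> is the composite of
  \<open>f : X \<rightarrow> Y\<close> followed by \<open>g : Y \<rightarrow> Z\<close>.\<close>

record ('o, 'a) quantaloid =
  Obj :: "'o set"
  Hom :: "'o \<Rightarrow> 'o \<Rightarrow> 'a gorder"
  Idt :: "'o \<Rightarrow> 'a"
  Cmp :: "'o \<Rightarrow> 'o \<Rightarrow> 'o \<Rightarrow> 'a \<Rightarrow> 'a \<Rightarrow> 'a"

abbreviation Arrows :: "('o, 'a) quantaloid \<Rightarrow> 'o \<Rightarrow> 'o \<Rightarrow> 'a set" where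
  "Arrows Q X Y \<equiv> carrier (Hom Q X Y)"

locale quantaloid =
  fixes Q :: "('o, 'a) quantaloid"
  assumes hom_complete: "\<lbrakk>X \<in> Obj Q; Y \<in> Obj Q\<rbrakk> \<Longrightarrow> complete_lattice (Hom Q X Y)"
    and Idt_closed: "X \<in> Obj Q \<Longrightarrow> Idt Q X \<in> Arrows Q X X"
    and Cmp_closed: "\<lbrakk>X \<in> Obj Q; Y \<in> Obj Q; Z \<in> Obj Q; f \<in> Arrows Q X Y; g \<in> Arrows Q Y Z\<rbrakk>
      \<Longrightarrow> Cmp Q X Y Z g f \<in> Arrows Q X Z"
    and Cmp_Idt_right: "\<lbrakk>X \<in> Obj Q; Y \<in> Obj Q; f \<in> Arrows Q X Y\<rbrakk>
      \<Longrightarrow> Cmp Q X X Y f (Idt Q X) = f"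
    and Cmp_Idt_left: "\<lbrakk>X \<in> Obj Q; Y \<in> Obj Q; f \<in> Arrows Q X Y\<rbrakk>
      \<Longrightarrow> Cmp Q X Y Y (Idt Q Y) f = f"
    and Cmp_assoc: "\<lbrakk>W \<in> Obj Q; X \<in> Obj Q; Y \<in> Obj Q; Z \<in> Obj Q;
        f \<in> Arrows Q W X; g \<in> Arrows Q X Y; h \<in> Arrows Q Y Z\<rbrakk>
      \<Longrightarrow> Cmp Q W X Z (Cmp Q X Y Z h g) f = Cmp Q W Y Z h (Cmp Q W X Y g f)"
    and Cmp_sup_right: "\<lbrakk>X \<in> Obj Q; Y \<in> Obj Q; Z \<in> Obj Q; S \<subseteq> Arrows Q X Y; g \<in> Arrows Q Y Z\<rbrakk>
      \<Longrightarrow> Cmp Q X Y Z g (\<Squnion>\<^bsub>Hom Q X Y\<^esub> S) = \<Squnion>\<^bsub>Hom Q X Z\<^esub> (Cmp Q X Y Z g ` S)"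
    and Cmp_sup_left: "\<lbrakk>X \<in> Obj Q; Y \<in> Obj Q; Z \<in> Obj Q; f \<in> Arrows Q X Y; S \<subseteq> Arrows Q Y Z\<rbrakk>
      \<Longrightarrow> Cmp Q X Y Z (\<Squnion>\<^bsub>Hom Q Y Z\<^esub> S) f = \<Squnion>\<^bsub>Hom Q X Z\<^esub> ((\<lambda>g. Cmp Q X Y Z g f) ` S)"

definition op_quantaloid :: "('o, 'a) quantaloid \<Rightarrow> ('o, 'a) quantaloid" where
  "op_quantaloid Q = \<lparr>Obj = Obj Q, Hom = (\<lambda>X Y. Hom Q Y X), Idt = Idt Q,
     Cmp = (\<lambda>X Y Z g f. Cmp Q Z Y X f g)\<rparr>"

definition full_sub :: "('o, 'a) quantaloid \<Rightarrow> ('o \<Rightarrow> bool) \<Rightarrow> ('o, 'a) quantaloid" where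
  "full_sub Q P = Q\<lparr>Obj := {X \<in> Obj Q. P X}\<rparr>"

definition isomorphic_in :: "('o, 'a) quantaloid \<Rightarrow> 'o \<Rightarrow> 'o \<Rightarrow> bool" where
  "isomorphic_in Q X Y \<longleftrightarrow> (\<exists>f \<in> Arrows Q X Y. \<exists>g \<in> Arrows Q Y X.
     Cmp Q X Y X g f = Idt Q X \<and> Cmp Q Y X Y f g = Idt Q Y)"

locale quantaloid_hom = C: quantaloid C + D: quantaloid D
  for C :: "('o, 'a) quantaloid" and D :: "('p, 'b) quantaloid" +
  fixes Fo :: "'o \<Rightarrow> 'p" and Fa :: "'o \<Rightarrow> 'o \<Rightarrow> 'a \<Rightarrow> 'b"
  assumes Fo_closed: "X \<in> Obj C \<Longrightarrow> Fo X \<in> Obj D"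
    and Fa_closed: "\<lbrakk>X \<in> Obj C; Y \<in> Obj C; f \<in> Arrows C X Y\<rbrakk>
      \<Longrightarrow> Fa X Y f \<in> Arrows D (Fo X) (Fo Y)"
    and Fa_Idt: "X \<in> Obj C \<Longrightarrow> Fa X X (Idt C X) = Idt D (Fo X)"
    and Fa_Cmp: "\<lbrakk>X \<in> Obj C; Y \<in> Obj C; Z \<in> Obj C; f \<in> Arrows C X Y; g \<in> Arrows C Y Z\<rbrakk>
      \<Longrightarrow> Fa X Z (Cmp C X Y Z g f) = Cmp D (Fo X) (Fo Y) (Fo Z) (Fa Y Z g) (Fa X Y f)"
    and Fa_sup: "\<lbrakk>X \<in> Obj C; Y \<in> Obj C; S \<subseteq> Arrows C X Y\<rbrakk>
      \<Longrightarrow> Fa X Y (\<Squnion>\<^bsub>Hom C X Y\<^esub> S) = \<Squnion>\<^bsub>Hom D (Fo X) (Fo Y)\<^esub> (Fa X Y ` S)"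

definition fully_faithful ::
  "('o, 'a) quantaloid \<Rightarrow> ('p, 'b) quantaloid \<Rightarrow> ('o \<Rightarrow> 'p) \<Rightarrow> ('o \<Rightarrow> 'o \<Rightarrow> 'a \<Rightarrow> 'b) \<Rightarrow> bool" where
  "fully_faithful C D Fo Fa \<longleftrightarrow>
     (\<forall>X \<in> Obj C. \<forall>Y \<in> Obj C. bij_betw (Fa X Y) (Arrows C X Y) (Arrows D (Fo X) (Fo Y)))"

definition essentially_surjective ::
  "('o, 'a) quantaloid \<Rightarrow> ('p, 'b) quantaloid \<Rightarrow> ('o \<Rightarrow> 'p) \<Rightarrow> bool" where
  "essentially_surjective C D Fo \<longleftrightarrow> (\<forall>Y \<in> Obj D. \<exists>X \<in> Obj C. isomorphic_in D (Fo X) Y)"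

definition quantaloid_equivalence ::
  "('o, 'a) quantaloid \<Rightarrow> ('p, 'b) quantaloid \<Rightarrow> ('o \<Rightarrow> 'p) \<Rightarrow> ('o \<Rightarrow> 'o \<Rightarrow> 'a \<Rightarrow> 'b) \<Rightarrow> bool" where
  "quantaloid_equivalence C D Fo Fa \<longleftrightarrow>
     quantaloid_hom C D Fo Fa \<and> fully_faithful C D Fo Fa \<and> essentially_surjective C D Fo"

definition dually_equivalent :: "('o, 'a) quantaloid \<Rightarrow> ('p, 'b) quantaloid \<Rightarrow> bool" where
  "dually_equivalent C D \<longleftrightarrow> (\<exists>Fo Fa. quantaloid_equivalence (op_quantaloid C) D Fo Fa)"

section \<open>The quantaloid of diagonals\<close>

text \<open>An object \<open>(X, Y, f)\<close> of the arrow quantaloid is an arrow \<open>f : X \<rightarrow> Y\<close>.\<close>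

definition Arr :: "('o, 'a) quantaloid \<Rightarrow> ('o \<times> 'o \<times> 'a, 'a \<times> 'a) quantaloid" where
  "Arr C = \<lparr>Obj = {(X, Y, f). X \<in> Obj C \<and> Y \<in> Obj C \<and> f \<in> Arrows C X Y},
     Hom = (\<lambda>(X1, Y1, f) (X2, Y2, g).
       \<lparr>carrier = {(u, v). u \<in> Arrows C X1 X2 \<and> v \<in> Arrows C Y1 Y2
                     \<and> Cmp C X1 X2 Y2 g u = Cmp C X1 Y1 Y2 v f},
        eq = (=),
        le = (\<lambda>(u, v) (u', v'). u \<sqsubseteq>\<^bsub>Hom C X1 X2\<^esub> u' \<and> v \<sqsubseteq>\<^bsub>Hom C Y1 Y2\<^esub> v')\<rparr>),
     Idt = (\<lambda>(X, Y, f). (Idt C X, Idt C Y)),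
     Cmp = (\<lambda>(X1, Y1, f) (X2, Y2, g) (X3, Y3, h) (u', v') (u, v).
       (Cmp C X1 X2 X3 u' u, Cmp C Y1 Y2 Y3 v' v))\<rparr>"

definition diag_rel ::
  "('o, 'a) quantaloid \<Rightarrow> 'o \<times> 'o \<times> 'a \<Rightarrow> 'o \<times> 'o \<times> 'a \<Rightarrow> (('a \<times> 'a) \<times> ('a \<times> 'a)) set" where
  "diag_rel C = (\<lambda>(X1, Y1, f) (X2, Y2, g).
     {((u, v), (u', v')). (u, v) \<in> Arrows (Arr C) (X1, Y1, f) (X2, Y2, g)
        \<and> (u', v') \<in> Arrows (Arr C) (X1, Y1, f) (X2, Y2, g)
        \<and> Cmp C X1 X2 Y2 g u = Cmp C X1 Y1 Y2 v f
        \<and> Cmp C X1 Y1 Y2 v f = Cmp C X1 X2 Y2 g u'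
        \<and> Cmp C X1 X2 Y2 g u' = Cmp C X1 Y1 Y2 v' f})"

text \<open>Quotient by a congruence \<open>R\<close>. As joins are computed on representatives, \<open>c\<close> lies below
  \<open>d\<close> iff \<open>d\<close> is the class of the join of representatives of \<open>c\<close> and \<open>d\<close>, that is, iff some
  representative of \<open>c\<close> lies below some representative of \<open>d\<close>.\<close>

definition quotient_quantaloid ::
  "('o, 'a) quantaloid \<Rightarrow> ('o \<Rightarrow> 'o \<Rightarrow> ('a \<times> 'a) set) \<Rightarrow> ('o, 'a set) quantaloid" where
  "quotient_quantaloid C R = \<lparr>Obj = Obj C,
     Hom = (\<lambda>X Y. \<lparr>carrier = Arrows C X Y // R X Y, eq = (=),
                    le = (\<lambda>c d. \<exists>p \<in> c. \<exists>q \<in> d. p \<sqsubseteq>\<^bsub>Hom C X Y\<^esub> q)\<rparr>),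
     Idt = (\<lambda>X. R X X `` {Idt C X}),
     Cmp = (\<lambda>X Y Z d c. \<Union>g \<in> d. \<Union>f \<in> c. R X Z `` {Cmp C X Y Z g f})\<rparr>"

definition Diag :: "('o, 'a) quantaloid \<Rightarrow> ('o \<times> 'o \<times> 'a, ('a \<times> 'a) set) quantaloid" where
  "Diag C = quotient_quantaloid (Arr C) (diag_rel C)"

definition regular_arrow :: "('o, 'a) quantaloid \<Rightarrow> 'o \<times> 'o \<times> 'a \<Rightarrow> bool" where
  "regular_arrow C = (\<lambda>(X, Y, f). \<exists>g \<in> Arrows C Y X. Cmp C X X Y f (Cmp C X Y X g f) = f)"

section \<open>Categories, functors and distributors enriched in a quantaloid\<close>

record ('o, 'q, 'a) qcat =
  objs :: "'a set"
  tp :: "'a \<Rightarrow> 'o"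
  hm :: "'a \<Rightarrow> 'a \<Rightarrow> 'q"

definition is_qcat :: "('o, 'q) quantaloid \<Rightarrow> ('o, 'q, 'a) qcat \<Rightarrow> bool" where
  "is_qcat Q A \<longleftrightarrow>
     (\<forall>x \<in> objs A. tp A x \<in> Obj Q) \<and>
     (\<forall>x \<in> objs A. \<forall>y \<in> objs A. hm A x y \<in> Arrows Q (tp A x) (tp A y)) \<and>
     (\<forall>x \<in> objs A. Idt Q (tp A x) \<sqsubseteq>\<^bsub>Hom Q (tp A x) (tp A x)\<^esub> hm A x x) \<and>
     (\<forall>x \<in> objs A. \<forall>y \<in> objs A. \<forall>z \<in> objs A.
        Cmp Q (tp A x) (tp A y) (tp A z) (hm A y z) (hm A x y)
          \<sqsubseteq>\<^bsub>Hom Q (tp A x) (tp A z)\<^esub> hm A x z)"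

definition qle :: "('o, 'q) quantaloid \<Rightarrow> ('o, 'q, 'a) qcat \<Rightarrow> 'a \<Rightarrow> 'a \<Rightarrow> bool" where
  "qle Q A x y \<longleftrightarrow> tp A x = tp A y \<and> Idt Q (tp A x) \<sqsubseteq>\<^bsub>Hom Q (tp A x) (tp A x)\<^esub> hm A x y"

definition skeletal :: "('o, 'q) quantaloid \<Rightarrow> ('o, 'q, 'a) qcat \<Rightarrow> bool" where
  "skeletal Q A \<longleftrightarrow> (\<forall>x \<in> objs A. \<forall>y \<in> objs A. qle Q A x y \<longrightarrow> qle Q A y x \<longrightarrow> x = y)"

text \<open>Functors are extensional functions, and distributors take the value \<open>undefined\<close> outside
  the object sets, so that equality of functors and of distributors is HOL equality.\<close>

definition qfunctor ::
  "('o, 'q) quantaloid \<Rightarrow> ('o, 'q, 'a) qcat \<Rightarrow> ('o, 'q, 'b) qcat \<Rightarrow> ('a \<Rightarrow> 'b) \<Rightarrow> bool" where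
  "qfunctor Q A B F \<longleftrightarrow> F \<in> objs A \<rightarrow>\<^sub>E objs B \<and>
     (\<forall>x \<in> objs A. tp B (F x) = tp A x) \<and>
     (\<forall>x \<in> objs A. \<forall>y \<in> objs A. hm A x y \<sqsubseteq>\<^bsub>Hom Q (tp A x) (tp A y)\<^esub> hm B (F x) (F y))"

definition adjoint :: "('o, 'q) quantaloid \<Rightarrow> ('o, 'q, 'a) qcat \<Rightarrow> ('o, 'q, 'b) qcat
    \<Rightarrow> ('a \<Rightarrow> 'b) \<Rightarrow> ('b \<Rightarrow> 'a) \<Rightarrow> bool" where
  "adjoint Q A B F G \<longleftrightarrow> qfunctor Q A B F \<and> qfunctor Q B A G \<and>
     (\<forall>x \<in> objs A. qle Q A x (G (F x))) \<and> (\<forall>y \<in> objs B. qle Q B (F (G y)) y)"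

definition qcat_isomorphic ::
  "('o, 'q) quantaloid \<Rightarrow> ('o, 'q, 'a) qcat \<Rightarrow> ('o, 'q, 'b) qcat \<Rightarrow> bool" where
  "qcat_isomorphic Q A B \<longleftrightarrow> (\<exists>F G. qfunctor Q A B F \<and> qfunctor Q B A G \<and>
     (\<forall>x \<in> objs A. G (F x) = x) \<and> (\<forall>y \<in> objs B. F (G y) = y))"

definition on_objs :: "('o, 'q, 'a) qcat \<Rightarrow> ('o, 'q, 'b) qcat \<Rightarrow> ('a \<Rightarrow> 'b \<Rightarrow> 'q) \<Rightarrow> 'a \<Rightarrow> 'b \<Rightarrow> 'q" where
  "on_objs A B \<phi> = (\<lambda>x y. if x \<in> objs A \<and> y \<in> objs B then \<phi> x y else undefined)"

definition distributor ::
  "('o, 'q) quantaloid \<Rightarrow> ('o, 'q, 'a) qcat \<Rightarrow> ('o, 'q, 'b) qcat \<Rightarrow> ('a \<Rightarrow> 'b \<Rightarrow> 'q) \<Rightarrow> bool" where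
  "distributor Q A B \<phi> \<longleftrightarrow>
     (\<forall>x y. x \<notin> objs A \<or> y \<notin> objs B \<longrightarrow> \<phi> x y = undefined) \<and>
     (\<forall>x \<in> objs A. \<forall>y \<in> objs B. \<phi> x y \<in> Arrows Q (tp A x) (tp B y)) \<and>
     (\<forall>x' \<in> objs A. \<forall>x \<in> objs A. \<forall>y \<in> objs B. \<forall>y' \<in> objs B.
        Cmp Q (tp A x') (tp B y) (tp B y') (hm B y y')
            (Cmp Q (tp A x') (tp A x) (tp B y) (\<phi> x y) (hm A x' x))
          \<sqsubseteq>\<^bsub>Hom Q (tp A x') (tp B y')\<^esub> \<phi> x' y')"

definition dist_le :: "('o, 'q) quantaloid \<Rightarrow> ('o, 'q, 'a) qcat \<Rightarrow> ('o, 'q, 'b) qcat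
    \<Rightarrow> ('a \<Rightarrow> 'b \<Rightarrow> 'q) \<Rightarrow> ('a \<Rightarrow> 'b \<Rightarrow> 'q) \<Rightarrow> bool" where
  "dist_le Q A B \<phi> \<psi> \<longleftrightarrow>
     (\<forall>x \<in> objs A. \<forall>y \<in> objs B. \<phi> x y \<sqsubseteq>\<^bsub>Hom Q (tp A x) (tp B y)\<^esub> \<psi> x y)"

definition dist_id :: "('o, 'q, 'a) qcat \<Rightarrow> 'a \<Rightarrow> 'a \<Rightarrow> 'q" where
  "dist_id A = on_objs A A (hm A)"

definition dist_comp ::
  "('o, 'q) quantaloid \<Rightarrow> ('o, 'q, 'a) qcat \<Rightarrow> ('o, 'q, 'b) qcat \<Rightarrow> ('o, 'q, 'c) qcat
    \<Rightarrow> ('b \<Rightarrow> 'c \<Rightarrow> 'q) \<Rightarrow> ('a \<Rightarrow> 'b \<Rightarrow> 'q) \<Rightarrow> 'a \<Rightarrow> 'c \<Rightarrow> 'q" where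
  "dist_comp Q A B C \<psi> \<phi> = on_objs A C (\<lambda>x z. \<Squnion>\<^bsub>Hom Q (tp A x) (tp C z)\<^esub>
     ((\<lambda>y. Cmp Q (tp A x) (tp B y) (tp C z) (\<psi> y z) (\<phi> x y)) ` objs B))"

text \<open>For \<open>\<phi>\<close> from \<open>A\<close> to \<open>B\<close> and \<open>\<chi>\<close> from \<open>A\<close> to \<open>C\<close>, the residual
  \<open>\<chi> \<swarrow> \<phi>\<close> from \<open>B\<close> to \<open>C\<close>. It is not defined within a single quantaloid of distributors
  because the three categories may have objects of different HOL types.\<close>

definition dist_res ::
  "('o, 'q) quantaloid \<Rightarrow> ('o, 'q, 'a) qcat \<Rightarrow> ('o, 'q, 'b) qcat \<Rightarrow> ('o, 'q, 'c) qcat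
    \<Rightarrow> ('a \<Rightarrow> 'c \<Rightarrow> 'q) \<Rightarrow> ('a \<Rightarrow> 'b \<Rightarrow> 'q) \<Rightarrow> 'b \<Rightarrow> 'c \<Rightarrow> 'q" where
  "dist_res Q A B C \<chi> \<phi> = (THE \<rho>. distributor Q B C \<rho> \<and>
     (\<forall>\<psi>. distributor Q B C \<psi> \<longrightarrow>
        (dist_le Q A C (dist_comp Q A B C \<psi> \<phi>) \<chi> \<longleftrightarrow> dist_le Q B C \<psi> \<rho>)))"

section \<open>Presheaves, completeness and complete distributivity\<close>

definition star :: "('o, 'q) quantaloid \<Rightarrow> 'o \<Rightarrow> ('o, 'q, unit) qcat" where
  "star Q X = \<lparr>objs = {()}, tp = (\<lambda>_. X), hm = (\<lambda>_ _. Idt Q X)\<rparr>"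

text \<open>A presheaf is tagged with its type, since \<open>\<mu>\<close> alone need not determine it.\<close>

type_synonym ('o, 'q, 'a) presheaf = "'o \<times> ('a \<Rightarrow> unit \<Rightarrow> 'q)"

definition Psh ::
  "('o, 'q) quantaloid \<Rightarrow> ('o, 'q, 'a) qcat \<Rightarrow> ('o, 'q, ('o, 'q, 'a) presheaf) qcat" where
  "Psh Q A = \<lparr>objs = {(X, \<mu>). X \<in> Obj Q \<and> distributor Q A (star Q X) \<mu>}, tp = fst,
     hm = (\<lambda>(X, \<mu>) (X', \<mu>'). dist_res Q A (star Q X) (star Q X') \<mu>' \<mu> () ())\<rparr>"

definition yoneda :: "('o, 'q) quantaloid \<Rightarrow> ('o, 'q, 'a) qcat \<Rightarrow> 'a \<Rightarrow> ('o, 'q, 'a) presheaf" where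
  "yoneda Q A = (\<lambda>x \<in> objs A. (tp A x, on_objs A (star Q (tp A x)) (\<lambda>y _. hm A y x)))"

definition complete :: "('o, 'q) quantaloid \<Rightarrow> ('o, 'q, 'a) qcat \<Rightarrow> bool" where
  "complete Q A \<longleftrightarrow> (\<exists>s. adjoint Q (Psh Q A) A s (yoneda Q A))"

definition ccd :: "('o, 'q) quantaloid \<Rightarrow> ('o, 'q, 'a) qcat \<Rightarrow> bool" where
  "ccd Q A \<longleftrightarrow> (\<exists>s. adjoint Q (Psh Q A) A s (yoneda Q A) \<and> (\<exists>t. adjoint Q A (Psh Q A) t s))"

section \<open>The quantaloids of distributors and of complete categories\<close>

text \<open>The parameter \<open>sm\<close> selects the object sets that count as small.\<close>

definition QDist :: "('o, 'q) quantaloid \<Rightarrow> ('a set \<Rightarrow> bool)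
    \<Rightarrow> (('o, 'q, 'a) qcat, 'a \<Rightarrow> 'a \<Rightarrow> 'q) quantaloid" where
  "QDist Q sm = \<lparr>Obj = {A. is_qcat Q A \<and> sm (objs A)},
     Hom = (\<lambda>A B. \<lparr>carrier = {\<phi>. distributor Q A B \<phi>}, eq = (=), le = dist_le Q A B\<rparr>),
     Idt = dist_id,
     Cmp = dist_comp Q\<rparr>"

definition QSup :: "('o, 'q) quantaloid \<Rightarrow> ('a set \<Rightarrow> bool)
    \<Rightarrow> (('o, 'q, 'a) qcat, 'a \<Rightarrow> 'a) quantaloid" where
  "QSup Q sm = \<lparr>Obj = {A. is_qcat Q A \<and> sm (objs A) \<and> skeletal Q A \<and> complete Q A},
     Hom = (\<lambda>A B. \<lparr>carrier = {F. \<exists>G. adjoint Q A B F G}, eq = (=),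
                    le = (\<lambda>F G. \<forall>x \<in> objs A. qle Q B (F x) (G x))\<rparr>),
     Idt = (\<lambda>A. \<lambda>x \<in> objs A. x),
     Cmp = (\<lambda>A B C G F. compose (objs A) G F)\<rparr>"

definition QSup_ccd :: "('o, 'q) quantaloid \<Rightarrow> ('a set \<Rightarrow> bool)
    \<Rightarrow> (('o, 'q, 'a) qcat, 'a \<Rightarrow> 'a) quantaloid" where
  "QSup_ccd Q sm = full_sub (QSup Q sm) (ccd Q)"

type_synonym ('o, 'q, 'a) dist_arrow =
  "('o, 'q, 'a) qcat \<times> ('o, 'q, 'a) qcat \<times> ('a \<Rightarrow> 'a \<Rightarrow> 'q)"

type_synonym ('q, 'a) diagonal = "(('a \<Rightarrow> 'a \<Rightarrow> 'q) \<times> ('a \<Rightarrow> 'a \<Rightarrow> 'q)) set"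

definition DDist_reg :: "('o, 'q) quantaloid \<Rightarrow> ('a set \<Rightarrow> bool)
    \<Rightarrow> (('o, 'q, 'a) dist_arrow, ('q, 'a) diagonal) quantaloid" where
  "DDist_reg Q sm = full_sub (Diag (QDist Q sm)) (regular_arrow (QDist Q sm))"

section \<open>The homomorphism given by Kan adjunctions\<close>

definition pull :: "('o, 'q) quantaloid \<Rightarrow> ('o, 'q, 'a) qcat \<Rightarrow> ('o, 'q, 'b) qcat
    \<Rightarrow> ('a \<Rightarrow> 'b \<Rightarrow> 'q) \<Rightarrow> ('o, 'q, 'b) presheaf \<Rightarrow> ('o, 'q, 'a) presheaf" where
  "pull Q A B \<phi> = (\<lambda>(X, l). (X, dist_comp Q A B (star Q X) l \<phi>))"

definition push :: "('o, 'q) quantaloid \<Rightarrow> ('o, 'q, 'a) qcat \<Rightarrow> ('o, 'q, 'b) qcat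
    \<Rightarrow> ('a \<Rightarrow> 'b \<Rightarrow> 'q) \<Rightarrow> ('o, 'q, 'a) presheaf \<Rightarrow> ('o, 'q, 'b) presheaf" where
  "push Q A B \<phi> = (\<lambda>(X, m). (X, dist_res Q A B (star Q X) m \<phi>))"

definition K_obj :: "('o, 'q) quantaloid \<Rightarrow> ('o, 'q, 'a) dist_arrow
    \<Rightarrow> ('o, 'q, ('o, 'q, 'a) presheaf) qcat" where
  "K_obj Q = (\<lambda>(A, B, \<phi>).
     (Psh Q B)\<lparr>objs := {l \<in> objs (Psh Q B). push Q A B \<phi> (pull Q A B \<phi> l) = l}\<rparr>)"

definition K_pair :: "('o, 'q) quantaloid \<Rightarrow> ('o, 'q, 'a) dist_arrow \<Rightarrow> ('o, 'q, 'a) dist_arrow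
    \<Rightarrow> ('a \<Rightarrow> 'a \<Rightarrow> 'q) \<times> ('a \<Rightarrow> 'a \<Rightarrow> 'q)
    \<Rightarrow> ('o, 'q, 'a) presheaf \<Rightarrow> ('o, 'q, 'a) presheaf" where
  "K_pair Q = (\<lambda>(A, B, \<phi>) (A', B', \<psi>) (\<zeta>, \<eta>).
     (\<lambda>l \<in> objs (K_obj Q (A', B', \<psi>)). push Q A B \<phi> (pull Q A B \<phi> (pull Q B B' \<eta> l))))"

text \<open>The common value of \<open>K_pair\<close> on the representatives of a class \<open>c\<close> of arrows from \<open>\<phi>\<close> to
  \<open>\<psi>\<close>; unspecified unless all representatives have the same value.\<close>

definition K_arr :: "('o, 'q) quantaloid \<Rightarrow> ('o, 'q, 'a) dist_arrow \<Rightarrow> ('o, 'q, 'a) dist_arrow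
    \<Rightarrow> ('q, 'a) diagonal \<Rightarrow> ('o, 'q, 'a) presheaf \<Rightarrow> ('o, 'q, 'a) presheaf" where
  "K_arr Q \<phi> \<psi> c = the_elem (K_pair Q \<phi> \<psi> ` c)"

section \<open>Size\<close>

text \<open>A HOL type \<open>'u\<close> serves as a universe: the small sets, of any type, are those of cardinality
  less than that of \<open>'u\<close>. Of a Grothendieck universe only closure under power sets is needed,
  given that the total set of arrows of the base quantaloid is small.\<close>

definition small :: "'u itself \<Rightarrow> 'b set \<Rightarrow> bool" where
  "small U S \<longleftrightarrow> S \<prec> (UNIV :: 'u set)"

definition universe :: "'u itself \<Rightarrow> bool" where
  "universe U \<longleftrightarrow> (\<forall>S :: 'u set. small U S \<longrightarrow> small U (Pow S))"

definition small_quantaloid :: "'u itself \<Rightarrow> ('o, 'q) quantaloid \<Rightarrow> bool" where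
  "small_quantaloid U Q \<longleftrightarrow> quantaloid Q \<and> small U (Obj Q) \<and>
     small U (\<Union>X \<in> Obj Q. \<Union>Y \<in> Obj Q. Arrows Q X Y)"

end

theory Submission
  imports Defs
begin

text \<open>
  Composing with \<open>\<phi>\<close> identifies \<open>K \<phi>\<close> with the image of \<open>\<phi>\<^sup>*\<close>, and there a diagonal
  \<open>d = \<psi> \<circ> \<zeta> = \<eta> \<circ> \<phi>\<close> acts by precomposition with \<open>\<zeta>\<close>. The rows of \<open>d\<close> are the
  values of this functor at the presheaves \<open>\<psi>(-, y)\<close>, so the homomorphism is an order embedding on arrows.
  Conversely, a left adjoint \<open>F\<close> is given by the \<open>d\<close> whose rows are the values of \<open>F\<close> at these
  presheaves, and if \<open>\<psi> = \<psi> \<circ> \<theta> \<circ> \<psi>\<close> then \<open>d = \<psi> \<circ> (\<theta> \<circ> d)\<close>, so \<open>d\<close> is a diagonal. Joins are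
  preserved because order isomorphisms preserve them.

  Regularity of \<open>\<phi>\<close>, witnessed by \<open>\<theta>\<close>, also gives the left adjoint of suprema in \<open>K \<phi>\<close>: an
  element \<open>\<mu> = (\<mu> \<circ> \<theta>) \<circ> \<phi>\<close> of the image is sent to the presheaf generated by the weights
  \<open>\<mu> \<circ> \<theta>\<close> on the rows of \<open>\<phi>\<close>. If, on \<open>C\<close>, \<open>t\<close> is left adjoint to \<open>sup\<close> and \<open>sup\<close> to the
  Yoneda embedding \<open>Y\<close>, then the totally below relation
  \<open>\<theta>(x, y) = t(y)(x)\<close> is idempotent and \<open>\<mu> \<swarrow> \<theta> = Y (sup \<mu>)\<close>, so that \<open>K \<theta>\<close> consists
  of the representable presheaves and is isomorphic to \<open>C\<close>.
\<close>

text \<open>Hom-arrows are handled by testing: \<open>f\<close> lies below the hom-arrow from \<mu>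
  to \<nu> iff the composite of \<open>arr f\<close> with \<mu> lies below \<nu>. So they become
  inequalities between distributors, and joins, residuals and composites are equated by comparing
  bounds. Adjunctions are used in this form too, in which preservation of weighted joins is
  immediate; this is what recovers a left adjoint on \<open>K_obj\<close> from its values at the
  closures of the representables. Both factorizations of a diagonal matter: the one through \<phi>
  makes the functor act on images by composition with \<open>d\<close>, the one through \<psi> makes
  its right adjoint land in \<open>K_obj\<close> of \<psi>. For an arbitrary left adjoint,
  residuation yields the first and regularity the second. Types shape the end of the proof. The
  objects of \<open>K_obj\<close> are presheaves, while the representing distributor has to live on
  the universe type; hence the totally below relation is carried along a bijection. Size is a
  parameter \<open>sm\<close>, so the same lemmas serve with and without a bound on size.\<close>

section \<open>Complete lattices\<close>

lemma complete_latticeI: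
  fixes L (structure)
  assumes "eq L = (=)"
    and "\<And>x. x \<in> carrier L \<Longrightarrow> x \<sqsubseteq> x"
    and "\<And>x y. \<lbrakk>x \<in> carrier L; y \<in> carrier L; x \<sqsubseteq> y; y \<sqsubseteq> x\<rbrakk> \<Longrightarrow> x = y"
    and "\<And>x y z. \<lbrakk>x \<in> carrier L; y \<in> carrier L; z \<in> carrier L; x \<sqsubseteq> y; y \<sqsubseteq> z\<rbrakk> \<Longrightarrow> x \<sqsubseteq> z"
    and ex: "\<And>S. S \<subseteq> carrier L \<Longrightarrow>
      \<exists>s \<in> carrier L. \<forall>y \<in> carrier L. s \<sqsubseteq> y \<longleftrightarrow> (\<forall>x \<in> S. x \<sqsubseteq> y)"
  shows "complete_lattice L"
proof -
  interpret partial_order L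
  proof
    show "x \<sqsubseteq> z" if "x \<sqsubseteq> y" "y \<sqsubseteq> z" "x \<in> carrier L" "y \<in> carrier L" "z \<in> carrier L" for x y z
      by (rule assms(4)[OF that(3-5) that(1,2)])
  qed (simp_all add: assms(1-3))
  show ?thesis
  proof
    fix S assume S: "S \<subseteq> carrier L"
    from ex[OF S] obtain s where s: "s \<in> carrier L"
      "\<And>y. y \<in> carrier L \<Longrightarrow> s \<sqsubseteq> y \<longleftrightarrow> (\<forall>x \<in> S. x \<sqsubseteq> y)"
      by blast
    have "least L s (Upper L S)"
      by (rule least_UpperI) (use S s s(2)[OF s(1)] in \<open>simp_all add: Upper_def subset_iff\<close>)
    then show "\<exists>s. least L s (Upper L S)" ..
  next
    fix S assume S: "S \<subseteq> carrier L"
    \<comment> \<open>The infimum of \<open>S\<close> is the join of its lower bounds, so the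
      hypothesis on joins suffices.\<close>
    have "Lower L S \<subseteq> carrier L" by auto
    from ex[OF this] obtain s where s: "s \<in> carrier L"
      "\<And>y. y \<in> carrier L \<Longrightarrow> s \<sqsubseteq> y \<longleftrightarrow> (\<forall>x \<in> Lower L S. x \<sqsubseteq> y)"
      by blast
    have "s \<sqsubseteq> y" if "y \<in> S" for y
      using s(2)[of y] that S by (auto simp: Lower_def)
    moreover have "y \<sqsubseteq> s" if "y \<in> Lower L S" for y
      using s(1) s(2)[of s] that by simp
    ultimately have "greatest L s (Lower L S)"
      by (intro greatest_LowerI) (use S s(1) in auto)
    then show "\<exists>i. greatest L i (Lower L S)" ..
  qed
qed

lemma (in complete_lattice) sup_le_iff:
  assumes "S \<subseteq> carrier L" "y \<in> carrier L"
  shows "\<Squnion>S \<sqsubseteq> y \<longleftrightarrow> (\<forall>x \<in> S. x \<sqsubseteq> y)"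
proof
  assume "\<Squnion>S \<sqsubseteq> y"
  with assms show "\<forall>x \<in> S. x \<sqsubseteq> y"
    by (meson le_trans subsetD sup_closed sup_upper)
next
  assume "\<forall>x \<in> S. x \<sqsubseteq> y"
  with assms show "\<Squnion>S \<sqsubseteq> y"
    by (intro sup_least) (auto simp: Upper_def)
qed

lemma (in complete_lattice) sup_eqI:
  assumes "S \<subseteq> carrier L" "s \<in> carrier L"
    and "\<And>y. y \<in> carrier L \<Longrightarrow> s \<sqsubseteq> y \<longleftrightarrow> (\<forall>x \<in> S. x \<sqsubseteq> y)"
  shows "\<Squnion>S = s"
proof (rule le_antisym)
  show "\<Squnion>S \<sqsubseteq> s"
    using assms(1,2) assms(3)[of s] by (simp add: sup_le_iff)
  show "s \<sqsubseteq> \<Squnion>S"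
    using assms(3)[OF sup_closed[OF assms(1)]] sup_upper[OF assms(1)] by blast
qed (use assms in simp_all)

section \<open>The hom-lattices of a quantaloid\<close>

context quantaloid
begin

abbreviation hom_le :: "'a \<Rightarrow> 'o \<Rightarrow> 'o \<Rightarrow> 'a \<Rightarrow> bool"
    (\<open>(_/ \<preceq>[_,/ _]/ _)\<close> [51, 0, 0, 51] 50) where
  "f \<preceq>[X, Y] g \<equiv> f \<sqsubseteq>\<^bsub>Hom Q X Y\<^esub> g"

lemma hom_partial_order: "\<lbrakk>X \<in> Obj Q; Y \<in> Obj Q\<rbrakk> \<Longrightarrow> partial_order (Hom Q X Y)"
  using hom_complete complete_lattice.axioms(1) by metis

lemma hom_refl [simp]: "\<lbrakk>X \<in> Obj Q; Y \<in> Obj Q; f \<in> Arrows Q X Y\<rbrakk> \<Longrightarrow> f \<preceq>[X, Y] f"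
  by (rule weak_partial_order.le_refl[OF partial_order.axioms(1)[OF hom_partial_order]])

lemma hom_trans:
  "\<lbrakk>f \<preceq>[X, Y] g; g \<preceq>[X, Y] h; X \<in> Obj Q; Y \<in> Obj Q;
    f \<in> Arrows Q X Y; g \<in> Arrows Q X Y; h \<in> Arrows Q X Y\<rbrakk> \<Longrightarrow> f \<preceq>[X, Y] h"
  by (rule weak_partial_order.le_trans[OF partial_order.axioms(1)[OF hom_partial_order]])

lemma hom_antisym:
  "\<lbrakk>f \<preceq>[X, Y] g; g \<preceq>[X, Y] f; X \<in> Obj Q; Y \<in> Obj Q;
    f \<in> Arrows Q X Y; g \<in> Arrows Q X Y\<rbrakk> \<Longrightarrow> f = g"
  by (rule partial_order.le_antisym[OF hom_partial_order])

lemma Sup_closed [simp]: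
  assumes "X \<in> Obj Q" "Y \<in> Obj Q" "S \<subseteq> Arrows Q X Y"
  shows "\<Squnion>\<^bsub>Hom Q X Y\<^esub> S \<in> Arrows Q X Y"
proof -
  interpret complete_lattice "Hom Q X Y" using assms by (intro hom_complete)
  show ?thesis using assms by simp
qed

lemma Sup_le_iff:
  assumes "X \<in> Obj Q" "Y \<in> Obj Q" "S \<subseteq> Arrows Q X Y" "h \<in> Arrows Q X Y"
  shows "\<Squnion>\<^bsub>Hom Q X Y\<^esub> S \<preceq>[X, Y] h \<longleftrightarrow> (\<forall>f \<in> S. f \<preceq>[X, Y] h)"
  by (rule complete_lattice.sup_le_iff[OF hom_complete]) (use assms in auto)

lemma Sup_upper:
  "\<lbrakk>X \<in> Obj Q; Y \<in> Obj Q; S \<subseteq> Arrows Q X Y; f \<in> S\<rbrakk> \<Longrightarrow> f \<preceq>[X, Y] \<Squnion>\<^bsub>Hom Q X Y\<^esub> S"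
  using Sup_le_iff[of X Y S "\<Squnion>\<^bsub>Hom Q X Y\<^esub> S"] by simp

text \<open>Antisymmetry in the form suited to joins and their composites: these are known through
  their upper bounds, so equality is proved without computing either side. The dual
  \<open>eq_if_same_lower\<close> serves residuals, which are known through their lower
  bounds.\<close>

lemma eq_if_same_upper:
  assumes "X \<in> Obj Q" "Y \<in> Obj Q" "f \<in> Arrows Q X Y" "g \<in> Arrows Q X Y"
    and "\<And>h. h \<in> Arrows Q X Y \<Longrightarrow> f \<preceq>[X, Y] h \<longleftrightarrow> g \<preceq>[X, Y] h"
  shows "f = g"
  using assms(5)[of f] assms(5)[of g] assms(1-4) by (intro hom_antisym) simp_all

lemma eq_if_same_lower:
  assumes "X \<in> Obj Q" "Y \<in> Obj Q" "f \<in> Arrows Q X Y" "g \<in> Arrows Q X Y"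
    and "\<And>h. h \<in> Arrows Q X Y \<Longrightarrow> h \<preceq>[X, Y] f \<longleftrightarrow> h \<preceq>[X, Y] g"
  shows "f = g"
  using assms(5)[of f] assms(5)[of g] assms(1-4) by (intro hom_antisym) simp_all

declare Idt_closed [simp] Cmp_closed [simp] Cmp_Idt_left [simp] Cmp_Idt_right [simp]

lemma Cmp_Sup_le_iff_right:
  assumes "X \<in> Obj Q" "Y \<in> Obj Q" "Z \<in> Obj Q" "S \<subseteq> Arrows Q X Y" "g \<in> Arrows Q Y Z"
    "h \<in> Arrows Q X Z"
  shows "Cmp Q X Y Z g (\<Squnion>\<^bsub>Hom Q X Y\<^esub> S) \<preceq>[X, Z] h
    \<longleftrightarrow> (\<forall>f \<in> S. Cmp Q X Y Z g f \<preceq>[X, Z] h)"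
  using assms by (subst Cmp_sup_right, simp_all, subst Sup_le_iff) auto

lemma Cmp_Sup_le_iff_left:
  assumes "X \<in> Obj Q" "Y \<in> Obj Q" "Z \<in> Obj Q" "f \<in> Arrows Q X Y" "S \<subseteq> Arrows Q Y Z"
    "h \<in> Arrows Q X Z"
  shows "Cmp Q X Y Z (\<Squnion>\<^bsub>Hom Q Y Z\<^esub> S) f \<preceq>[X, Z] h
    \<longleftrightarrow> (\<forall>g \<in> S. Cmp Q X Y Z g f \<preceq>[X, Z] h)"
  using assms by (subst Cmp_sup_left, simp_all, subst Sup_le_iff) auto

text \<open>Monotonicity comes from preservation of a binary join, since \<open>f\<close> lies below
  \<open>f'\<close> iff the join of \<open>{f, f'}\<close> is \<open>f'\<close>.\<close>

lemma Cmp_mono_right: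
  assumes "f \<preceq>[X, Y] f'" "X \<in> Obj Q" "Y \<in> Obj Q" "Z \<in> Obj Q"
    "f \<in> Arrows Q X Y" "f' \<in> Arrows Q X Y" "g \<in> Arrows Q Y Z"
  shows "Cmp Q X Y Z g f \<preceq>[X, Z] Cmp Q X Y Z g f'"
proof -
  have "\<Squnion>\<^bsub>Hom Q X Y\<^esub> {f, f'} = f'"
    using assms by (intro eq_if_same_upper) (auto simp: Sup_le_iff intro: hom_trans)
  then show ?thesis
    using Cmp_Sup_le_iff_right[of X Y Z "{f, f'}" g "Cmp Q X Y Z g f'"] assms by simp
qed

lemma Cmp_mono_left:
  assumes "g \<preceq>[Y, Z] g'" "X \<in> Obj Q" "Y \<in> Obj Q" "Z \<in> Obj Q"
    "f \<in> Arrows Q X Y" "g \<in> Arrows Q Y Z" "g' \<in> Arrows Q Y Z"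
  shows "Cmp Q X Y Z g f \<preceq>[X, Z] Cmp Q X Y Z g' f"
proof -
  have "\<Squnion>\<^bsub>Hom Q Y Z\<^esub> {g, g'} = g'"
    using assms by (intro eq_if_same_upper) (auto simp: Sup_le_iff intro: hom_trans)
  then show ?thesis
    using Cmp_Sup_le_iff_left[of X Y Z f "{g, g'}" "Cmp Q X Y Z g' f"] assms by simp
qed

lemma Cmp_mono:
  assumes "f \<preceq>[X, Y] f'" "g \<preceq>[Y, Z] g'" "X \<in> Obj Q" "Y \<in> Obj Q" "Z \<in> Obj Q"
    "f \<in> Arrows Q X Y" "f' \<in> Arrows Q X Y" "g \<in> Arrows Q Y Z" "g' \<in> Arrows Q Y Z"
  shows "Cmp Q X Y Z g f \<preceq>[X, Z] Cmp Q X Y Z g' f'"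
  using assms by (blast intro: hom_trans Cmp_mono_left Cmp_mono_right Cmp_closed)

end

section \<open>The calculus of distributors\<close>

lemma qcat_tp [simp]: "is_qcat Q A \<Longrightarrow> x \<in> objs A \<Longrightarrow> tp A x \<in> Obj Q"
  and qcat_hm [simp]:
    "is_qcat Q A \<Longrightarrow> x \<in> objs A \<Longrightarrow> y \<in> objs A \<Longrightarrow> hm A x y \<in> Arrows Q (tp A x) (tp A y)"
  and qcat_id: "is_qcat Q A \<Longrightarrow> x \<in> objs A \<Longrightarrow>
    Idt Q (tp A x) \<sqsubseteq>\<^bsub>Hom Q (tp A x) (tp A x)\<^esub> hm A x x"
  and qcat_comp: "is_qcat Q A \<Longrightarrow> x \<in> objs A \<Longrightarrow> y \<in> objs A \<Longrightarrow> z \<in> objs A \<Longrightarrow>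
    Cmp Q (tp A x) (tp A y) (tp A z) (hm A y z) (hm A x y)
          \<sqsubseteq>\<^bsub>Hom Q (tp A x) (tp A z)\<^esub> hm A x z"
  by (simp_all add: is_qcat_def)

lemma dist_arrow [simp]: "distributor Q A B \<phi> \<Longrightarrow> x \<in> objs A \<Longrightarrow> y \<in> objs B \<Longrightarrow>
    \<phi> x y \<in> Arrows Q (tp A x) (tp B y)"
  and dist_undef: "distributor Q A B \<phi> \<Longrightarrow> x \<notin> objs A \<or> y \<notin> objs B \<Longrightarrow> \<phi> x y = undefined"
  by (simp_all add: distributor_def)

lemma dist_ext:
  assumes "distributor Q A B \<phi>" "distributor Q A B \<psi>"
    "\<And>x y. x \<in> objs A \<Longrightarrow> y \<in> objs B \<Longrightarrow> \<phi> x y = \<psi> x y"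
  shows "\<phi> = \<psi>"
proof (intro ext)
  fix x y show "\<phi> x y = \<psi> x y"
    using assms(3) dist_undef[OF assms(1)] dist_undef[OF assms(2)]
    by (cases "x \<in> objs A \<and> y \<in> objs B") auto
qed

lemma star_simps [simp]:
  "objs (star Q X) = {()}" "tp (star Q X) u = X" "hm (star Q X) u v = Idt Q X"
  by (simp_all add: star_def)

lemma on_objs_apply [simp]: "x \<in> objs A \<Longrightarrow> y \<in> objs B \<Longrightarrow> on_objs A B \<phi> x y = \<phi> x y"
  and on_objs_undef: "x \<notin> objs A \<or> y \<notin> objs B \<Longrightarrow> on_objs A B \<phi> x y = undefined"
  by (auto simp: on_objs_def)

context quantaloid
begin

abbreviation "qcat \<equiv> is_qcat Q"
abbreviation "psh \<equiv> Psh Q"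
abbreviation "dst \<equiv> distributor Q"
abbreviation "dle \<equiv> dist_le Q"
abbreviation "cmp \<equiv> dist_comp Q"
abbreviation "res \<equiv> dist_res Q"
abbreviation "one \<equiv> star Q"

lemma star_qcat [simp]: "X \<in> Obj Q \<Longrightarrow> qcat (one X)"
  by (simp add: is_qcat_def)

text \<open>The two-sided action law splits into a right and a left one, with
  \<open>\<phi> x' y\<close> as intermediate bound. Conversely, \<open>dist_act_right\<close> and
  \<open>dist_act_left\<close> insert an identity on the other side.\<close>

lemma distributorI:
  assumes "qcat A" "qcat B"
    and "\<And>x y. x \<notin> objs A \<or> y \<notin> objs B \<Longrightarrow> \<phi> x y = undefined"
    and arr: "\<And>x y. x \<in> objs A \<Longrightarrow> y \<in> objs B \<Longrightarrow> \<phi> x y \<in> Arrows Q (tp A x) (tp B y)"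
    and r: "\<And>x' x y. \<lbrakk>x' \<in> objs A; x \<in> objs A; y \<in> objs B\<rbrakk> \<Longrightarrow>
      Cmp Q (tp A x') (tp A x) (tp B y) (\<phi> x y) (hm A x' x) \<preceq>[tp A x', tp B y] \<phi> x' y"
    and l: "\<And>x y y'. \<lbrakk>x \<in> objs A; y \<in> objs B; y' \<in> objs B\<rbrakk> \<Longrightarrow>
      Cmp Q (tp A x) (tp B y) (tp B y') (hm B y y') (\<phi> x y) \<preceq>[tp A x, tp B y'] \<phi> x y'"
  shows "dst A B \<phi>"
  unfolding distributor_def
proof (intro conjI ballI)
  fix x' x y y' assume *: "x' \<in> objs A" "x \<in> objs A" "y \<in> objs B" "y' \<in> objs B"
  have "Cmp Q (tp A x') (tp B y) (tp B y') (hm B y y')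
      (Cmp Q (tp A x') (tp A x) (tp B y) (\<phi> x y) (hm A x' x)) \<preceq>[tp A x', tp B y']
      Cmp Q (tp A x') (tp B y) (tp B y') (hm B y y') (\<phi> x' y)"
    using * assms(1,2) arr by (intro Cmp_mono_right r) auto
  then show "Cmp Q (tp A x') (tp B y) (tp B y') (hm B y y')
      (Cmp Q (tp A x') (tp A x) (tp B y) (\<phi> x y) (hm A x' x)) \<preceq>[tp A x', tp B y'] \<phi> x' y'"
    by (rule hom_trans[OF _ l]) (use * assms(1,2) arr in auto)
qed (use assms(3) arr in auto)

lemma dist_act_right:
  assumes "qcat A" "qcat B" "dst A B \<phi>" "x' \<in> objs A" "x \<in> objs A" "y \<in> objs B"
  shows "Cmp Q (tp A x') (tp A x) (tp B y) (\<phi> x y) (hm A x' x) \<preceq>[tp A x', tp B y] \<phi> x' y"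
proof -
  let ?f = "Cmp Q (tp A x') (tp A x) (tp B y) (\<phi> x y) (hm A x' x)"
  have f: "?f \<in> Arrows Q (tp A x') (tp B y)" using assms by simp
  have "Cmp Q (tp A x') (tp B y) (tp B y) (Idt Q (tp B y)) ?f \<preceq>[tp A x', tp B y]
      Cmp Q (tp A x') (tp B y) (tp B y) (hm B y y) ?f"
    using assms f by (intro Cmp_mono_left qcat_id) auto
  then have "?f \<preceq>[tp A x', tp B y] Cmp Q (tp A x') (tp B y) (tp B y) (hm B y y) ?f"
    using assms f by simp
  moreover have "Cmp Q (tp A x') (tp B y) (tp B y) (hm B y y) ?f \<preceq>[tp A x', tp B y] \<phi> x' y"
    using assms by (auto simp: distributor_def)
  ultimately show ?thesis
    by (rule hom_trans) (use assms f in auto)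
qed

lemma dist_act_left:
  assumes "qcat A" "qcat B" "dst A B \<phi>" "x \<in> objs A" "y \<in> objs B" "y' \<in> objs B"
  shows "Cmp Q (tp A x) (tp B y) (tp B y') (hm B y y') (\<phi> x y) \<preceq>[tp A x, tp B y'] \<phi> x y'"
proof -
  have "Cmp Q (tp A x) (tp A x) (tp B y) (\<phi> x y) (Idt Q (tp A x)) \<preceq>[tp A x, tp B y]
      Cmp Q (tp A x) (tp A x) (tp B y) (\<phi> x y) (hm A x x)"
    using assms by (intro Cmp_mono_right qcat_id) auto
  then have "\<phi> x y \<preceq>[tp A x, tp B y] Cmp Q (tp A x) (tp A x) (tp B y) (\<phi> x y) (hm A x x)"
    using assms by simp
  then have "Cmp Q (tp A x) (tp B y) (tp B y') (hm B y y') (\<phi> x y) \<preceq>[tp A x, tp B y']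
     Cmp Q (tp A x) (tp B y) (tp B y') (hm B y y')
      (Cmp Q (tp A x) (tp A x) (tp B y) (\<phi> x y) (hm A x x))"
    using assms by (intro Cmp_mono_right) auto
  moreover have "Cmp Q (tp A x) (tp B y) (tp B y') (hm B y y')
      (Cmp Q (tp A x) (tp A x) (tp B y) (\<phi> x y) (hm A x x)) \<preceq>[tp A x, tp B y'] \<phi> x y'"
    using assms by (auto simp: distributor_def)
  ultimately show ?thesis
    by (rule hom_trans) (use assms in auto)
qed

lemma dist_le_refl [simp]: "\<lbrakk>qcat A; qcat B; dst A B \<phi>\<rbrakk> \<Longrightarrow> dle A B \<phi> \<phi>"
  by (simp add: dist_le_def)

lemma dist_le_trans:
  assumes "dle A B \<phi> \<psi>" "dle A B \<psi> \<chi>" "qcat A" "qcat B" "dst A B \<phi>" "dst A B \<psi>" "dst A B \<chi>"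
  shows "dle A B \<phi> \<chi>"
  unfolding dist_le_def
proof (intro ballI)
  fix x y assume xy: "x \<in> objs A" "y \<in> objs B"
  show "\<phi> x y \<preceq>[tp A x, tp B y] \<chi> x y"
  proof (rule hom_trans)
    show "\<phi> x y \<preceq>[tp A x, tp B y] \<psi> x y" "\<psi> x y \<preceq>[tp A x, tp B y] \<chi> x y"
      using assms(1,2) xy by (simp_all add: dist_le_def)
  qed (use assms xy in simp_all)
qed

lemma dist_le_antisym:
  assumes "dle A B \<phi> \<psi>" "dle A B \<psi> \<phi>" "qcat A" "qcat B" "dst A B \<phi>" "dst A B \<psi>"
  shows "\<phi> = \<psi>"
  using assms by (intro dist_ext[of Q A B]) (auto simp: dist_le_def intro!: hom_antisym)

lemma dist_eq_if_same_lower: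
  assumes "qcat A" "qcat B" "dst A B \<phi>" "dst A B \<psi>"
    and "\<And>\<chi>. dst A B \<chi> \<Longrightarrow> dle A B \<chi> \<phi> \<longleftrightarrow> dle A B \<chi> \<psi>"
  shows "\<phi> = \<psi>"
  using assms(5)[of \<phi>] assms(5)[of \<psi>] assms(1-4) by (intro dist_le_antisym) simp_all

lemma dist_eq_if_same_upper:
  assumes "qcat A" "qcat B" "dst A B \<phi>" "dst A B \<psi>"
    and "\<And>\<chi>. dst A B \<chi> \<Longrightarrow> dle A B \<phi> \<chi> \<longleftrightarrow> dle A B \<psi> \<chi>"
  shows "\<phi> = \<psi>"
  using assms(5)[of \<phi>] assms(5)[of \<psi>] assms(1-4) by (intro dist_le_antisym) simp_all

lemma dist_comp_apply:
  "x \<in> objs A \<Longrightarrow> z \<in> objs C \<Longrightarrow> cmp A B C \<psi> \<phi> x z = \<Squnion>\<^bsub>Hom Q (tp A x) (tp C z)\<^esub>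
     ((\<lambda>y. Cmp Q (tp A x) (tp B y) (tp C z) (\<psi> y z) (\<phi> x y)) ` objs B)"
  by (simp add: dist_comp_def)

context
  fixes A :: "('o, 'a, 'b) qcat" and B :: "('o, 'a, 'c) qcat" and C :: "('o, 'a, 'd) qcat"
    and \<phi> \<psi>
  assumes AB [simp]: "qcat A" "qcat B" "qcat C" "dst A B \<phi>" "dst B C \<psi>"
begin

lemma dist_comp_arrow [simp]:
  "x \<in> objs A \<Longrightarrow> z \<in> objs C \<Longrightarrow> cmp A B C \<psi> \<phi> x z \<in> Arrows Q (tp A x) (tp C z)"
  by (subst dist_comp_apply) (auto intro!: Sup_closed)

lemma dist_comp_le_iff:
  "x \<in> objs A \<Longrightarrow> z \<in> objs C \<Longrightarrow> h \<in> Arrows Q (tp A x) (tp C z) \<Longrightarrow>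
   cmp A B C \<psi> \<phi> x z \<preceq>[tp A x, tp C z] h \<longleftrightarrow> (\<forall>y \<in> objs B.
      Cmp Q (tp A x) (tp B y) (tp C z) (\<psi> y z) (\<phi> x y) \<preceq>[tp A x, tp C z] h)"
  by (simp add: dist_comp_apply, subst Sup_le_iff) auto

lemma dist_comp_upper:
  "x \<in> objs A \<Longrightarrow> z \<in> objs C \<Longrightarrow> y \<in> objs B \<Longrightarrow>
   Cmp Q (tp A x) (tp B y) (tp C z) (\<psi> y z) (\<phi> x y) \<preceq>[tp A x, tp C z] cmp A B C \<psi> \<phi> x z"
  using dist_comp_le_iff[of x z "cmp A B C \<psi> \<phi> x z"] by simp

text \<open>A composite with a join is tested summand by summand. The outer arrow is already
  absorbed into the neighbouring factor, which is the form needed for associativity and for the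
  action laws of composites.\<close>

lemma Cmp_dist_comp_le_iff_right:
  "\<lbrakk>x \<in> objs A; z \<in> objs C; W \<in> Obj Q; g \<in> Arrows Q (tp C z) W; h \<in> Arrows Q (tp A x) W\<rbrakk> \<Longrightarrow>
   Cmp Q (tp A x) (tp C z) W g (cmp A B C \<psi> \<phi> x z) \<preceq>[tp A x, W] h \<longleftrightarrow>
   (\<forall>y \<in> objs B. Cmp Q (tp A x) (tp B y) W (Cmp Q (tp B y) (tp C z) W g (\<psi> y z)) (\<phi> x y)
      \<preceq>[tp A x, W] h)"
  by (simp add: dist_comp_apply, subst Cmp_Sup_le_iff_right) (auto simp: Cmp_assoc)

lemma Cmp_dist_comp_le_iff_left:
  "\<lbrakk>x \<in> objs A; z \<in> objs C; W \<in> Obj Q; f \<in> Arrows Q W (tp A x); h \<in> Arrows Q W (tp C z)\<rbrakk> \<Longrightarrow>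
   Cmp Q W (tp A x) (tp C z) (cmp A B C \<psi> \<phi> x z) f \<preceq>[W, tp C z] h \<longleftrightarrow>
   (\<forall>y \<in> objs B. Cmp Q W (tp B y) (tp C z) (\<psi> y z) (Cmp Q W (tp A x) (tp B y) (\<phi> x y) f)
      \<preceq>[W, tp C z] h)"
  by (simp add: dist_comp_apply, subst Cmp_Sup_le_iff_left) (auto simp: Cmp_assoc)

lemma dist_comp_dist [simp]: "dst A C (cmp A B C \<psi> \<phi>)"
proof (rule distributorI)
  fix x' x z assume *: "x' \<in> objs A" "x \<in> objs A" "z \<in> objs C"
  have "Cmp Q (tp A x') (tp B y) (tp C z) (\<psi> y z) (Cmp Q (tp A x') (tp A x) (tp B y) (\<phi> x y) (hm A x' x))
      \<preceq>[tp A x', tp C z] cmp A B C \<psi> \<phi> x' z" if "y \<in> objs B" for y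
    by (rule hom_trans[OF Cmp_mono_right[OF dist_act_right] dist_comp_upper])
      (use * that in \<open>auto\<close>)
  then show "Cmp Q (tp A x') (tp A x) (tp C z) (cmp A B C \<psi> \<phi> x z) (hm A x' x)
      \<preceq>[tp A x', tp C z] cmp A B C \<psi> \<phi> x' z"
    using * by (subst Cmp_dist_comp_le_iff_left) auto
next
  fix x z z' assume *: "x \<in> objs A" "z \<in> objs C" "z' \<in> objs C"
  have "Cmp Q (tp A x) (tp B y) (tp C z') (Cmp Q (tp B y) (tp C z) (tp C z') (hm C z z') (\<psi> y z)) (\<phi> x y)
      \<preceq>[tp A x, tp C z'] cmp A B C \<psi> \<phi> x z'" if "y \<in> objs B" for y
    by (rule hom_trans[OF Cmp_mono_left[OF dist_act_left] dist_comp_upper])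
      (use * that in \<open>auto\<close>)
  then show "Cmp Q (tp A x) (tp C z) (tp C z') (hm C z z') (cmp A B C \<psi> \<phi> x z)
      \<preceq>[tp A x, tp C z'] cmp A B C \<psi> \<phi> x z'"
    using * by (subst Cmp_dist_comp_le_iff_right) auto
qed (auto simp: dist_comp_def on_objs_undef dist_comp_apply intro!: Sup_closed)

lemma dist_comp_dle_iff:
  "dst A C \<chi> \<Longrightarrow> dle A C (cmp A B C \<psi> \<phi>) \<chi> \<longleftrightarrow> (\<forall>x \<in> objs A. \<forall>y \<in> objs B. \<forall>z \<in> objs C.
     Cmp Q (tp A x) (tp B y) (tp C z) (\<psi> y z) (\<phi> x y) \<preceq>[tp A x, tp C z] \<chi> x z)"
  unfolding dist_le_def using dist_comp_le_iff by (auto simp: Ball_def)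

end

lemma dist_comp_assoc:
  assumes [simp]: "qcat A" "qcat B" "qcat C" "qcat D"
    "dst A B \<phi>" "dst B C \<psi>" "dst C D \<chi>"
  shows "cmp A B D (cmp B C D \<chi> \<psi>) \<phi> = cmp A C D \<chi> (cmp A B C \<psi> \<phi>)"
proof (rule dist_ext[of Q A D])
  fix x w assume [simp]: "x \<in> objs A" "w \<in> objs D"
  show "cmp A B D (cmp B C D \<chi> \<psi>) \<phi> x w = cmp A C D \<chi> (cmp A B C \<psi> \<phi>) x w"
    by (rule eq_if_same_upper[of "tp A x" "tp D w"])
      (auto simp: dist_comp_le_iff Cmp_dist_comp_le_iff_left Cmp_dist_comp_le_iff_right Cmp_assoc)
qed simp_all

lemma dist_id_dist [simp]: "qcat A \<Longrightarrow> dst A A (dist_id A)"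
  by (rule distributorI) (auto simp: dist_id_def on_objs_undef intro: qcat_comp)

lemma dist_id_apply [simp]: "x \<in> objs A \<Longrightarrow> y \<in> objs A \<Longrightarrow> dist_id A x y = hm A x y"
  by (simp add: dist_id_def)

lemma dist_comp_mono:
  assumes [simp]: "qcat A" "qcat B" "qcat C"
    "dst A B \<phi>" "dst A B \<phi>'" "dst B C \<psi>" "dst B C \<psi>'" and "dle A B \<phi> \<phi>'" "dle B C \<psi> \<psi>'"
  shows "dle A C (cmp A B C \<psi> \<phi>) (cmp A B C \<psi>' \<phi>')"
proof (subst dist_comp_dle_iff)
  show "\<forall>x \<in> objs A. \<forall>y \<in> objs B. \<forall>z \<in> objs C.
      Cmp Q (tp A x) (tp B y) (tp C z) (\<psi> y z) (\<phi> x y) \<preceq>[tp A x, tp C z] cmp A B C \<psi>' \<phi>' x z"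
    using assms(8,9) by (auto simp: dist_le_def intro!: hom_trans[OF Cmp_mono dist_comp_upper])
qed simp_all

lemma dist_comp_id_right [simp]:
  assumes [simp]: "qcat A" "qcat B" "dst A B \<phi>"
  shows "cmp A A B \<phi> (dist_id A) = \<phi>"
proof (rule dist_le_antisym)
  show "dle A B (cmp A A B \<phi> (dist_id A)) \<phi>"
    by (simp add: dist_comp_dle_iff dist_act_right)
  show "dle A B \<phi> (cmp A A B \<phi> (dist_id A))"
    unfolding dist_le_def
  proof (intro ballI)
    fix x y assume [simp]: "x \<in> objs A" "y \<in> objs B"
    \<comment> \<open>The summand at \<open>x\<close> dominates \<open>\<phi> x y\<close>, because
      the identity lies below \<open>hm A x x\<close>.\<close>
    have "Cmp Q (tp A x) (tp A x) (tp B y) (\<phi> x y) (Idt Q (tp A x)) \<preceq>[tp A x, tp B y]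
      Cmp Q (tp A x) (tp A x) (tp B y) (\<phi> x y) (dist_id A x x)"
      by (rule Cmp_mono_right) (simp_all add: qcat_id)
    then have "Cmp Q (tp A x) (tp A x) (tp B y) (\<phi> x y) (Idt Q (tp A x)) \<preceq>[tp A x, tp B y]
      cmp A A B \<phi> (dist_id A) x y"
      by (rule hom_trans[OF _ dist_comp_upper]) simp_all
    then show "\<phi> x y \<preceq>[tp A x, tp B y] cmp A A B \<phi> (dist_id A) x y"
      by simp
  qed
qed simp_all

lemma dist_comp_id_left [simp]:
  assumes [simp]: "qcat A" "qcat B" "dst A B \<phi>"
  shows "cmp A B B (dist_id B) \<phi> = \<phi>"
proof (rule dist_le_antisym)
  show "dle A B (cmp A B B (dist_id B) \<phi>) \<phi>"
    by (simp add: dist_comp_dle_iff dist_act_left)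
  show "dle A B \<phi> (cmp A B B (dist_id B) \<phi>)"
    unfolding dist_le_def
  proof (intro ballI)
    fix x y assume [simp]: "x \<in> objs A" "y \<in> objs B"
    have "Cmp Q (tp A x) (tp B y) (tp B y) (Idt Q (tp B y)) (\<phi> x y) \<preceq>[tp A x, tp B y]
      Cmp Q (tp A x) (tp B y) (tp B y) (dist_id B y y) (\<phi> x y)"
      by (rule Cmp_mono_left) (simp_all add: qcat_id)
    then have "Cmp Q (tp A x) (tp B y) (tp B y) (Idt Q (tp B y)) (\<phi> x y) \<preceq>[tp A x, tp B y]
      cmp A B B (dist_id B) \<phi> x y"
      by (rule hom_trans[OF _ dist_comp_upper]) simp_all
    then show "\<phi> x y \<preceq>[tp A x, tp B y] cmp A B B (dist_id B) \<phi> x y"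
      by simp
  qed
qed simp_all

lemma dist_id_star: "dist_id (one X) = (\<lambda>_ _. Idt Q X)"
  by (intro ext) (simp add: dist_id_def)


text \<open>The residual is built pointwise as the join of all admissible \<open>g\<close>; since
  composition preserves joins, this join is itself admissible. One condition on \<open>g\<close>
  covers all \<open>x\<close>, in place of a meet of residuals in Q.\<close>

lemma dist_res_ex:
  assumes [simp]: "qcat A" "qcat B" "qcat C" "dst A B \<phi>" "dst A C \<chi>"
  shows "\<exists>\<rho>. dst B C \<rho> \<and> (\<forall>y \<in> objs B. \<forall>z \<in> objs C. \<forall>g \<in> Arrows Q (tp B y) (tp C z).
    g \<preceq>[tp B y, tp C z] \<rho> y z \<longleftrightarrow>
    (\<forall>x \<in> objs A. Cmp Q (tp A x) (tp B y) (tp C z) g (\<phi> x y) \<preceq>[tp A x, tp C z] \<chi> x z))"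
proof -
  define S where "S y z = {g \<in> Arrows Q (tp B y) (tp C z). \<forall>x \<in> objs A.
     Cmp Q (tp A x) (tp B y) (tp C z) g (\<phi> x y) \<preceq>[tp A x, tp C z] \<chi> x z}" for y z
  define \<rho> where "\<rho> = on_objs B C (\<lambda>y z. \<Squnion>\<^bsub>Hom Q (tp B y) (tp C z)\<^esub> (S y z))"
  have \<rho>_arr [simp]: "\<rho> y z \<in> Arrows Q (tp B y) (tp C z)" if "y \<in> objs B" "z \<in> objs C" for y z
    using that unfolding \<rho>_def by (auto intro!: Sup_closed simp: S_def)
  have S_\<rho>: "\<rho> y z \<in> S y z" if "y \<in> objs B" "z \<in> objs C" for y z
  proof -
    have "Cmp Q (tp A x) (tp B y) (tp C z) (\<Squnion>\<^bsub>Hom Q (tp B y) (tp C z)\<^esub> (S y z)) (\<phi> x y)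
      \<preceq>[tp A x, tp C z] \<chi> x z" if "x \<in> objs A" for x
      using that \<open>y \<in> objs B\<close> \<open>z \<in> objs C\<close> by (subst Cmp_Sup_le_iff_left) (auto simp: S_def)
    then show ?thesis using that \<rho>_arr[OF that] by (simp add: S_def \<rho>_def)
  qed
  have char: "g \<preceq>[tp B y, tp C z] \<rho> y z \<longleftrightarrow>
      (\<forall>x \<in> objs A. Cmp Q (tp A x) (tp B y) (tp C z) g (\<phi> x y) \<preceq>[tp A x, tp C z] \<chi> x z)"
    if yz: "y \<in> objs B" "z \<in> objs C" and g: "g \<in> Arrows Q (tp B y) (tp C z)" for y z g
  proof (intro iffI ballI)
    fix x assume le: "g \<preceq>[tp B y, tp C z] \<rho> y z" and x: "x \<in> objs A"
    have "Cmp Q (tp A x) (tp B y) (tp C z) g (\<phi> x y) \<preceq>[tp A x, tp C z]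
        Cmp Q (tp A x) (tp B y) (tp C z) (\<rho> y z) (\<phi> x y)"
      using le x yz g by (intro Cmp_mono_left) auto
    moreover have "Cmp Q (tp A x) (tp B y) (tp C z) (\<rho> y z) (\<phi> x y) \<preceq>[tp A x, tp C z] \<chi> x z"
      using S_\<rho>[OF yz] x by (simp add: S_def)
    ultimately show "Cmp Q (tp A x) (tp B y) (tp C z) g (\<phi> x y) \<preceq>[tp A x, tp C z] \<chi> x z"
      by (rule hom_trans) (use x yz g in auto)
  next
    assume "\<forall>x \<in> objs A. Cmp Q (tp A x) (tp B y) (tp C z) g (\<phi> x y) \<preceq>[tp A x, tp C z] \<chi> x z"
    then have "g \<in> S y z" using g by (simp add: S_def)
    then show "g \<preceq>[tp B y, tp C z] \<rho> y z"
      using yz unfolding \<rho>_def by (simp, intro Sup_upper) (auto simp: S_def)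
  qed
  \<comment> \<open>Both action laws are verified by testing with \<open>char\<close>: the action of
    \<open>C\<close> is absorbed by \<chi>, that of \<open>B\<close> by \<phi>.\<close>
  have "dst B C \<rho>"
  proof (rule distributorI)
    fix y z z' assume *[simp]: "y \<in> objs B" "z \<in> objs C" "z' \<in> objs C"
    show "Cmp Q (tp B y) (tp C z) (tp C z') (hm C z z') (\<rho> y z) \<preceq>[tp B y, tp C z'] \<rho> y z'"
    proof (subst char, simp_all, intro ballI)
      fix x assume [simp]: "x \<in> objs A"
      have "Cmp Q (tp A x) (tp C z) (tp C z') (hm C z z') (Cmp Q (tp A x) (tp B y) (tp C z) (\<rho> y z) (\<phi> x y))
        \<preceq>[tp A x, tp C z'] Cmp Q (tp A x) (tp C z) (tp C z') (hm C z z') (\<chi> x z)"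
        using S_\<rho>[of y z] by (intro Cmp_mono_right) (auto simp: S_def)
      then show "Cmp Q (tp A x) (tp B y) (tp C z') (Cmp Q (tp B y) (tp C z) (tp C z') (hm C z z') (\<rho> y z)) (\<phi> x y)
         \<preceq>[tp A x, tp C z'] \<chi> x z'"
        by (subst Cmp_assoc, simp_all) (rule hom_trans[OF _ dist_act_left[where y = z]], simp_all)
    qed
  next
    fix y' y z assume *[simp]: "y' \<in> objs B" "y \<in> objs B" "z \<in> objs C"
    show "Cmp Q (tp B y') (tp B y) (tp C z) (\<rho> y z) (hm B y' y) \<preceq>[tp B y', tp C z] \<rho> y' z"
    proof (subst char, simp_all, intro ballI)
      fix x assume [simp]: "x \<in> objs A"
      have "Cmp Q (tp A x) (tp B y) (tp C z) (\<rho> y z) (Cmp Q (tp A x) (tp B y') (tp B y) (hm B y' y) (\<phi> x y'))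
        \<preceq>[tp A x, tp C z] Cmp Q (tp A x) (tp B y) (tp C z) (\<rho> y z) (\<phi> x y)"
        by (intro Cmp_mono_right dist_act_left) simp_all
      moreover have "Cmp Q (tp A x) (tp B y) (tp C z) (\<rho> y z) (\<phi> x y) \<preceq>[tp A x, tp C z] \<chi> x z"
        using S_\<rho>[of y z] by (simp add: S_def)
      ultimately have "Cmp Q (tp A x) (tp B y) (tp C z) (\<rho> y z) (Cmp Q (tp A x) (tp B y') (tp B y) (hm B y' y) (\<phi> x y'))
        \<preceq>[tp A x, tp C z] \<chi> x z"
        by (rule hom_trans) simp_all
      then show "Cmp Q (tp A x) (tp B y') (tp C z) (Cmp Q (tp B y') (tp B y) (tp C z) (\<rho> y z) (hm B y' y)) (\<phi> x y')
         \<preceq>[tp A x, tp C z] \<chi> x z"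
        by (simp add: Cmp_assoc)
    qed
  qed (auto simp: \<rho>_def on_objs_undef S_def intro!: Sup_closed)
  with char show ?thesis by blast
qed

text \<open>The adjunction property determines the residual, so the definite description agrees with
  the pointwise construction of \<open>dist_res_ex\<close>, and both descriptions become
  available.\<close>

lemma dist_res_props:
  assumes [simp]: "qcat A" "qcat B" "qcat C" "dst A B \<phi>" "dst A C \<chi>"
  shows dist_res_dist [simp]: "dst B C (res A B C \<chi> \<phi>)" (is ?th1)
    and dist_res_le_iff: "\<And>y z g. \<lbrakk>y \<in> objs B; z \<in> objs C; g \<in> Arrows Q (tp B y) (tp C z)\<rbrakk> \<Longrightarrow>
      g \<preceq>[tp B y, tp C z] res A B C \<chi> \<phi> y z \<longleftrightarrow>
      (\<forall>x \<in> objs A. Cmp Q (tp A x) (tp B y) (tp C z) g (\<phi> x y) \<preceq>[tp A x, tp C z] \<chi> x z)"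
        (is "PROP ?th2")
    and dist_res_adj: "\<And>\<psi>. dst B C \<psi> \<Longrightarrow>
      dle A C (cmp A B C \<psi> \<phi>) \<chi> \<longleftrightarrow> dle B C \<psi> (res A B C \<chi> \<phi>)" (is "PROP ?th3")
proof -
  from dist_res_ex[OF assms] obtain \<rho> where \<rho> [simp]: "dst B C \<rho>" and
    char: "\<And>y z g. \<lbrakk>y \<in> objs B; z \<in> objs C; g \<in> Arrows Q (tp B y) (tp C z)\<rbrakk> \<Longrightarrow>
      g \<preceq>[tp B y, tp C z] \<rho> y z \<longleftrightarrow>
      (\<forall>x \<in> objs A. Cmp Q (tp A x) (tp B y) (tp C z) g (\<phi> x y) \<preceq>[tp A x, tp C z] \<chi> x z)"
    by blast
  have adj: "dle A C (cmp A B C \<psi> \<phi>) \<chi> \<longleftrightarrow> dle B C \<psi> \<rho>" if [simp]: "dst B C \<psi>" for \<psi>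
    by (subst dist_comp_dle_iff, simp_all) (auto simp: dist_le_def char)
  have "res A B C \<chi> \<phi> = \<rho>"
    unfolding dist_res_def
  proof (rule the_equality)
    fix \<rho>' assume *: "dst B C \<rho>' \<and> (\<forall>\<psi>. dst B C \<psi> \<longrightarrow>
      (dle A C (cmp A B C \<psi> \<phi>) \<chi> \<longleftrightarrow> dle B C \<psi> \<rho>'))"
    show "\<rho>' = \<rho>"
      by (rule dist_eq_if_same_lower[of B C]) (use * adj in auto)
  qed (use adj in auto)
  then show ?th1 "PROP ?th2" "PROP ?th3"
    using \<rho> char adj by simp_all
qed

lemma dist_res_counit:
  assumes [simp]: "qcat A" "qcat B" "qcat C" "dst A B \<phi>" "dst A C \<chi>"
  shows "dle A C (cmp A B C (res A B C \<chi> \<phi>) \<phi>) \<chi>"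
  by (simp add: dist_res_adj)

lemma dist_res_unit:
  assumes [simp]: "qcat A" "qcat B" "qcat C" "dst A B \<phi>" "dst B C \<psi>"
  shows "dle B C \<psi> (res A B C (cmp A B C \<psi> \<phi>) \<phi>)"
  by (simp flip: dist_res_adj)

lemma dist_comp_mono_left:
  assumes "dle B C \<psi> \<psi>'" "qcat A" "qcat B" "qcat C"
    "dst A B \<phi>" "dst B C \<psi>" "dst B C \<psi>'"
  shows "dle A C (cmp A B C \<psi> \<phi>) (cmp A B C \<psi>' \<phi>)"
  using assms by (intro dist_comp_mono) auto

lemma dist_comp_mono_right:
  assumes "dle A B \<phi> \<phi>'" "qcat A" "qcat B" "qcat C"
    "dst A B \<phi>" "dst A B \<phi>'" "dst B C \<psi>"
  shows "dle A C (cmp A B C \<psi> \<phi>) (cmp A B C \<psi> \<phi>')"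
  using assms by (intro dist_comp_mono) auto

text \<open>A triangle identity of residuation. It is the reason why a closed presheaf and its image
  under composition with \<phi> determine each other.\<close>

lemma dist_comp_res_comp [simp]:
  assumes [simp]: "qcat A" "qcat B" "qcat C" "dst A B \<phi>" "dst B C \<psi>"
  shows "cmp A B C (res A B C (cmp A B C \<psi> \<phi>) \<phi>) \<phi> = cmp A B C \<psi> \<phi>"
  by (rule dist_le_antisym[of A C]) (simp_all add: dist_res_counit dist_comp_mono_left dist_res_unit)

section \<open>Presheaves\<close>

text \<open>An arrow of Q as a distributor between one-object categories, so that scaling a presheaf
  by an arrow is a composite of distributors.\<close>

definition arr :: "'a \<Rightarrow> unit \<Rightarrow> unit \<Rightarrow> 'a" where
  "arr f = (\<lambda>_ _. f)"

lemma arr_apply [simp]: "arr f u v = f"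
  by (simp add: arr_def)

lemma arr_dist [simp]: "X \<in> Obj Q \<Longrightarrow> Y \<in> Obj Q \<Longrightarrow> f \<in> Arrows Q X Y \<Longrightarrow> dst (one X) (one Y) (arr f)"
  by (rule distributorI) auto

lemma arr_comp:
  assumes "X \<in> Obj Q" "Y \<in> Obj Q" "Z \<in> Obj Q" "f \<in> Arrows Q X Y" "g \<in> Arrows Q Y Z"
  shows "cmp (one X) (one Y) (one Z) (arr g) (arr f) = arr (Cmp Q X Y Z g f)"
proof (intro ext)
  fix u v :: unit
  show "cmp (one X) (one Y) (one Z) (arr g) (arr f) u v = arr (Cmp Q X Y Z g f) u v"
    using assms by (intro eq_if_same_upper[of X Z])
      (use dist_comp_arrow[of "one X" "one Y" "one Z" "arr f" "arr g" u v]
        dist_comp_le_iff[of "one X" "one Y" "one Z" "arr f" "arr g" u v] in simp_all)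
qed

lemma arr_Idt_comp [simp]: "\<lbrakk>qcat A; X \<in> Obj Q; dst A (one X) \<mu>\<rbrakk> \<Longrightarrow>
    cmp A (one X) (one X) (arr (Idt Q X)) \<mu> = \<mu>"
  using dist_comp_id_left[of A "one X" \<mu>] by (simp add: dist_id_star arr_def)

lemma Psh_obj_iff [simp]: "(X, \<mu>) \<in> objs (psh A) \<longleftrightarrow> X \<in> Obj Q \<and> dst A (one X) \<mu>"
  and Psh_tp [simp]: "tp (psh A) p = fst p"
  by (simp_all add: Psh_def)

context
  fixes A :: "('o, 'a, 'b) qcat" and X Y \<mu> \<nu>
  assumes A [simp]: "qcat A" "X \<in> Obj Q" "Y \<in> Obj Q" "dst A (one X) \<mu>" "dst A (one Y) \<nu>"
begin

lemma hm_Psh_closed [simp]: "hm (psh A) (X, \<mu>) (Y, \<nu>) \<in> Arrows Q X Y"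
  using dist_arrow[OF dist_res_dist[of A "one X" "one Y" \<mu> \<nu>], of "()" "()"] by (simp add: Psh_def)

text \<open>The residual adjunction tested at \<open>arr f\<close>; in later computations it
  replaces the residual that defines \<open>hm (psh A)\<close>.\<close>

lemma hm_Psh_iff: "f \<in> Arrows Q X Y \<Longrightarrow> f \<preceq>[X, Y] hm (psh A) (X, \<mu>) (Y, \<nu>) \<longleftrightarrow>
    dle A (one Y) (cmp A (one X) (one Y) (arr f) \<mu>) \<nu>"
  using dist_res_adj[of A "one X" "one Y" \<mu> \<nu> "arr f"] by (simp add: Psh_def dist_le_def)

lemma hm_Psh_iff_pointwise: "f \<in> Arrows Q X Y \<Longrightarrow> f \<preceq>[X, Y] hm (psh A) (X, \<mu>) (Y, \<nu>) \<longleftrightarrow>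
    (\<forall>x \<in> objs A. Cmp Q (tp A x) X Y f (\<mu> x ()) \<preceq>[tp A x, Y] \<nu> x ())"
  by (subst hm_Psh_iff, simp, subst dist_comp_dle_iff, simp_all)

end

lemma qle_Psh_iff:
  assumes [simp]: "qcat A" "X \<in> Obj Q" "Y \<in> Obj Q" "dst A (one X) \<mu>" "dst A (one Y) \<nu>"
  shows "qle Q (psh A) (X, \<mu>) (Y, \<nu>) \<longleftrightarrow> X = Y \<and> dle A (one X) \<mu> \<nu>"
proof (cases "X = Y")
  case True
  then have Y: "Y = X" and \<nu> [simp]: "dst A (one X) \<nu>" using assms(5) by simp_all
  show ?thesis unfolding Y by (simp add: qle_def hm_Psh_iff)
qed (simp add: qle_def)

lemma Psh_qcat [simp]:
  assumes [simp]: "qcat A"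
  shows "qcat (psh A)"
proof -
  have "Cmp Q X Y Z (hm (psh A) (Y, \<nu>) (Z, \<xi>)) (hm (psh A) (X, \<mu>) (Y, \<nu>))
     \<preceq>[X, Z] hm (psh A) (X, \<mu>) (Z, \<xi>)"
    if [simp]: "X \<in> Obj Q" "Y \<in> Obj Q" "Z \<in> Obj Q" "dst A (one X) \<mu>" "dst A (one Y) \<nu>" "dst A (one Z) \<xi>"
    for X Y Z \<mu> \<nu> \<xi>
  proof (subst hm_Psh_iff)
    let ?f = "hm (psh A) (X, \<mu>) (Y, \<nu>)" and ?g = "hm (psh A) (Y, \<nu>) (Z, \<xi>)"
    have "dle A (one Z) (cmp A (one Y) (one Z) (arr ?g) (cmp A (one X) (one Y) (arr ?f) \<mu>))
        (cmp A (one Y) (one Z) (arr ?g) \<nu>)"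
      by (rule dist_comp_mono_right) (simp_all flip: hm_Psh_iff)
    moreover have "dle A (one Z) (cmp A (one Y) (one Z) (arr ?g) \<nu>) \<xi>"
      by (simp flip: hm_Psh_iff)
    ultimately have "dle A (one Z) (cmp A (one Y) (one Z) (arr ?g) (cmp A (one X) (one Y) (arr ?f) \<mu>)) \<xi>"
      by (rule dist_le_trans) simp_all
    then show "dle A (one Z) (cmp A (one X) (one Z) (arr (Cmp Q X Y Z ?g ?f)) \<mu>) \<xi>"
      by (simp add: dist_comp_assoc flip: arr_comp)
  qed simp_all
  note comp = this
  show ?thesis
    unfolding is_qcat_def
  proof (intro conjI ballI)
    fix p q r assume "p \<in> objs (psh A)" "q \<in> objs (psh A)" "r \<in> objs (psh A)"
    then show "Cmp Q (tp (psh A) p) (tp (psh A) q) (tp (psh A) r) (hm (psh A) q r)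
        (hm (psh A) p q) \<preceq>[tp (psh A) p, tp (psh A) r] hm (psh A) p r"
      by (cases p; cases q; cases r) (simp add: comp)
  next
    fix p q assume "p \<in> objs (psh A)" "q \<in> objs (psh A)"
    then show "hm (psh A) p q \<in> Arrows Q (tp (psh A) p) (tp (psh A) q)"
      by (cases p; cases q) simp
  next
    fix p assume "p \<in> objs (psh A)"
    then show "tp (psh A) p \<in> Obj Q"
      "Idt Q (tp (psh A) p) \<preceq>[tp (psh A) p, tp (psh A) p] hm (psh A) p p"
      by (cases p; simp add: hm_Psh_iff)+
  qed
qed

lemma Psh_skeletal: "qcat A \<Longrightarrow> skeletal Q (psh A)"
  by (auto simp: skeletal_def qle_Psh_iff) (metis dist_le_antisym star_qcat)

section \<open>Distributors as families of presheaves\<close>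

definition row :: "('o, 'a, 'b) qcat \<Rightarrow> ('o, 'a, 'c) qcat \<Rightarrow> ('b \<Rightarrow> 'c \<Rightarrow> 'a) \<Rightarrow> 'c \<Rightarrow> 'b \<Rightarrow> unit \<Rightarrow> 'a" where
  "row A B \<phi> y = on_objs A (one (tp B y)) (\<lambda>x _. \<phi> x y)"

text \<open>The transpose of a functor from \<open>B\<close> to \<open>psh A\<close>; the type tags
  are dropped because they have to agree with \<open>tp B\<close>.\<close>

definition of_rows :: "('o, 'a, 'b) qcat \<Rightarrow> ('o, 'a, 'c) qcat \<Rightarrow> ('c \<Rightarrow> ('o, 'a, 'b) presheaf) \<Rightarrow> 'b \<Rightarrow> 'c \<Rightarrow> 'a" where
  "of_rows A B F = on_objs A B (\<lambda>x y. snd (F y) x ())"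

lemma row_apply [simp]: "x \<in> objs A \<Longrightarrow> row A B \<phi> y x u = \<phi> x y"
  by (simp add: row_def)

lemma row_dist [simp]:
  assumes [simp]: "qcat A" "qcat B" "dst A B \<phi>" "y \<in> objs B"
  shows "dst A (one (tp B y)) (row A B \<phi> y)"
  by (rule distributorI) (auto simp: row_def on_objs_undef intro: dist_act_right)

lemma row_comp:
  assumes [simp]: "qcat A" "qcat B" "qcat C" "dst A B \<phi>" "dst B C \<psi>" "z \<in> objs C"
  shows "row A C (cmp A B C \<psi> \<phi>) z = cmp A B (one (tp C z)) (row B C \<psi> z) \<phi>"
  by (rule dist_ext[of Q A "one (tp C z)"]) (simp_all add: dist_comp_apply cong: image_cong_simp)

lemma dist_le_rows_iff:
  "dle A B \<phi> \<psi> \<longleftrightarrow> (\<forall>y \<in> objs B. dle A (one (tp B y)) (row A B \<phi> y) (row A B \<psi> y))"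
  by (auto simp: dist_le_def)

lemma dist_eq_rows:
  assumes "dst A B \<phi>" "dst A B \<psi>" "\<And>y. y \<in> objs B \<Longrightarrow> row A B \<phi> y = row A B \<psi> y"
  shows "\<phi> = \<psi>"
  by (rule dist_ext[OF assms(1,2)]) (metis assms(3) row_apply)

text \<open>The pointwise condition for an entry at \<open>z\<close> refers to \<chi> only through
  its row at \<open>z\<close>, so fixing \<open>z\<close> leaves a residual of presheaves.\<close>

lemma row_res:
  assumes [simp]: "qcat A" "qcat B" "qcat C" "dst A B \<phi>" "dst A C \<chi>" "z \<in> objs C"
  shows "row B C (res A B C \<chi> \<phi>) z = res A B (one (tp C z)) (row A C \<chi> z) \<phi>"
proof (rule dist_ext[of Q B "one (tp C z)"])
  fix y u assume [simp]: "y \<in> objs B" "u \<in> objs (one (tp C z))"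
  show "row B C (res A B C \<chi> \<phi>) z y u = res A B (one (tp C z)) (row A C \<chi> z) \<phi> y u"
    by (rule eq_if_same_lower[of "tp B y" "tp C z"])
      (use dist_arrow[OF dist_res_dist[of A B "one (tp C z)" \<phi> "row A C \<chi> z"], of y u]
        dist_res_le_iff[of A B "one (tp C z)" \<phi> "row A C \<chi> z" y u] in
        \<open>simp_all add: dist_res_le_iff\<close>)
qed simp_all

context
  fixes A :: "('o, 'a, 'b) qcat" and B :: "('o, 'a, 'c) qcat" and F
  assumes AB [simp]: "qcat A" "qcat B"
    and F: "\<And>y. y \<in> objs B \<Longrightarrow> F y \<in> objs (psh A)" "\<And>y. y \<in> objs B \<Longrightarrow> fst (F y) = tp B y"
    and F_hm: "\<And>y y'. y \<in> objs B \<Longrightarrow> y' \<in> objs B \<Longrightarrow>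
      hm B y y' \<preceq>[tp B y, tp B y'] hm (psh A) (F y) (F y')"
begin

lemma F_dist [simp]: "y \<in> objs B \<Longrightarrow> dst A (one (tp B y)) (snd (F y))"
  by (metis F Psh_obj_iff prod.collapse)

text \<open>The left action law is \<open>F_hm\<close> read through
  \<open>hm_Psh_iff_pointwise\<close>; the right one holds in each presheaf separately.
  \<open>F\<close> need not be extensional, which admits the inclusion \<open>\<lambda>l. l\<close>
  of a subcategory.\<close>

lemma of_rows_dist [simp]: "dst A B (of_rows A B F)"
proof (rule distributorI)
  fix x y y' assume [simp]: "x \<in> objs A" "y \<in> objs B" "y' \<in> objs B"
  have "F y = (tp B y, snd (F y))" "F y' = (tp B y', snd (F y'))"
    by (metis F(2) prod.collapse \<open>y \<in> objs B\<close>) (metis F(2) prod.collapse \<open>y' \<in> objs B\<close>)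
  then have "hm B y y' \<preceq>[tp B y, tp B y'] hm (psh A) (tp B y, snd (F y)) (tp B y', snd (F y'))"
    using F_hm[of y y'] by simp
  then show "Cmp Q (tp A x) (tp B y) (tp B y') (hm B y y') (of_rows A B F x y)
      \<preceq>[tp A x, tp B y'] of_rows A B F x y'"
    by (simp add: hm_Psh_iff_pointwise of_rows_def)
next
  fix x' x y assume [simp]: "x' \<in> objs A" "x \<in> objs A" "y \<in> objs B"
  show "Cmp Q (tp A x') (tp A x) (tp B y) (of_rows A B F x y) (hm A x' x)
      \<preceq>[tp A x', tp B y] of_rows A B F x' y"
    using dist_act_right[of A "one (tp B y)" "snd (F y)" x' x "()"] by (simp add: of_rows_def)
next
  fix x y assume [simp]: "x \<in> objs A" "y \<in> objs B"
  show "of_rows A B F x y \<in> Arrows Q (tp A x) (tp B y)"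
    using dist_arrow[OF F_dist, of y x "()"] by (simp add: of_rows_def)
qed (auto simp: of_rows_def on_objs_undef)

lemma row_of_rows [simp]: "y \<in> objs B \<Longrightarrow> row A B (of_rows A B F) y = snd (F y)"
  by (rule dist_ext[OF row_dist F_dist]) (simp_all, simp add: of_rows_def)

end

declare F_dist [simp del] of_rows_dist [simp del] row_of_rows [simp del]

text \<open>Representables are rows of the identity distributor, so composing with them is governed
  by \<open>row_comp\<close>.\<close>

lemma yoneda_eq: "x \<in> objs A \<Longrightarrow> yoneda Q A x = (tp A x, row A A (dist_id A) x)"
  unfolding yoneda_def row_def on_objs_def by (auto simp: fun_eq_iff)


section \<open>Adjunctions\<close>

lemma qle_hm_right:
  assumes [simp]: "qcat A" "x \<in> objs A" "y \<in> objs A" "z \<in> objs A" and yz: "qle Q A y z"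
  shows "hm A x y \<preceq>[tp A x, tp A y] hm A x z"
proof -
  from yz have t [simp]: "tp A z = tp A y" and le: "Idt Q (tp A y) \<preceq>[tp A y, tp A y] hm A y z"
    by (auto simp: qle_def)
  have [simp]: "hm A y z \<in> Arrows Q (tp A y) (tp A y)" "hm A x z \<in> Arrows Q (tp A x) (tp A y)"
    using qcat_hm[of Q A y z] qcat_hm[of Q A x z] by simp_all
  have "Cmp Q (tp A x) (tp A y) (tp A y) (Idt Q (tp A y)) (hm A x y) \<preceq>[tp A x, tp A y]
      Cmp Q (tp A x) (tp A y) (tp A y) (hm A y z) (hm A x y)"
    by (intro Cmp_mono_left le) simp_all
  moreover have "Cmp Q (tp A x) (tp A y) (tp A y) (hm A y z) (hm A x y) \<preceq>[tp A x, tp A y] hm A x z"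
    using qcat_comp[of Q A x y z] by simp
  ultimately have "Cmp Q (tp A x) (tp A y) (tp A y) (Idt Q (tp A y)) (hm A x y)
      \<preceq>[tp A x, tp A y] hm A x z"
    by (rule hom_trans) simp_all
  then show ?thesis by simp
qed

lemma qle_hm_left:
  assumes [simp]: "qcat A" "x \<in> objs A" "y \<in> objs A" "z \<in> objs A" and yz: "qle Q A x y"
  shows "hm A y z \<preceq>[tp A x, tp A z] hm A x z"
proof -
  from yz have t [simp]: "tp A y = tp A x" and le: "Idt Q (tp A x) \<preceq>[tp A x, tp A x] hm A x y"
    by (auto simp: qle_def)
  have [simp]: "hm A x y \<in> Arrows Q (tp A x) (tp A x)" "hm A y z \<in> Arrows Q (tp A x) (tp A z)"
    using qcat_hm[of Q A x y] qcat_hm[of Q A y z] by simp_all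
  have "Cmp Q (tp A x) (tp A x) (tp A z) (hm A y z) (Idt Q (tp A x)) \<preceq>[tp A x, tp A z]
      Cmp Q (tp A x) (tp A x) (tp A z) (hm A y z) (hm A x y)"
    by (intro Cmp_mono_right le) simp_all
  moreover have "Cmp Q (tp A x) (tp A x) (tp A z) (hm A y z) (hm A x y) \<preceq>[tp A x, tp A z] hm A x z"
    using qcat_comp[of Q A x y z] by simp
  ultimately have "Cmp Q (tp A x) (tp A x) (tp A z) (hm A y z) (Idt Q (tp A x))
      \<preceq>[tp A x, tp A z] hm A x z"
    by (rule hom_trans) simp_all
  then show ?thesis by simp
qed

lemma qle_refl: "qcat A \<Longrightarrow> x \<in> objs A \<Longrightarrow> qle Q A x x"
  by (simp add: qle_def qcat_id)

lemma qle_trans: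
  assumes [simp]: "qcat A" "x \<in> objs A" "y \<in> objs A" "z \<in> objs A"
    and xy: "qle Q A x y" and yz: "qle Q A y z"
  shows "qle Q A x z"
proof -
  from xy yz have t: "tp A y = tp A x" "tp A z = tp A x"
    by (auto simp: qle_def)
  have "Idt Q (tp A x) \<preceq>[tp A x, tp A x] hm A x z"
    by (rule hom_trans[of _ _ _ "hm A x y"])
      (use qle_hm_right[OF assms(1,2,3,4) yz] xy qcat_hm[of Q A x z] qcat_hm[of Q A x y] t in \<open>simp_all add: qle_def\<close>)
  then show ?thesis using t by (simp add: qle_def)
qed

lemma yoneda_funcset: "qcat A \<Longrightarrow> yoneda Q A \<in> objs A \<rightarrow>\<^sub>E objs (psh A)"
  by (rule PiE_I) (simp add: yoneda_eq, simp add: yoneda_def)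

text \<open>The identity as test arrow gives unit and counit; combined with these, the test gives
  functoriality of both maps.\<close>

lemma adjointI:
  assumes A [simp]: "qcat A" "qcat B"
    and F: "F \<in> objs A \<rightarrow>\<^sub>E objs B" "\<And>x. x \<in> objs A \<Longrightarrow> tp B (F x) = tp A x"
    and G: "G \<in> objs B \<rightarrow>\<^sub>E objs A" "\<And>y. y \<in> objs B \<Longrightarrow> tp A (G y) = tp B y"
    and iff: "\<And>x y f. \<lbrakk>x \<in> objs A; y \<in> objs B; f \<in> Arrows Q (tp A x) (tp B y)\<rbrakk> \<Longrightarrow>
      f \<preceq>[tp A x, tp B y] hm B (F x) y \<longleftrightarrow> f \<preceq>[tp A x, tp B y] hm A x (G y)"
  shows "adjoint Q A B F G"
proof -
  have F' [simp]: "F x \<in> objs B" "tp B (F x) = tp A x" if "x \<in> objs A" for x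
    using F that by auto
  have G' [simp]: "G x \<in> objs A" "tp A (G x) = tp B x" if "x \<in> objs B" for x
    using G that by auto
  have unit: "qle Q A x (G (F x))" if "x \<in> objs A" for x
    using that iff[of x "F x" "Idt Q (tp A x)"] qcat_id[of Q B "F x"] by (simp add: qle_def)
  have counit: "qle Q B (F (G y)) y" if "y \<in> objs B" for y
    using that iff[of "G y" y "Idt Q (tp B y)"] qcat_id[of Q A "G y"] by (simp add: qle_def)
  have Fh: "hm A x x' \<preceq>[tp A x, tp A x'] hm B (F x) (F x')" if "x \<in> objs A" "x' \<in> objs A" for x x'
    using that iff[of x "F x'" "hm A x x'"] qle_hm_right[OF A(1) _ _ _ unit, of x x'] by simp
  have Gh: "hm B y y' \<preceq>[tp B y, tp B y'] hm A (G y) (G y')" if "y \<in> objs B" "y' \<in> objs B" for y y'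
    using that iff[of "G y" y' "hm B y y'"] qle_hm_left[OF A(2) _ _ _ counit, of y y'] by simp
  show ?thesis
    unfolding adjoint_def qfunctor_def using F(1) G(1) unit counit Fh Gh by simp
qed

context
  fixes A :: "('o, 'a, 'b) qcat" and B :: "('o, 'a, 'c) qcat" and F G
  assumes AB [simp]: "qcat A" "qcat B" and adj: "adjoint Q A B F G"
begin

lemma adjoint_objs:
  "x \<in> objs A \<Longrightarrow> F x \<in> objs B" "y \<in> objs B \<Longrightarrow> G y \<in> objs A"
  "x \<in> objs A \<Longrightarrow> tp B (F x) = tp A x" "y \<in> objs B \<Longrightarrow> tp A (G y) = tp B y"
  using adj by (auto simp: adjoint_def qfunctor_def)

lemma adjoint_unit: "x \<in> objs A \<Longrightarrow> qle Q A x (G (F x))"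
  and adjoint_counit: "y \<in> objs B \<Longrightarrow> qle Q B (F (G y)) y"
  using adj by (auto simp: adjoint_def)

lemma adjoint_fun_hm: "x \<in> objs A \<Longrightarrow> x' \<in> objs A \<Longrightarrow>
    hm A x x' \<preceq>[tp A x, tp A x'] hm B (F x) (F x')"
  and adjoint_right_hm: "y \<in> objs B \<Longrightarrow> y' \<in> objs B \<Longrightarrow>
    hm B y y' \<preceq>[tp B y, tp B y'] hm A (G y) (G y')"
  using adj by (auto simp: adjoint_def qfunctor_def)

lemma adjoint_hm_closed:
  "x \<in> objs A \<Longrightarrow> y \<in> objs B \<Longrightarrow> hm B (F x) y \<in> Arrows Q (tp A x) (tp B y)"
  "x \<in> objs A \<Longrightarrow> y \<in> objs B \<Longrightarrow> hm A x (G y) \<in> Arrows Q (tp A x) (tp B y)"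
  using qcat_hm[OF AB(2), of "F x" y] qcat_hm[OF AB(1), of x "G y"] by (simp_all add: adjoint_objs)

text \<open>One inequality applies \<open>G\<close> and then precomposes with the unit, the other
  applies \<open>F\<close> and then the counit.\<close>

lemma adjoint_hm_eq:
  assumes x [simp]: "x \<in> objs A" and y [simp]: "y \<in> objs B"
  shows "hm B (F x) y = hm A x (G y)"
proof (rule hom_antisym)
  note [simp] = adjoint_objs adjoint_hm_closed
  have 1: "hm A (G (F x)) (G y) \<in> Arrows Q (tp A x) (tp B y)" "hm B (F x) (F (G y)) \<in> Arrows Q (tp A x) (tp B y)"
    using qcat_hm[OF AB(1), of "G (F x)" "G y"] qcat_hm[OF AB(2), of "F x" "F (G y)"] by simp_all
  show "hm B (F x) y \<preceq>[tp A x, tp B y] hm A x (G y)"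
    by (rule hom_trans[of _ _ _ "hm A (G (F x)) (G y)"])
      (use 1 adjoint_right_hm[of "F x" y] qle_hm_left[OF AB(1) _ _ _ adjoint_unit[OF x], of "G y"] in simp_all)
  show "hm A x (G y) \<preceq>[tp A x, tp B y] hm B (F x) y"
    by (rule hom_trans[of _ _ _ "hm B (F x) (F (G y))"])
      (use 1 adjoint_fun_hm[of x "G y"] qle_hm_right[OF AB(2) _ _ _ adjoint_counit[OF y], of "F x"] in simp_all)
qed (simp_all add: adjoint_objs adjoint_hm_closed)

end

section \<open>The complete category \<open>K_obj\<close>\<close>

lemma K_obj_iff: "(X, l) \<in> objs (K_obj Q (A, B, \<phi>)) \<longleftrightarrow>
    X \<in> Obj Q \<and> dst B (one X) l \<and> res A B (one X) (cmp A B (one X) l \<phi>) \<phi> = l"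
  and K_obj_tp [simp]: "tp (K_obj Q (A, B, \<phi>)) = fst"
  and K_obj_hm [simp]: "hm (K_obj Q (A, B, \<phi>)) = hm (psh B)"
  by (auto simp: K_obj_def Psh_def push_def pull_def)

text \<open>The evaluation distributor. The hom-arrows of \<open>K_obj\<close> are residuals of its composite with
  \<open>\<phi>\<close>, so completeness and distributivity become computations with distributors.\<close>

definition ev :: "('o, 'a, 'b) dist_arrow \<Rightarrow> 'b \<Rightarrow> ('o, 'a, 'b) presheaf \<Rightarrow> 'a" where
  "ev = (\<lambda>(A, B, \<phi>). of_rows B (K_obj Q (A, B, \<phi>)) (\<lambda>l. l))"

context
  fixes A B :: "('o, 'a, 'b) qcat" and \<phi>
  assumes AB [simp]: "qcat A" "qcat B" "dst A B \<phi>"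
begin

abbreviation (input) "Kphi \<equiv> K_obj Q (A, B, \<phi>)"
abbreviation (input) "Ephi \<equiv> cmp A B Kphi (ev (A, B, \<phi>)) \<phi>"

lemma K_objD: "l \<in> objs Kphi \<Longrightarrow> l \<in> objs (psh B)"
  by (cases l) (simp add: K_obj_iff)

lemma K_snd [simp]: "l \<in> objs Kphi \<Longrightarrow> dst B (one (fst l)) (snd l)"
  and K_fst [simp]: "l \<in> objs Kphi \<Longrightarrow> fst l \<in> Obj Q"
  and K_closed: "l \<in> objs Kphi \<Longrightarrow> res A B (one (fst l)) (cmp A B (one (fst l)) (snd l) \<phi>) \<phi> = snd l"
  by (cases l; simp add: K_obj_iff)+

lemma K_qcat [simp]: "qcat Kphi"
  using Psh_qcat[OF AB(2)] K_objD unfolding is_qcat_def by (auto simp del: Psh_obj_iff)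

lemma K_skeletal: "skeletal Q Kphi"
  using Psh_skeletal[OF AB(2)] K_objD unfolding skeletal_def qle_def by (auto simp del: Psh_obj_iff)

lemma res_in_K: "X \<in> Obj Q \<Longrightarrow> dst B (one X) l \<Longrightarrow>
    (X, res A B (one X) (cmp A B (one X) l \<phi>) \<phi>) \<in> objs Kphi"
  by (simp add: K_obj_iff)

text \<open>Values of the right adjoint of a Galois connection are fixed by the induced closure
  operator.\<close>

lemma res_in_K': 
  assumes [simp]: "X \<in> Obj Q" "dst A (one X) m"
  shows "(X, res A B (one X) m \<phi>) \<in> objs Kphi"
proof -
  have "res A B (one X) (cmp A B (one X) (res A B (one X) m \<phi>) \<phi>) \<phi> = res A B (one X) m \<phi>"
    by (rule dist_le_antisym[of B "one X"])
      (auto simp: dist_res_unit intro!: dist_res_adj[THEN iffD1] simp: dist_res_counit)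
  then show ?thesis by (simp add: K_obj_iff)
qed

lemma K_hm_closed [simp]: "l \<in> objs Kphi \<Longrightarrow> l' \<in> objs Kphi \<Longrightarrow> hm (psh B) l l' \<in> Arrows Q (fst l) (fst l')"
  using qcat_hm[OF K_qcat, of l l'] by simp

lemma ev_dist [simp]: "dst B Kphi (ev (A, B, \<phi>))"
  unfolding ev_def prod.case by (rule of_rows_dist) (auto simp: K_objD simp del: Psh_obj_iff intro: K_objD)

lemma row_ev [simp]: "l \<in> objs Kphi \<Longrightarrow> row B Kphi (ev (A, B, \<phi>)) l = snd l"
  unfolding ev_def prod.case by (rule row_of_rows) (auto simp: K_objD simp del: Psh_obj_iff intro: K_objD)

lemma row_Ephi: "l \<in> objs Kphi \<Longrightarrow> row A Kphi Ephi l = cmp A B (one (fst l)) (snd l) \<phi>"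
  by (simp add: row_comp)

text \<open>Since \<open>snd l\<close> is the residual of its own composite with \<phi>, the
  residual adjunction reflects the order after composition. Closedness is asked of the larger
  presheaf alone, so that the smaller one may be a scaled presheaf in
  \<open>K_hm_iff\<close>.\<close>

lemma K_le_iff:
  assumes l [simp]: "l \<in> objs Kphi" and [simp]: "dst B (one (fst l)) m"
  shows "dle B (one (fst l)) m (snd l) \<longleftrightarrow>
    dle A (one (fst l)) (cmp A B (one (fst l)) m \<phi>) (cmp A B (one (fst l)) (snd l) \<phi>)"
  by (subst dist_res_adj) (simp_all add: K_closed)

lemma K_hm_iff:
  assumes l [simp]: "l \<in> objs Kphi" "l' \<in> objs Kphi" and f [simp]: "f \<in> Arrows Q (fst l) (fst l')"
  shows "f \<preceq>[fst l, fst l'] hm Kphi l l' \<longleftrightarrow>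
    dle A (one (fst l')) (cmp A (one (fst l)) (one (fst l')) (arr f) (cmp A B (one (fst l)) (snd l) \<phi>))
      (cmp A B (one (fst l')) (snd l') \<phi>)"
  using hm_Psh_iff[of B "fst l" "fst l'" "snd l" "snd l'" f]
    K_le_iff[of l' "cmp B (one (fst l)) (one (fst l')) (arr f) (snd l)"]
  by (simp add: dist_comp_assoc)

text \<open>This is \<open>K_hm_iff\<close> for all pairs at once:
  \<open>l \<mapsto> l \<circ> \<phi>\<close> is fully faithful, and these composites are the rows
  of \<open>Ephi\<close>.\<close>

lemma dist_id_K: "dist_id Kphi = res A Kphi Kphi Ephi Ephi"
proof (rule dist_ext[of Q Kphi Kphi])
  fix l l' assume [simp]: "l \<in> objs Kphi" "l' \<in> objs Kphi"
  show "dist_id Kphi l l' = res A Kphi Kphi Ephi Ephi l l'"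
  proof (rule eq_if_same_lower[of "fst l" "fst l'"])
    fix f assume [simp]: "f \<in> Arrows Q (fst l) (fst l')"
    have "f \<preceq>[fst l, fst l'] dist_id Kphi l l' \<longleftrightarrow>
      dle A (one (fst l')) (cmp A (one (fst l)) (one (fst l')) (arr f) (row A Kphi Ephi l)) (row A Kphi Ephi l')"
      by (simp add: K_hm_iff[simplified] row_Ephi)
    also have "\<dots> \<longleftrightarrow> f \<preceq>[fst l, fst l'] res A Kphi Kphi Ephi Ephi l l'"
      using row_dist[of A Kphi Ephi l] row_dist[of A Kphi Ephi l'] dist_res_le_iff[of A Kphi Kphi Ephi Ephi l l' f]
      by (subst dist_comp_dle_iff) simp_all
    finally show "f \<preceq>[fst l, fst l'] dist_id Kphi l l' \<longleftrightarrow>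
      f \<preceq>[fst l, fst l'] res A Kphi Kphi Ephi Ephi l l'" .
  qed (use dist_arrow[of Q Kphi Kphi "dist_id Kphi" l l'] dist_arrow[of Q Kphi Kphi "res A Kphi Kphi Ephi Ephi" l l'] in simp_all)
qed simp_all

text \<open>The join with weights \<open>T\<close>: the images under composition with \<phi> have
  the join \<open>T \<circ> Ephi\<close> in \<open>psh A\<close>, which residuation brings back to a
  closed presheaf.\<close>

definition K_sup :: "('o, 'a, ('o, 'a, 'b) presheaf) presheaf \<Rightarrow> ('o, 'a, 'b) presheaf" where
  "K_sup = (\<lambda>p \<in> objs (psh Kphi). (fst p, res A B (one (fst p)) (cmp A Kphi (one (fst p)) (snd p) Ephi) \<phi>))"

context
  fixes X T
  assumes T [simp]: "X \<in> Obj Q" "dst Kphi (one X) T"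
begin

lemma K_sup_eq: "K_sup (X, T) = (X, res A B (one X) (cmp A Kphi (one X) T Ephi) \<phi>)"
  by (simp add: K_sup_def)

lemma K_sup_in: "K_sup (X, T) \<in> objs Kphi"
  by (simp add: K_sup_eq res_in_K')

text \<open>The composite \<open>T \<circ> Ephi\<close> equals
  \<open>(T \<circ> ev) \<circ> \<phi>\<close>, so it is an image and residuation loses
  nothing.\<close>

lemma K_sup_comp: "cmp A B (one X) (snd (K_sup (X, T))) \<phi> = cmp A Kphi (one X) T Ephi"
  by (simp add: K_sup_eq flip: dist_comp_assoc)

end

text \<open>On images, \<open>T \<circ> Ephi\<close> lies below the image of \<open>l\<close> iff
  \<open>T\<close> lies below the residual of that image along \<open>Ephi\<close>, and by
  \<open>dist_id_K\<close> this residual is the representable presheaf of \<open>l\<close>.\<close>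

lemma K_sup_adjoint: "adjoint Q (psh Kphi) Kphi K_sup (yoneda Q Kphi)"
proof (rule adjointI)
  fix p l f assume "p \<in> objs (psh Kphi)" and l [simp]: "l \<in> objs Kphi"
    and f: "f \<in> Arrows Q (tp (psh Kphi) p) (tp Kphi l)"
  then obtain X T where p: "p = (X, T)" and [simp]: "X \<in> Obj Q" "dst Kphi (one X) T"
    by (cases p) auto
  have [simp]: "f \<in> Arrows Q X (fst l)" using f by (simp add: p)
  let ?Y = "fst l"
  have fst_sup [simp]: "fst (K_sup (X, T)) = X" by (simp add: K_sup_eq)
  have [simp]: "dst Kphi (one ?Y) (row Kphi Kphi (dist_id Kphi) l)" "dst A (one ?Y) (row A Kphi Ephi l)"
    using row_dist[of Kphi Kphi "dist_id Kphi" l] row_dist[of A Kphi Ephi l] by simp_all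
  have "f \<preceq>[X, ?Y] hm Kphi (K_sup (X, T)) l \<longleftrightarrow>
      dle A (one ?Y) (cmp A (one X) (one ?Y) (arr f) (cmp A Kphi (one X) T Ephi)) (row A Kphi Ephi l)"
    using K_hm_iff[of "K_sup (X, T)" l f] by (simp add: K_sup_in K_sup_comp row_Ephi)
  also have "\<dots> \<longleftrightarrow> dle A (one ?Y) (cmp A Kphi (one ?Y) (cmp Kphi (one X) (one ?Y) (arr f) T) Ephi) (row A Kphi Ephi l)"
    by (simp add: dist_comp_assoc)
  also have "\<dots> \<longleftrightarrow> dle Kphi (one ?Y) (cmp Kphi (one X) (one ?Y) (arr f) T) (row Kphi Kphi (dist_id Kphi) l)"
    using row_res[of A Kphi Kphi Ephi Ephi l] by (simp add: dist_res_adj flip: dist_id_K)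
  also have "\<dots> \<longleftrightarrow> f \<preceq>[X, ?Y] hm (psh Kphi) (X, T) (yoneda Q Kphi l)"
    by (simp add: yoneda_eq hm_Psh_iff)
  finally show "f \<preceq>[tp (psh Kphi) p, tp Kphi l] hm Kphi (K_sup p) l \<longleftrightarrow>
      f \<preceq>[tp (psh Kphi) p, tp Kphi l] hm (psh Kphi) p (yoneda Q Kphi l)"
    by (simp add: p)
next
  show "K_sup \<in> objs (psh Kphi) \<rightarrow>\<^sub>E objs Kphi"
    using K_sup_in by (auto simp: K_sup_def[abs_def] extensional_def)
  show "yoneda Q Kphi \<in> objs Kphi \<rightarrow>\<^sub>E objs (psh Kphi)"
    by (simp add: yoneda_funcset)
qed (auto simp: K_sup_eq yoneda_eq)

lemma K_ccd:
  assumes \<theta> [simp]: "dst B A \<theta>" and reg: "cmp A A B \<phi> (cmp A B A \<theta> \<phi>) = \<phi>"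
  shows "ccd Q Kphi"
proof -
  \<comment> \<open>The row of \<phi> at \<open>b\<close> is also the row of \<open>Ephi\<close> at
    the closure of the representable of \<open>b\<close>, so \<kappa> at \<open>l\<close> and
    \<open>b\<close> is the hom-arrow from \<open>l\<close> to that closure. Composing a weight on
    \<open>B\<close> with \<kappa> thus generates a presheaf on \<open>Kphi\<close>.\<close>
  define \<kappa> where "\<kappa> = res A Kphi B \<phi> Ephi"
  have \<kappa> [simp]: "dst Kphi B \<kappa>" by (simp add: \<kappa>_def)
  have \<kappa>_Ephi: "cmp A Kphi B \<kappa> Ephi = \<phi>"
  proof (rule dist_le_antisym[of A B])
    show "dle A B (cmp A Kphi B \<kappa> Ephi) \<phi>" by (simp add: \<kappa>_def dist_res_counit)
    show "dle A B \<phi> (cmp A Kphi B \<kappa> Ephi)"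
      unfolding dist_le_def
    proof (intro ballI)
      fix a b assume [simp]: "a \<in> objs A" "b \<in> objs B"
      \<comment> \<open>The closed presheaf whose image is the row of \<phi> at \<open>b\<close>.
        The summand at \<open>k\<close> already dominates \<open>\<phi> a b\<close>, since the
        identity lies below \<open>\<kappa> k b\<close>.\<close>
      define k where "k = (tp B b, res A B (one (tp B b)) (row A B \<phi> b) \<phi>)"
      have k [simp]: "k \<in> objs Kphi" "fst k = tp B b"
        by (simp_all add: k_def res_in_K')
      have rk: "row A Kphi Ephi k = row A B \<phi> b"
      proof -
        have "row A B \<phi> b = cmp A B (one (tp B b)) (row B B (dist_id B) b) \<phi>"
          by (simp flip: row_comp)
        then show ?thesis by (simp add: row_Ephi) (simp add: k_def)
      qed
      then have ek [simp]: "Ephi a' k = \<phi> a' b" if "a' \<in> objs A" for a'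
        using that row_apply[of a' A Kphi Ephi k] by (metis row_apply)
      have \<kappa>k: "\<kappa> k b \<in> Arrows Q (tp B b) (tp B b)"
        using dist_arrow[OF \<kappa> k(1), of b] by simp
      have "Idt Q (tp B b) \<preceq>[tp B b, tp B b] \<kappa> k b"
        using dist_res_le_iff[of A Kphi B Ephi \<phi> k b "Idt Q (tp B b)"] by (simp add: \<kappa>_def)
      then have "Cmp Q (tp A a) (tp B b) (tp B b) (Idt Q (tp B b)) (\<phi> a b) \<preceq>[tp A a, tp B b]
          Cmp Q (tp A a) (tp B b) (tp B b) (\<kappa> k b) (\<phi> a b)"
        by (rule Cmp_mono_left) (simp_all add: \<kappa>k)
      moreover have "Cmp Q (tp A a) (tp B b) (tp B b) (\<kappa> k b) (\<phi> a b) \<preceq>[tp A a, tp B b]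
          cmp A Kphi B \<kappa> Ephi a b"
        using dist_comp_upper[of A Kphi B Ephi \<kappa> a b k] by simp
      ultimately have "Cmp Q (tp A a) (tp B b) (tp B b) (Idt Q (tp B b)) (\<phi> a b)
          \<preceq>[tp A a, tp B b] cmp A Kphi B \<kappa> Ephi a b"
        by (rule hom_trans) (simp_all add: \<kappa>k)
      then show "\<phi> a b \<preceq>[tp A a, tp B b] cmp A Kphi B \<kappa> Ephi a b" by simp
    qed
  qed simp_all
  have comp_reg: "cmp A B Z (cmp B A Z (cmp A B Z l \<phi>) \<theta>) \<phi> = cmp A B Z l \<phi>"
    if [simp]: "qcat Z" "dst B Z l" for Z :: "('o, 'a, 'd) qcat" and l
    using that reg by (simp add: dist_comp_assoc)
  have comp_reg_Ephi: "cmp A B Kphi (cmp B A Kphi Ephi \<theta>) \<phi> = Ephi"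
    using reg by (simp add: dist_comp_assoc)
  \<comment> \<open>Composed with \<open>Ephi\<close>, the left side becomes
    \<open>Ephi \<circ> \<theta> \<circ> \<phi>\<close>, which is \<open>Ephi\<close> by regularity.
    This inequality supplies the counit of \<open>t\<close> and \<open>K_sup\<close>.\<close>
  have Ephi\<theta>\<kappa>: "dle Kphi Kphi (cmp Kphi B Kphi (cmp B A Kphi Ephi \<theta>) \<kappa>) (dist_id Kphi)"
    unfolding dist_id_K by (subst dist_res_adj[symmetric]) (simp_all add: dist_comp_assoc \<kappa>_Ephi comp_reg_Ephi[simplified dist_comp_assoc] reg)
  define t where "t = (\<lambda>l \<in> objs Kphi. (fst l, cmp Kphi B (one (fst l))
    (cmp B A (one (fst l)) (cmp A B (one (fst l)) (snd l) \<phi>) \<theta>) \<kappa>))"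
  have "adjoint Q Kphi (psh Kphi) t K_sup"
  proof (rule adjointI)
    fix l p f assume l [simp]: "l \<in> objs Kphi" and "p \<in> objs (psh Kphi)"
      and f: "f \<in> Arrows Q (tp Kphi l) (tp (psh Kphi) p)"
    then obtain X T where p: "p = (X, T)" and [simp]: "X \<in> Obj Q" "dst Kphi (one X) T"
      by (cases p) auto
    have [simp]: "f \<in> Arrows Q (fst l) X" using f by (simp add: p)
    have fst_sup [simp]: "fst (K_sup (X, T)) = X" by (simp add: K_sup_eq)
    let ?Y = "fst l" and ?l = "cmp A B (one (fst l)) (snd l) \<phi>"
    let ?fl = "cmp A (one ?Y) (one X) (arr f) ?l"
    let ?tl = "cmp Kphi B (one X) (cmp B A (one X) ?fl \<theta>) \<kappa>"
    have tl: "cmp Kphi (one ?Y) (one X) (arr f) (cmp Kphi B (one ?Y) (cmp B A (one ?Y) ?l \<theta>) \<kappa>) = ?tl"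
      by (simp add: dist_comp_assoc)
    \<comment> \<open>Composition with \<open>Ephi\<close> leads from left to right, because
      \<kappa> and regularity restore the scaled image of \<open>l\<close>; composition with
      \<theta> and \<kappa> leads back, by the preceding inequality.\<close>
    have "dle Kphi (one X) ?tl T \<longleftrightarrow> dle A (one X) ?fl (cmp A Kphi (one X) T Ephi)"
    proof
      assume "dle Kphi (one X) ?tl T"
      then have "dle A (one X) (cmp A Kphi (one X) ?tl Ephi) (cmp A Kphi (one X) T Ephi)"
        by (rule dist_comp_mono_left) simp_all
      moreover have "cmp A Kphi (one X) ?tl Ephi = cmp A B (one X) (cmp B A (one X) ?fl \<theta>) \<phi>"
        by (simp add: dist_comp_assoc[of A Kphi B] \<kappa>_Ephi dist_comp_assoc[of A Kphi B "one X" Ephi \<kappa>])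
      moreover have "\<dots> = ?fl"
        using comp_reg[of "one X" "cmp B (one ?Y) (one X) (arr f) (snd l)"] by (simp add: dist_comp_assoc)
      ultimately show "dle A (one X) ?fl (cmp A Kphi (one X) T Ephi)" by simp
    next
      assume "dle A (one X) ?fl (cmp A Kphi (one X) T Ephi)"
      then have "dle Kphi (one X) ?tl (cmp Kphi B (one X) (cmp B A (one X) (cmp A Kphi (one X) T Ephi) \<theta>) \<kappa>)"
        by (intro dist_comp_mono_left) simp_all
      moreover have "cmp Kphi B (one X) (cmp B A (one X) (cmp A Kphi (one X) T Ephi) \<theta>) \<kappa> =
          cmp Kphi Kphi (one X) T (cmp Kphi B Kphi (cmp B A Kphi Ephi \<theta>) \<kappa>)"
        by (simp add: dist_comp_assoc)
      moreover have "dle Kphi (one X) \<dots> (cmp Kphi Kphi (one X) T (dist_id Kphi))"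
        by (rule dist_comp_mono_right[OF Ephi\<theta>\<kappa>]) simp_all
      ultimately show "dle Kphi (one X) ?tl T"
        using dist_le_trans[of Kphi "one X" ?tl "cmp Kphi Kphi (one X) T (cmp Kphi B Kphi (cmp B A Kphi Ephi \<theta>) \<kappa>)" T] by simp
    qed
    then show "f \<preceq>[tp Kphi l, tp (psh Kphi) p] hm (psh Kphi) (t l) p \<longleftrightarrow>
      f \<preceq>[tp Kphi l, tp (psh Kphi) p] hm Kphi l (K_sup p)"
      using K_hm_iff[of l "K_sup (X, T)" f]
      by (simp add: p t_def hm_Psh_iff K_sup_in K_sup_comp tl)
  next
    show "t \<in> objs Kphi \<rightarrow>\<^sub>E objs (psh Kphi)"
      by (auto simp: t_def)
    show "K_sup \<in> objs (psh Kphi) \<rightarrow>\<^sub>E objs Kphi"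
      using K_sup_in by (auto simp: K_sup_def[abs_def] extensional_def)
  qed (auto simp: K_sup_eq t_def)
  then show ?thesis
    using K_sup_adjoint unfolding ccd_def by blast
qed

end

declare K_snd [simp del] K_fst [simp del] K_hm_closed [simp del]


section \<open>Joins of distributors\<close>

definition dist_Sup :: "('o, 'a, 'b) qcat \<Rightarrow> ('o, 'a, 'c) qcat \<Rightarrow> ('b \<Rightarrow> 'c \<Rightarrow> 'a) set \<Rightarrow> 'b \<Rightarrow> 'c \<Rightarrow> 'a" where
  "dist_Sup A B S = on_objs A B (\<lambda>x y. \<Squnion>\<^bsub>Hom Q (tp A x) (tp B y)\<^esub> ((\<lambda>\<phi>. \<phi> x y) ` S))"

context
  fixes A :: "('o, 'a, 'b) qcat" and B :: "('o, 'a, 'c) qcat" and S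
  assumes A [simp]: "qcat A" "qcat B" and S: "\<And>\<phi>. \<phi> \<in> S \<Longrightarrow> dst A B \<phi>"
begin

lemma dist_Sup_arrow [simp]: "x \<in> objs A \<Longrightarrow> y \<in> objs B \<Longrightarrow> dist_Sup A B S x y \<in> Arrows Q (tp A x) (tp B y)"
  using S by (auto simp: dist_Sup_def intro!: Sup_closed)

lemma dist_Sup_upper: "x \<in> objs A \<Longrightarrow> y \<in> objs B \<Longrightarrow> \<phi> \<in> S \<Longrightarrow>
    \<phi> x y \<preceq>[tp A x, tp B y] dist_Sup A B S x y"
  using S by (auto simp: dist_Sup_def intro!: Sup_upper)

lemma dist_Sup_dist [simp]: "dst A B (dist_Sup A B S)"
proof (rule distributorI)
  fix x y y' assume *[simp]: "x \<in> objs A" "y \<in> objs B" "y' \<in> objs B"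
  have "Cmp Q (tp A x) (tp B y) (tp B y') (hm B y y') (\<phi> x y) \<preceq>[tp A x, tp B y'] dist_Sup A B S x y'"
    if "\<phi> \<in> S" for \<phi>
    by (rule hom_trans[OF dist_act_left[where \<phi> = \<phi>] dist_Sup_upper]) (use S that in simp_all)
  then show "Cmp Q (tp A x) (tp B y) (tp B y') (hm B y y') (dist_Sup A B S x y)
      \<preceq>[tp A x, tp B y'] dist_Sup A B S x y'"
    by (subst dist_Sup_def, simp, subst Cmp_Sup_le_iff_right) (use S in auto)
next
  fix x' x y assume *[simp]: "x' \<in> objs A" "x \<in> objs A" "y \<in> objs B"
  have "Cmp Q (tp A x') (tp A x) (tp B y) (\<phi> x y) (hm A x' x) \<preceq>[tp A x', tp B y] dist_Sup A B S x' y"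
    if "\<phi> \<in> S" for \<phi>
    by (rule hom_trans[OF dist_act_right[where \<phi> = \<phi>] dist_Sup_upper]) (use S that in simp_all)
  then show "Cmp Q (tp A x') (tp A x) (tp B y) (dist_Sup A B S x y) (hm A x' x)
      \<preceq>[tp A x', tp B y] dist_Sup A B S x' y"
    by (subst dist_Sup_def, simp, subst Cmp_Sup_le_iff_left) (use S in auto)
qed (auto simp: dist_Sup_def on_objs_undef S intro!: Sup_closed)

lemma dist_Sup_le_iff: "dst A B \<chi> \<Longrightarrow> dle A B (dist_Sup A B S) \<chi> \<longleftrightarrow> (\<forall>\<phi> \<in> S. dle A B \<phi> \<chi>)"
proof -
  assume [simp]: "dst A B \<chi>"
  have "dist_Sup A B S x y \<preceq>[tp A x, tp B y] \<chi> x y \<longleftrightarrow>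
      (\<forall>\<phi> \<in> S. \<phi> x y \<preceq>[tp A x, tp B y] \<chi> x y)" if "x \<in> objs A" "y \<in> objs B" for x y
    using that S by (simp add: dist_Sup_def, subst Sup_le_iff) auto
  then show ?thesis by (auto simp: dist_le_def)
qed

lemma dist_Sup_comp_le_iff: "qcat Z \<Longrightarrow> dst Z A \<phi> \<Longrightarrow> dst Z B \<chi> \<Longrightarrow>
    dle Z B (cmp Z A B (dist_Sup A B S) \<phi>) \<chi> \<longleftrightarrow> (\<forall>\<psi> \<in> S. dle Z B (cmp Z A B \<psi> \<phi>) \<chi>)"
  by (simp add: dist_res_adj dist_Sup_le_iff S)

text \<open>The residual \<open>dist_res\<close> serves the other variable
  (\<open>dist_Sup_comp_le_iff\<close>); in this one the joins are pulled out pointwise in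
  Q.\<close>

lemma dist_comp_Sup_le_iff:
  assumes [simp]: "qcat Z" "dst B Z \<psi>" "dst A Z \<chi>"
  shows "dle A Z (cmp A B Z \<psi> (dist_Sup A B S)) \<chi> \<longleftrightarrow> (\<forall>\<phi> \<in> S. dle A Z (cmp A B Z \<psi> \<phi>) \<chi>)"
proof -
  have "Cmp Q (tp A x) (tp B y) (tp Z z) (\<psi> y z) (dist_Sup A B S x y) \<preceq>[tp A x, tp Z z] \<chi> x z \<longleftrightarrow>
      (\<forall>\<phi> \<in> S. Cmp Q (tp A x) (tp B y) (tp Z z) (\<psi> y z) (\<phi> x y) \<preceq>[tp A x, tp Z z] \<chi> x z)"
    if "x \<in> objs A" "y \<in> objs B" "z \<in> objs Z" for x y z
    using that S by (simp add: dist_Sup_def, subst Cmp_Sup_le_iff_right) auto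
  then have "dle A Z (cmp A B Z \<psi> (dist_Sup A B S)) \<chi> \<longleftrightarrow> (\<forall>\<phi> \<in> S. \<forall>x \<in> objs A. \<forall>y \<in> objs B. \<forall>z \<in> objs Z.
      Cmp Q (tp A x) (tp B y) (tp Z z) (\<psi> y z) (\<phi> x y) \<preceq>[tp A x, tp Z z] \<chi> x z)"
    by (subst dist_comp_dle_iff) auto
  also have "\<dots> \<longleftrightarrow> (\<forall>\<phi> \<in> S. dle A Z (cmp A B Z \<psi> \<phi>) \<chi>)"
    using S by (simp add: dist_comp_dle_iff)
  finally show ?thesis .
qed

end

section \<open>The quantaloid of distributors\<close>

abbreviation "Dist \<equiv> QDist Q"
abbreviation "DDist \<equiv> DDist_reg Q"
abbreviation "Sccd \<equiv> QSup_ccd Q"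

lemma QDist_simps [simp]:
  "Obj (Dist sm) = {A. qcat A \<and> sm (objs A)}"
  "Arrows (Dist sm) A B = {\<phi>. dst A B \<phi>}"
  "\<phi> \<sqsubseteq>\<^bsub>Hom (Dist sm) A B\<^esub> \<psi> \<longleftrightarrow> dle A B \<phi> \<psi>"
  "Idt (Dist sm) = dist_id" "Cmp (Dist sm) = cmp"
  by (simp_all add: QDist_def)

lemma QDist_Sup:
  assumes "qcat A" "qcat B" "S \<subseteq> {\<phi>. dst A B \<phi>}"
  shows "complete_lattice (Hom (Dist sm) A B)"
    "\<Squnion>\<^bsub>Hom (Dist sm) A B\<^esub> S = dist_Sup A B S"
proof -
  interpret complete_lattice "Hom (Dist sm) A B"
  proof (rule complete_latticeI)
    fix S assume "S \<subseteq> Arrows (Dist sm) A B"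
    then show "\<exists>s \<in> Arrows (Dist sm) A B. \<forall>y \<in> Arrows (Dist sm) A B.
        s \<sqsubseteq>\<^bsub>Hom (Dist sm) A B\<^esub> y \<longleftrightarrow> (\<forall>x \<in> S. x \<sqsubseteq>\<^bsub>Hom (Dist sm) A B\<^esub> y)"
      using assms by (intro bexI[of _ "dist_Sup A B S"]) (simp_all add: subset_iff dist_Sup_le_iff)
  qed (use assms in \<open>auto simp: QDist_def[of Q sm] intro: dist_le_antisym dist_le_trans\<close>)
  show "complete_lattice (Hom (Dist sm) A B)" by unfold_locales
  show "\<Squnion>\<^bsub>Hom (Dist sm) A B\<^esub> S = dist_Sup A B S"
    by (rule sup_eqI) (use assms in \<open>simp_all add: subset_iff dist_Sup_le_iff\<close>)
qed

lemma QDist_quantaloid: "quantaloid (Dist sm)"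
proof (rule quantaloid.intro)
  fix X Y assume "X \<in> Obj (Dist sm)" "Y \<in> Obj (Dist sm)"
  then show "complete_lattice (Hom (Dist sm) X Y)"
    by (intro QDist_Sup(1)[of _ _ "{}"]) auto
next
  fix X Y Z S g assume *: "X \<in> Obj (Dist sm)" "Y \<in> Obj (Dist sm)" "Z \<in> Obj (Dist sm)"
    "S \<subseteq> Arrows (Dist sm) X Y" "g \<in> Arrows (Dist sm) Y Z"
  have S: "dst X Y \<phi>" if "\<phi> \<in> S" for \<phi> using that * by auto
  have im: "dst X Z \<phi>" if "\<phi> \<in> cmp X Y Z g ` S" for \<phi> using that * by auto
  have "cmp X Y Z g (dist_Sup X Y S) = dist_Sup X Z (cmp X Y Z g ` S)"
    by (rule dist_eq_if_same_upper[of X Z])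
      (use * in \<open>simp_all add: dist_comp_Sup_le_iff[OF _ _ S] dist_Sup_le_iff[OF _ _ im]
        dist_Sup_dist[OF _ _ im] dist_Sup_dist[OF _ _ S]\<close>)
  then show "Cmp (Dist sm) X Y Z g (\<Squnion>\<^bsub>Hom (Dist sm) X Y\<^esub> S) =
      \<Squnion>\<^bsub>Hom (Dist sm) X Z\<^esub> (Cmp (Dist sm) X Y Z g ` S)"
    using * by (subst QDist_Sup(2), simp_all, subst QDist_Sup(2)) (auto simp: subset_iff)
next
  fix X Y Z S f assume *: "X \<in> Obj (Dist sm)" "Y \<in> Obj (Dist sm)" "Z \<in> Obj (Dist sm)"
    "f \<in> Arrows (Dist sm) X Y" "S \<subseteq> Arrows (Dist sm) Y Z"
  have S: "dst Y Z \<phi>" if "\<phi> \<in> S" for \<phi> using that * by auto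
  have im: "dst X Z \<phi>" if "\<phi> \<in> (\<lambda>g. cmp X Y Z g f) ` S" for \<phi> using that * by auto
  have "cmp X Y Z (dist_Sup Y Z S) f = dist_Sup X Z ((\<lambda>g. cmp X Y Z g f) ` S)"
    by (rule dist_eq_if_same_upper[of X Z])
      (use * in \<open>simp_all add: dist_Sup_comp_le_iff[OF _ _ S] dist_Sup_le_iff[OF _ _ im]
        dist_Sup_dist[OF _ _ im] dist_Sup_dist[OF _ _ S]\<close>)
  then show "Cmp (Dist sm) X Y Z (\<Squnion>\<^bsub>Hom (Dist sm) Y Z\<^esub> S) f =
      \<Squnion>\<^bsub>Hom (Dist sm) X Z\<^esub> ((\<lambda>g. Cmp (Dist sm) X Y Z g f) ` S)"
    using * by (subst QDist_Sup(2), simp_all, subst QDist_Sup(2)) (auto simp: subset_iff)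
qed (auto simp: dist_comp_assoc)

section \<open>Joins and meets in complete categories\<close>

text \<open>The identity below \<open>hm A z z\<close> gives one direction, the right action on
  \<mu> the other. The scalar \<open>f\<close> makes this a statement on hom-arrows rather than on
  the underlying order.\<close>

lemma yoneda_lemma:
  assumes [simp]: "qcat A" "X \<in> Obj Q" "dst A (one X) \<mu>" "z \<in> objs A" "f \<in> Arrows Q (tp A z) X"
  shows "dle A (one X) (cmp A (one (tp A z)) (one X) (arr f) (row A A (dist_id A) z)) \<mu>
    \<longleftrightarrow> f \<preceq>[tp A z, X] \<mu> z ()"
proof -
  have [simp]: "dst A (one (tp A z)) (row A A (dist_id A) z)" by simp
  have "dle A (one X) (cmp A (one (tp A z)) (one X) (arr f) (row A A (dist_id A) z)) \<mu> \<longleftrightarrow>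
      (\<forall>x \<in> objs A. Cmp Q (tp A x) (tp A z) X f (hm A x z) \<preceq>[tp A x, X] \<mu> x ())"
    by (subst dist_comp_dle_iff) simp_all
  also have "\<dots> \<longleftrightarrow> f \<preceq>[tp A z, X] \<mu> z ()"
  proof
    have [simp]: "\<mu> x () \<in> Arrows Q (tp A x) X" if "x \<in> objs A" for x
      using dist_arrow[OF assms(3) that, of "()"] by simp
    assume "\<forall>x \<in> objs A. Cmp Q (tp A x) (tp A z) X f (hm A x z) \<preceq>[tp A x, X] \<mu> x ()"
    then have *: "Cmp Q (tp A z) (tp A z) X f (hm A z z) \<preceq>[tp A z, X] \<mu> z ()" by simp
    have "Cmp Q (tp A z) (tp A z) X f (Idt Q (tp A z)) \<preceq>[tp A z, X] Cmp Q (tp A z) (tp A z) X f (hm A z z)"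
      by (intro Cmp_mono_right qcat_id) simp_all
    from hom_trans[OF this *] show "f \<preceq>[tp A z, X] \<mu> z ()" by simp
  next
    have [simp]: "\<mu> x () \<in> Arrows Q (tp A x) X" if "x \<in> objs A" for x
      using dist_arrow[OF assms(3) that, of "()"] by simp
    assume f: "f \<preceq>[tp A z, X] \<mu> z ()"
    show "\<forall>x \<in> objs A. Cmp Q (tp A x) (tp A z) X f (hm A x z) \<preceq>[tp A x, X] \<mu> x ()"
    proof
      fix x assume [simp]: "x \<in> objs A"
      have "Cmp Q (tp A x) (tp A z) X f (hm A x z) \<preceq>[tp A x, X] Cmp Q (tp A x) (tp A z) X (\<mu> z ()) (hm A x z)"
        by (intro Cmp_mono_left f) simp_all
      then show "Cmp Q (tp A x) (tp A z) X f (hm A x z) \<preceq>[tp A x, X] \<mu> x ()"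
        by (rule hom_trans) (use dist_act_right[of A "one X" \<mu> x z "()"] in simp_all)
    qed
  qed
  finally show ?thesis .
qed

context
  fixes A :: "('o, 'a, 'b) qcat" and s
  assumes A [simp]: "qcat A" and s: "adjoint Q (psh A) A s (yoneda Q A)"
begin

lemma sup_hm_iff:
  assumes [simp]: "X \<in> Obj Q" "dst A (one X) \<mu>" "z \<in> objs A" "f \<in> Arrows Q X (tp A z)"
  shows "f \<preceq>[X, tp A z] hm A (s (X, \<mu>)) z \<longleftrightarrow>
    dle A (one (tp A z)) (cmp A (one X) (one (tp A z)) (arr f) \<mu>) (row A A (dist_id A) z)"
  using adjoint_hm_eq[OF Psh_qcat[OF A] A s, where x = "(X, \<mu>)" and y = z] hm_Psh_iff[of A X "tp A z" \<mu> "row A A (dist_id A) z" f]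
  by (simp add: yoneda_eq)

lemma sup_in:
  "X \<in> Obj Q \<Longrightarrow> dst A (one X) \<mu> \<Longrightarrow> s (X, \<mu>) \<in> objs A"
  "X \<in> Obj Q \<Longrightarrow> dst A (one X) \<mu> \<Longrightarrow> tp A (s (X, \<mu>)) = X"
  using adjoint_objs(1,3)[OF Psh_qcat[OF A] A s, of "(X, \<mu>)"] by simp_all

lemma le_row_sup:
  assumes [simp]: "X \<in> Obj Q" "dst A (one X) \<mu>"
  shows "dle A (one X) \<mu> (row A A (dist_id A) (s (X, \<mu>)))"
  using adjoint_unit[OF Psh_qcat[OF A] A s, where x = "(X, \<mu>)"] row_dist[of A A "dist_id A" "s (X, \<mu>)"]
  by (simp add: yoneda_eq sup_in qle_Psh_iff)

text \<open>The join is the supremum of the pointwise join of the representables of the members. It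
  is characterized by all test arrows, not by identities alone, because adjunctions are obtained
  from equality of hom-arrows.\<close>

lemma complete_joins:
  assumes X [simp]: "X \<in> Obj Q" and S: "S \<subseteq> objs A" "\<And>c. c \<in> S \<Longrightarrow> tp A c = X"
  shows "\<exists>j \<in> objs A. tp A j = X \<and> (\<forall>z \<in> objs A. \<forall>f \<in> Arrows Q X (tp A z).
    f \<preceq>[X, tp A z] hm A j z \<longleftrightarrow> (\<forall>c \<in> S. f \<preceq>[X, tp A z] hm A c z))"
proof -
  let ?R = "row A A (dist_id A) ` S"
  have R: "dst A (one X) (row A A (dist_id A) c)" if "c \<in> S" for c
    using row_dist[of A A "dist_id A" c] that S by auto
  have R': "dst A (one X) r" if "r \<in> ?R" for r using R that by auto
  define \<nu> where "\<nu> = dist_Sup A (one X) ?R"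
  have [simp]: "dst A (one X) \<nu>" unfolding \<nu>_def by (rule dist_Sup_dist) (use R in auto)
  have "f \<preceq>[X, tp A z] hm A (s (X, \<nu>)) z \<longleftrightarrow> (\<forall>c \<in> S. f \<preceq>[X, tp A z] hm A c z)"
    if z [simp]: "z \<in> objs A" and f [simp]: "f \<in> Arrows Q X (tp A z)" for z f
  proof -
    have "f \<preceq>[X, tp A z] hm A (s (X, \<nu>)) z \<longleftrightarrow>
      (\<forall>c \<in> S. dle A (one (tp A z)) (cmp A (one X) (one (tp A z)) (arr f) (row A A (dist_id A) c)) (row A A (dist_id A) z))"
      using sup_hm_iff[of X \<nu> z f]
        dist_comp_Sup_le_iff[OF A star_qcat[OF X] R', where S = ?R and Z = "one (tp A z)" and \<psi> = "arr f" and \<chi> = "row A A (dist_id A) z"]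
      by (simp flip: \<nu>_def)
    moreover have "dle A (one (tp A z)) (cmp A (one X) (one (tp A z)) (arr f) (row A A (dist_id A) c)) (row A A (dist_id A) z)
      \<longleftrightarrow> f \<preceq>[X, tp A z] hm A c z" if "c \<in> S" for c
      using yoneda_lemma[of A "tp A z" "row A A (dist_id A) z" c f] S that by auto
    ultimately show ?thesis by simp
  qed
  then show ?thesis
    by (intro bexI[of _ "s (X, \<nu>)"]) (auto simp: sup_in)
qed

text \<open>As in ordered sets, meets are suprema of common lower bounds: that role is played by
  \<mu>, the largest presheaf below the representables of all members.\<close>

lemma complete_meets:
  assumes X [simp]: "X \<in> Obj Q" and S: "S \<subseteq> objs A" "\<And>c. c \<in> S \<Longrightarrow> tp A c = X"
  shows "\<exists>m \<in> objs A. tp A m = X \<and> (\<forall>z \<in> objs A. \<forall>f \<in> Arrows Q (tp A z) X.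
    f \<preceq>[tp A z, X] hm A z m \<longleftrightarrow> (\<forall>c \<in> S. f \<preceq>[tp A z, X] hm A z c))"
proof -
  have R: "dst A (one X) (row A A (dist_id A) c)" if "c \<in> S" for c
    using row_dist[of A A "dist_id A" c] that S by auto
  define T where "T = {\<mu>. dst A (one X) \<mu> \<and> (\<forall>c \<in> S. dle A (one X) \<mu> (row A A (dist_id A) c))}"
  define \<mu> where "\<mu> = dist_Sup A (one X) T"
  have T: "dst A (one X) \<nu>" if "\<nu> \<in> T" for \<nu> using that by (simp add: T_def)
  have [simp]: "dst A (one X) \<mu>" unfolding \<mu>_def by (rule dist_Sup_dist) (use T in auto)
  have le_\<mu>: "dle A (one X) \<nu> \<mu>" if "\<nu> \<in> T" for \<nu>
    using dist_Sup_le_iff[of A "one X" T \<mu>] T that by (simp flip: \<mu>_def)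
  have \<mu>_le: "dle A (one X) \<mu> (row A A (dist_id A) c)" if "c \<in> S" for c
  proof -
    have "\<forall>\<nu> \<in> T. dle A (one X) \<nu> (row A A (dist_id A) c)" using that by (simp add: T_def)
    then show ?thesis
      unfolding \<mu>_def using dist_Sup_le_iff[OF A star_qcat[OF X] T R[OF that]] by blast
  qed
  let ?m = "s (X, \<mu>)"
  have m [simp]: "?m \<in> objs A" "tp A ?m = X" by (simp_all add: sup_in)
  have m_row [simp]: "dst A (one X) (row A A (dist_id A) ?m)"
    using row_dist[of A A "dist_id A" ?m] by simp
  have "f \<preceq>[tp A z, X] hm A z ?m \<longleftrightarrow> (\<forall>c \<in> S. f \<preceq>[tp A z, X] hm A z c)"
    if z [simp]: "z \<in> objs A" and f [simp]: "f \<in> Arrows Q (tp A z) X" for z f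
  proof (intro iffI ballI)
    fix c assume le: "f \<preceq>[tp A z, X] hm A z ?m" and c: "c \<in> S"
    have c' [simp]: "c \<in> objs A" "tp A c = X" using c S by auto
    have [simp]: "hm A z c \<in> Arrows Q (tp A z) X" "hm A z ?m \<in> Arrows Q (tp A z) X"
      using qcat_hm[of Q A z c] qcat_hm[of Q A z ?m] by simp_all
    have "qle Q A ?m c"
      using sup_hm_iff[of X \<mu> c "Idt Q X"] \<mu>_le[OF c] by (simp add: qle_def)
    then have "hm A z ?m \<preceq>[tp A z, X] hm A z c"
      using qle_hm_right[of A z ?m c] by simp
    then show "f \<preceq>[tp A z, X] hm A z c"
      by (rule hom_trans[OF le]) simp_all
  next
    assume le: "\<forall>c \<in> S. f \<preceq>[tp A z, X] hm A z c"
    \<comment> \<open>By the Yoneda lemma the assumption says that \<open>?\<nu>\<close> lies below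
      the representables of all members; it therefore belongs to \<open>T\<close> and lies below the
      representable of the supremum.\<close>
    let ?\<nu> = "cmp A (one (tp A z)) (one X) (arr f) (row A A (dist_id A) z)"
    have "?\<nu> \<in> T"
      unfolding T_def using le yoneda_lemma[OF A X R z f] S by auto
    then have "dle A (one X) ?\<nu> (row A A (dist_id A) ?m)"
      by (intro dist_le_trans[OF le_\<mu> le_row_sup]) simp_all
    then show "f \<preceq>[tp A z, X] hm A z ?m"
      by (simp add: yoneda_lemma)
  qed
  then show ?thesis
    by (intro bexI[of _ ?m]) auto
qed

end

section \<open>The quantaloid of complete categories\<close>

lemma QSup_simps [simp]:
  "Obj (QSup Q sm) = {A. qcat A \<and> sm (objs A) \<and> skeletal Q A \<and> complete Q A}"
  "Arrows (QSup Q sm) A B = {F. \<exists>G. adjoint Q A B F G}"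
  "F \<sqsubseteq>\<^bsub>Hom (QSup Q sm) A B\<^esub> G \<longleftrightarrow> (\<forall>x \<in> objs A. qle Q B (F x) (G x))"
  "Idt (QSup Q sm) A = (\<lambda>x \<in> objs A. x)" "Cmp (QSup Q sm) A B C G F = compose (objs A) G F"
  by (simp_all add: QSup_def)

context
  fixes A B :: "('o, 'a, 'b) qcat"
  assumes A [simp]: "qcat A" "qcat B" "skeletal Q B" "complete Q A" "complete Q B"
begin

text \<open>The join is formed pointwise in \<open>B\<close>. Its right adjoint is the pointwise
  meet of the right adjoints in \<open>A\<close>, since a test of \<open>F x\<close> against
  \<open>y\<close> is a test of \<open>x\<close> against \<open>R F y\<close>.\<close>

lemma left_adjoint_join:
  assumes S: "S \<subseteq> {F. \<exists>G. adjoint Q A B F G}"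
  obtains H where "\<exists>G. adjoint Q A B H G"
    and "\<And>x y f. x \<in> objs A \<Longrightarrow> y \<in> objs B \<Longrightarrow> f \<in> Arrows Q (tp A x) (tp B y) \<Longrightarrow>
      f \<preceq>[tp A x, tp B y] hm B (H x) y \<longleftrightarrow>
      (\<forall>F \<in> S. f \<preceq>[tp A x, tp B y] hm B (F x) y)"
proof -
  have "\<forall>F \<in> S. \<exists>G. adjoint Q A B F G" using S by auto
  from bchoice[OF this] obtain R where R: "\<And>F. F \<in> S \<Longrightarrow> adjoint Q A B F (R F)" by auto
  obtain s where s: "adjoint Q (psh A) A s (yoneda Q A)" using A(4) unfolding complete_def ..
  obtain s' where s': "adjoint Q (psh B) B s' (yoneda Q B)" using A(5) unfolding complete_def ..
  note adj = adjoint_objs[OF A(1,2) R]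
  have "\<exists>j \<in> objs B. tp B j = tp A x \<and> (\<forall>z \<in> objs B. \<forall>f \<in> Arrows Q (tp A x) (tp B z).
      f \<preceq>[tp A x, tp B z] hm B j z \<longleftrightarrow> (\<forall>c \<in> (\<lambda>F. F x) ` S. f \<preceq>[tp A x, tp B z] hm B c z))"
    if "x \<in> objs A" for x
    by (rule complete_joins[OF A(2) s']) (use that adj in auto)
  then have "\<forall>x \<in> objs A. \<exists>j. j \<in> objs B \<and> tp B j = tp A x \<and> (\<forall>z \<in> objs B. \<forall>f \<in> Arrows Q (tp A x) (tp B z).
      f \<preceq>[tp A x, tp B z] hm B j z \<longleftrightarrow> (\<forall>F \<in> S. f \<preceq>[tp A x, tp B z] hm B (F x) z))"
    by (simp add: Bex_def)
  from bchoice[OF this] obtain H where "\<forall>x \<in> objs A. H x \<in> objs B \<and> tp B (H x) = tp A x \<and>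
      (\<forall>z \<in> objs B. \<forall>f \<in> Arrows Q (tp A x) (tp B z). f \<preceq>[tp A x, tp B z] hm B (H x) z \<longleftrightarrow>
        (\<forall>F \<in> S. f \<preceq>[tp A x, tp B z] hm B (F x) z))" ..
  then have H: "H x \<in> objs B" "tp B (H x) = tp A x"
      "\<And>z f. z \<in> objs B \<Longrightarrow> f \<in> Arrows Q (tp A x) (tp B z) \<Longrightarrow>
        f \<preceq>[tp A x, tp B z] hm B (H x) z \<longleftrightarrow> (\<forall>F \<in> S. f \<preceq>[tp A x, tp B z] hm B (F x) z)"
      if "x \<in> objs A" for x
    using that by auto
  have "\<exists>m \<in> objs A. tp A m = tp B y \<and> (\<forall>z \<in> objs A. \<forall>f \<in> Arrows Q (tp A z) (tp B y).
      f \<preceq>[tp A z, tp B y] hm A z m \<longleftrightarrow> (\<forall>c \<in> (\<lambda>F. R F y) ` S. f \<preceq>[tp A z, tp B y] hm A z c))"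
    if "y \<in> objs B" for y
    by (rule complete_meets[OF A(1) s]) (use that adj in auto)
  then have "\<forall>y \<in> objs B. \<exists>m. m \<in> objs A \<and> tp A m = tp B y \<and> (\<forall>z \<in> objs A. \<forall>f \<in> Arrows Q (tp A z) (tp B y).
      f \<preceq>[tp A z, tp B y] hm A z m \<longleftrightarrow> (\<forall>F \<in> S. f \<preceq>[tp A z, tp B y] hm A z (R F y)))"
    by (simp add: Bex_def)
  from bchoice[OF this] obtain G where "\<forall>y \<in> objs B. G y \<in> objs A \<and> tp A (G y) = tp B y \<and>
      (\<forall>z \<in> objs A. \<forall>f \<in> Arrows Q (tp A z) (tp B y). f \<preceq>[tp A z, tp B y] hm A z (G y) \<longleftrightarrow>
        (\<forall>F \<in> S. f \<preceq>[tp A z, tp B y] hm A z (R F y)))" ..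
  then have G: "G y \<in> objs A" "tp A (G y) = tp B y"
      "\<And>z f. z \<in> objs A \<Longrightarrow> f \<in> Arrows Q (tp A z) (tp B y) \<Longrightarrow>
        f \<preceq>[tp A z, tp B y] hm A z (G y) \<longleftrightarrow> (\<forall>F \<in> S. f \<preceq>[tp A z, tp B y] hm A z (R F y))"
      if "y \<in> objs B" for y
    using that by auto
  have "adjoint Q A B (restrict H (objs A)) (restrict G (objs B))"
    by (rule adjointI) (use H G adjoint_hm_eq[OF A(1,2) R] in auto)
  then show thesis
    by (intro that[of "restrict H (objs A)"]) (use H(3) in auto)
qed

lemma pointwise_join_le_iff:
  assumes S: "S \<subseteq> {F. \<exists>G. adjoint Q A B F G}" and H: "\<exists>G. adjoint Q A B H G"
    and K: "\<exists>G. adjoint Q A B K G"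
    and char: "\<And>x y f. x \<in> objs A \<Longrightarrow> y \<in> objs B \<Longrightarrow> f \<in> Arrows Q (tp A x) (tp B y) \<Longrightarrow>
      f \<preceq>[tp A x, tp B y] hm B (H x) y \<longleftrightarrow>
      (\<forall>F \<in> S. f \<preceq>[tp A x, tp B y] hm B (F x) y)"
  shows "(\<forall>x \<in> objs A. qle Q B (H x) (K x)) \<longleftrightarrow> (\<forall>F \<in> S. \<forall>x \<in> objs A. qle Q B (F x) (K x))"
proof -
  have "qle Q B (H x) (K x) \<longleftrightarrow> (\<forall>F \<in> S. qle Q B (F x) (K x))" if x: "x \<in> objs A" for x
  proof -
    have *: "F x \<in> objs B \<and> tp B (F x) = tp A x" if "\<exists>G. adjoint Q A B F G" for F
      using that adjoint_objs[OF A(1,2)] x by blast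
    with K S H char[OF x, of "K x" "Idt Q (tp A x)"] show ?thesis
      unfolding qle_def using x by (auto simp: subset_iff)
  qed
  then show ?thesis by auto
qed

lemma QSup_hom_complete: "complete_lattice (Hom (QSup Q sm) A B)"
proof (rule complete_latticeI)
  fix F G assume "F \<in> Arrows (QSup Q sm) A B" "G \<in> Arrows (QSup Q sm) A B"
  then obtain F' G' where adj: "adjoint Q A B F F'" "adjoint Q A B G G'" by auto
  assume le: "F \<sqsubseteq>\<^bsub>Hom (QSup Q sm) A B\<^esub> G" "G \<sqsubseteq>\<^bsub>Hom (QSup Q sm) A B\<^esub> F"
  show "F = G"
  proof (rule extensionalityI[of _ "objs A"])
    fix x assume "x \<in> objs A"
    then show "F x = G x"
      using le adjoint_objs[OF A(1,2) adj(1)] adjoint_objs[OF A(1,2) adj(2)] A(3)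
      by (auto simp: skeletal_def)
  qed (use adj in \<open>auto simp: adjoint_def qfunctor_def PiE_iff\<close>)
next
  fix S assume S: "S \<subseteq> Arrows (QSup Q sm) A B"
  then obtain H where H: "\<exists>G. adjoint Q A B H G" and
    char: "\<And>x y f. x \<in> objs A \<Longrightarrow> y \<in> objs B \<Longrightarrow> f \<in> Arrows Q (tp A x) (tp B y) \<Longrightarrow>
      f \<preceq>[tp A x, tp B y] hm B (H x) y \<longleftrightarrow>
      (\<forall>F \<in> S. f \<preceq>[tp A x, tp B y] hm B (F x) y)"
    using left_adjoint_join[of S thesis] by (simp only: QSup_simps)
  have "(\<forall>x \<in> objs A. qle Q B (H x) (K x)) \<longleftrightarrow> (\<forall>F \<in> S. \<forall>x \<in> objs A. qle Q B (F x) (K x))"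
    if "\<exists>G. adjoint Q A B K G" for K
    by (rule pointwise_join_le_iff) (use S H char that in auto)
  with H show "\<exists>s \<in> Arrows (QSup Q sm) A B. \<forall>y \<in> Arrows (QSup Q sm) A B.
      s \<sqsubseteq>\<^bsub>Hom (QSup Q sm) A B\<^esub> y \<longleftrightarrow> (\<forall>x \<in> S. x \<sqsubseteq>\<^bsub>Hom (QSup Q sm) A B\<^esub> y)"
    by auto
next
  fix F G H assume "F \<in> Arrows (QSup Q sm) A B" "G \<in> Arrows (QSup Q sm) A B" "H \<in> Arrows (QSup Q sm) A B"
    "F \<sqsubseteq>\<^bsub>Hom (QSup Q sm) A B\<^esub> G" "G \<sqsubseteq>\<^bsub>Hom (QSup Q sm) A B\<^esub> H"
  then show "F \<sqsubseteq>\<^bsub>Hom (QSup Q sm) A B\<^esub> H"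
    using adjoint_objs(1)[OF A(1,2)] by simp (metis A(2) qle_trans)
next
  fix F assume "F \<in> Arrows (QSup Q sm) A B"
  then show "F \<sqsubseteq>\<^bsub>Hom (QSup Q sm) A B\<^esub> F"
    using adjoint_objs(1)[OF A(1,2)] by (auto intro: qle_refl)
qed (simp add: QSup_def)

lemma QSup_join_eqI:
  assumes S: "S \<subseteq> {F. \<exists>G. adjoint Q A B F G}" and H: "\<exists>G. adjoint Q A B H G"
    and char: "\<And>x y f. x \<in> objs A \<Longrightarrow> y \<in> objs B \<Longrightarrow> f \<in> Arrows Q (tp A x) (tp B y) \<Longrightarrow>
      f \<preceq>[tp A x, tp B y] hm B (H x) y \<longleftrightarrow>
      (\<forall>F \<in> S. f \<preceq>[tp A x, tp B y] hm B (F x) y)"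
  shows "\<Squnion>\<^bsub>Hom (QSup Q sm) A B\<^esub> S = H"
proof (rule complete_lattice.sup_eqI[OF QSup_hom_complete])
  fix K assume "K \<in> Arrows (QSup Q sm) A B"
  then show "H \<sqsubseteq>\<^bsub>Hom (QSup Q sm) A B\<^esub> K \<longleftrightarrow> (\<forall>F \<in> S. F \<sqsubseteq>\<^bsub>Hom (QSup Q sm) A B\<^esub> K)"
    using pointwise_join_le_iff[OF S H _ char, of K] by simp
qed (use S H in simp_all)

text \<open>Joins of left adjoints are not merely least upper bounds but are preserved by the
  hom-arrows, because they are computed pointwise.\<close>

lemma QSup_Sup_hm:
  assumes S: "S \<subseteq> {F. \<exists>G. adjoint Q A B F G}" and xy: "x \<in> objs A" "y \<in> objs B" "f \<in> Arrows Q (tp A x) (tp B y)"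
  shows "f \<preceq>[tp A x, tp B y] hm B ((\<Squnion>\<^bsub>Hom (QSup Q sm) A B\<^esub> S) x) y \<longleftrightarrow>
    (\<forall>F \<in> S. f \<preceq>[tp A x, tp B y] hm B (F x) y)"
proof -
  obtain H where H: "\<exists>G. adjoint Q A B H G" and
    char: "\<And>x y f. x \<in> objs A \<Longrightarrow> y \<in> objs B \<Longrightarrow> f \<in> Arrows Q (tp A x) (tp B y) \<Longrightarrow>
      f \<preceq>[tp A x, tp B y] hm B (H x) y \<longleftrightarrow>
      (\<forall>F \<in> S. f \<preceq>[tp A x, tp B y] hm B (F x) y)"
    by (rule left_adjoint_join[OF S]) blast
  have "\<Squnion>\<^bsub>Hom (QSup Q sm) A B\<^esub> S = H"
    by (rule QSup_join_eqI) (use S H char in auto)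
  then show ?thesis using char[OF xy] by simp
qed

end


lemma adjoint_id: "qcat A \<Longrightarrow> adjoint Q A A (\<lambda>x \<in> objs A. x) (\<lambda>x \<in> objs A. x)"
  by (rule adjointI) auto

lemma adjoint_comp:
  assumes [simp]: "qcat A" "qcat B" "qcat C" and F: "adjoint Q A B F F'" and G: "adjoint Q B C G G'"
  shows "adjoint Q A C (compose (objs A) G F) (compose (objs C) F' G')"
proof (rule adjointI)
  note [simp] = adjoint_objs[OF assms(1,2) F] adjoint_objs[OF assms(2,3) G] compose_eq
  fix x y f assume [simp]: "x \<in> objs A" "y \<in> objs C"
  show "f \<preceq>[tp A x, tp C y] hm C (compose (objs A) G F x) y \<longleftrightarrow>
      f \<preceq>[tp A x, tp C y] hm A x (compose (objs C) F' G' y)"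
    by (simp add: adjoint_hm_eq[OF assms(2,3) G] adjoint_hm_eq[OF assms(1,2) F])
qed (use adjoint_objs[OF assms(1,2) F] adjoint_objs[OF assms(2,3) G] in \<open>auto simp: compose_eq compose_def\<close>)

lemma left_adjoint_funcset: "\<exists>G. adjoint Q A B F G \<Longrightarrow> F \<in> objs A \<rightarrow> objs B"
  and left_adjoint_extensional: "\<exists>G. adjoint Q A B F G \<Longrightarrow> F \<in> extensional (objs A)"
  by (auto simp: adjoint_def qfunctor_def PiE_iff)

lemma QSup_Sup_left_adjoint:
  assumes "qcat A" "qcat B" "skeletal Q B" "complete Q A" "complete Q B"
    "S \<subseteq> {F. \<exists>G. adjoint Q A B F G}"
  shows "\<exists>G. adjoint Q A B (\<Squnion>\<^bsub>Hom (QSup Q sm) A B\<^esub> S) G"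
proof -
  interpret complete_lattice "Hom (QSup Q sm) A B" using assms by (intro QSup_hom_complete)
  show ?thesis using sup_closed[of S] assms by simp
qed

lemma QSup_quantaloid: "quantaloid (QSup Q sm)"
proof (rule quantaloid.intro)
  fix A B assume "A \<in> Obj (QSup Q sm)" "B \<in> Obj (QSup Q sm)"
  then show "complete_lattice (Hom (QSup Q sm) A B)"
    by (intro QSup_hom_complete) auto
next
  fix A B C F G assume "A \<in> Obj (QSup Q sm)" "B \<in> Obj (QSup Q sm)" "C \<in> Obj (QSup Q sm)"
    "F \<in> Arrows (QSup Q sm) A B" "G \<in> Arrows (QSup Q sm) B C"
  moreover from this obtain F' G' where "adjoint Q A B F F'" "adjoint Q B C G G'" by auto
  ultimately show "Cmp (QSup Q sm) A B C G F \<in> Arrows (QSup Q sm) A C"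
    using adjoint_comp[of A B C F F' G G'] by auto
next
  fix A B F assume "F \<in> Arrows (QSup Q sm) A B"
  then have F: "F \<in> objs A \<rightarrow> objs B" "F \<in> extensional (objs A)"
    using left_adjoint_funcset[of A B F] left_adjoint_extensional[of A B F] by simp_all
  show "Cmp (QSup Q sm) A A B F (Idt (QSup Q sm) A) = F"
    "Cmp (QSup Q sm) A B B (Idt (QSup Q sm) B) F = F"
    using compose_Id[OF F] Id_compose[OF F] by simp_all
next
  fix A B C D F G H assume "F \<in> Arrows (QSup Q sm) A B"
  then have F: "F \<in> objs A \<rightarrow> objs B" using left_adjoint_funcset by auto
  show "Cmp (QSup Q sm) A B D (Cmp (QSup Q sm) B C D H G) F =
      Cmp (QSup Q sm) A C D H (Cmp (QSup Q sm) A B C G F)"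
    unfolding QSup_simps by (rule compose_assoc[OF F, symmetric])
next
  fix A B C S G assume *: "A \<in> Obj (QSup Q sm)" "B \<in> Obj (QSup Q sm)" "C \<in> Obj (QSup Q sm)"
    "S \<subseteq> Arrows (QSup Q sm) A B" "G \<in> Arrows (QSup Q sm) B C"
  then have [simp]: "qcat A" "qcat B" "qcat C" "skeletal Q B" "skeletal Q C"
    "complete Q A" "complete Q B" "complete Q C" by auto
  from * have S: "S \<subseteq> {F. \<exists>G. adjoint Q A B F G}" by simp
  from * obtain R where R: "adjoint Q B C G R" by auto
  note R_objs [simp] = adjoint_objs[OF _ _ R, simplified]
  let ?H = "\<Squnion>\<^bsub>Hom (QSup Q sm) A B\<^esub> S"
  obtain R' where R': "adjoint Q A B ?H R'" using QSup_Sup_left_adjoint[of A B S] S by auto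
  have H [simp]: "?H x \<in> objs B" "tp B (?H x) = tp A x" if "x \<in> objs A" for x
    using adjoint_objs[OF _ _ R'] that by auto
  have F: "F x \<in> objs B" "tp B (F x) = tp A x" if "x \<in> objs A" "F \<in> S" for x F
    using adjoint_objs[of A B F] that S by auto
  have "\<Squnion>\<^bsub>Hom (QSup Q sm) A C\<^esub> (compose (objs A) G ` S) = compose (objs A) G ?H"
  proof (rule QSup_join_eqI)
    show "compose (objs A) G ` S \<subseteq> {F. \<exists>G. adjoint Q A C F G}"
    proof clarify
      fix F assume "F \<in> S"
      with S obtain F' where "adjoint Q A B F F'" by auto
      from adjoint_comp[OF _ _ _ this R] show "\<exists>G'. adjoint Q A C (compose (objs A) G F) G'" by auto
    qed
    show "\<exists>G'. adjoint Q A C (compose (objs A) G ?H) G'"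
      using adjoint_comp[OF _ _ _ R' R] by auto
    fix x z f assume [simp]: "x \<in> objs A" "z \<in> objs C" "f \<in> Arrows Q (tp A x) (tp C z)"
    \<comment> \<open>Postcomposition with \<open>G\<close> is moved to its right adjoint, so that
      the pointwise join is tested at \<open>R z\<close>.\<close>
    have hm: "hm C (G y) z = hm B y (R z)" if "y \<in> objs B" for y
      using adjoint_hm_eq[OF _ _ R that] by simp
    show "f \<preceq>[tp A x, tp C z] hm C (compose (objs A) G ?H x) z \<longleftrightarrow>
        (\<forall>F \<in> compose (objs A) G ` S. f \<preceq>[tp A x, tp C z] hm C (F x) z)"
      using QSup_Sup_hm[of A B S x "R z" f] S F by (simp add: compose_eq hm)
  qed simp_all
  then show "Cmp (QSup Q sm) A B C G (\<Squnion>\<^bsub>Hom (QSup Q sm) A B\<^esub> S) =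
      \<Squnion>\<^bsub>Hom (QSup Q sm) A C\<^esub> (Cmp (QSup Q sm) A B C G ` S)"
    by (simp add: QSup_def)
next
  fix A B C S F assume *: "A \<in> Obj (QSup Q sm)" "B \<in> Obj (QSup Q sm)" "C \<in> Obj (QSup Q sm)"
    "F \<in> Arrows (QSup Q sm) A B" "S \<subseteq> Arrows (QSup Q sm) B C"
  then have [simp]: "qcat A" "qcat B" "qcat C" "skeletal Q B" "skeletal Q C"
    "complete Q A" "complete Q B" "complete Q C" by auto
  from * have S: "S \<subseteq> {F. \<exists>G. adjoint Q B C F G}" by simp
  from * obtain R where R: "adjoint Q A B F R" by auto
  note R_objs [simp] = adjoint_objs[OF _ _ R, simplified]
  let ?H = "\<Squnion>\<^bsub>Hom (QSup Q sm) B C\<^esub> S"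
  obtain R' where R': "adjoint Q B C ?H R'" using QSup_Sup_left_adjoint[of B C S] S by auto
  have "\<Squnion>\<^bsub>Hom (QSup Q sm) A C\<^esub> ((\<lambda>G. compose (objs A) G F) ` S) = compose (objs A) ?H F"
  proof (rule QSup_join_eqI)
    show "(\<lambda>G. compose (objs A) G F) ` S \<subseteq> {F. \<exists>G. adjoint Q A C F G}"
    proof clarify
      fix G assume "G \<in> S"
      with S obtain G' where "adjoint Q B C G G'" by auto
      from adjoint_comp[OF _ _ _ R this] show "\<exists>G'. adjoint Q A C (compose (objs A) G F) G'" by auto
    qed
    show "\<exists>G'. adjoint Q A C (compose (objs A) ?H F) G'"
      using adjoint_comp[OF _ _ _ R R'] by auto
    fix x z f assume [simp]: "x \<in> objs A" "z \<in> objs C" "f \<in> Arrows Q (tp A x) (tp C z)"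
    show "f \<preceq>[tp A x, tp C z] hm C (compose (objs A) ?H F x) z \<longleftrightarrow>
        (\<forall>F \<in> (\<lambda>G. compose (objs A) G F) ` S. f \<preceq>[tp A x, tp C z] hm C (F x) z)"
      using QSup_Sup_hm[of B C S "F x" z f] S by (simp add: compose_eq)
  qed simp_all
  then show "Cmp (QSup Q sm) A B C (\<Squnion>\<^bsub>Hom (QSup Q sm) B C\<^esub> S) F =
      \<Squnion>\<^bsub>Hom (QSup Q sm) A C\<^esub> ((\<lambda>G. Cmp (QSup Q sm) A B C G F) ` S)"
    by (simp add: QSup_def)
qed (auto intro: adjoint_id)

end

section \<open>Full subquantaloids and opposites\<close>

lemma quantaloid_full_sub:
  assumes "quantaloid Q"
  shows "quantaloid (full_sub Q P)"
proof -
  interpret quantaloid Q by fact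
  show ?thesis
    by (rule quantaloid.intro)
      (simp_all add: full_sub_def hom_complete Cmp_assoc Cmp_sup_left Cmp_sup_right)
qed

lemma quantaloid_op:
  assumes "quantaloid Q"
  shows "quantaloid (op_quantaloid Q)"
proof -
  interpret quantaloid Q by fact
  show ?thesis
    by (rule quantaloid.intro)
      (simp_all add: op_quantaloid_def hom_complete Cmp_assoc Cmp_sup_left Cmp_sup_right)
qed

section \<open>Diagonals\<close>

lemma Arr_obj [simp]: "(X, Y, f) \<in> Obj (Arr C) \<longleftrightarrow> X \<in> Obj C \<and> Y \<in> Obj C \<and> f \<in> Arrows C X Y"
  and Arr_arrows [simp]: "(u, v) \<in> Arrows (Arr C) (X1, Y1, f) (X2, Y2, g) \<longleftrightarrow>
    u \<in> Arrows C X1 X2 \<and> v \<in> Arrows C Y1 Y2 \<and> Cmp C X1 X2 Y2 g u = Cmp C X1 Y1 Y2 v f"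
  and Arr_le [simp]: "(u, v) \<sqsubseteq>\<^bsub>Hom (Arr C) (X1, Y1, f) (X2, Y2, g)\<^esub> (u', v') \<longleftrightarrow>
    u \<sqsubseteq>\<^bsub>Hom C X1 X2\<^esub> u' \<and> v \<sqsubseteq>\<^bsub>Hom C Y1 Y2\<^esub> v'"
  and Arr_Idt [simp]: "Idt (Arr C) (X1, Y1, f) = (Idt C X1, Idt C Y1)"
  and Arr_Cmp [simp]: "Cmp (Arr C) (X1, Y1, f) (X2, Y2, g) (X3, Y3, h) (u', v') (u, v) =
    (Cmp C X1 X2 X3 u' u, Cmp C Y1 Y2 Y3 v' v)"
  by (simp_all add: Arr_def)

text \<open>The common composite, which determines the class.\<close>

definition diagonal ::
  "('o, 'a) quantaloid \<Rightarrow> 'o \<times> 'o \<times> 'a \<Rightarrow> 'o \<times> 'o \<times> 'a \<Rightarrow> 'a \<times> 'a \<Rightarrow> 'a" where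
  "diagonal C = (\<lambda>(X1, Y1, f) (X2, Y2, g) (u, v). Cmp C X1 X2 Y2 g u)"

abbreviation "dclass C \<phi> \<psi> p \<equiv> diag_rel C \<phi> \<psi> `` {p}"

lemma diag_rel_iff: "(p, q) \<in> diag_rel C \<phi> \<psi> \<longleftrightarrow>
    p \<in> Arrows (Arr C) \<phi> \<psi> \<and> q \<in> Arrows (Arr C) \<phi> \<psi> \<and> diagonal C \<phi> \<psi> p = diagonal C \<phi> \<psi> q"
  by (cases \<phi>; cases \<psi>; cases p; cases q) (auto simp: diag_rel_def diagonal_def)

lemma dclass_eq: "p \<in> Arrows (Arr C) \<phi> \<psi> \<Longrightarrow>
    dclass C \<phi> \<psi> p = {q \<in> Arrows (Arr C) \<phi> \<psi>. diagonal C \<phi> \<psi> q = diagonal C \<phi> \<psi> p}"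
  by (auto simp: diag_rel_iff)

lemma dclass_eq_iff: "p \<in> Arrows (Arr C) \<phi> \<psi> \<Longrightarrow> q \<in> Arrows (Arr C) \<phi> \<psi> \<Longrightarrow>
    dclass C \<phi> \<psi> p = dclass C \<phi> \<psi> q \<longleftrightarrow> diagonal C \<phi> \<psi> p = diagonal C \<phi> \<psi> q"
  by (auto simp: dclass_eq)

lemma Diag_simps [simp]:
  "Obj (Diag C) = Obj (Arr C)"
  "Arrows (Diag C) \<phi> \<psi> = dclass C \<phi> \<psi> ` Arrows (Arr C) \<phi> \<psi>"
  "eq (Hom (Diag C) \<phi> \<psi>) = (=)"
  "Idt (Diag C) \<phi> = dclass C \<phi> \<phi> (Idt (Arr C) \<phi>)"
  by (auto simp: Diag_def quotient_quantaloid_def quotient_def)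

context quantaloid
begin

lemma diagonal_closed [simp]:
  "\<phi> \<in> Obj (Arr Q) \<Longrightarrow> \<psi> \<in> Obj (Arr Q) \<Longrightarrow> p \<in> Arrows (Arr Q) \<phi> \<psi> \<Longrightarrow>
    diagonal Q \<phi> \<psi> p \<in> Arrows Q (fst \<phi>) (fst (snd \<psi>))"
  by (cases \<phi>; cases \<psi>; cases p) (simp add: diagonal_def)

lemma Arr_arrow_components:
  "\<phi> \<in> Obj (Arr Q) \<Longrightarrow> \<psi> \<in> Obj (Arr Q) \<Longrightarrow> p \<in> Arrows (Arr Q) \<phi> \<psi> \<Longrightarrow>
    fst p \<in> Arrows Q (fst \<phi>) (fst \<psi>) \<and> snd p \<in> Arrows Q (fst (snd \<phi>)) (fst (snd \<psi>))"
  "\<phi> \<in> Obj (Arr Q) \<Longrightarrow> fst \<phi> \<in> Obj Q \<and> fst (snd \<phi>) \<in> Obj Q"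
  by (cases \<phi>; cases \<psi>; cases p; simp) (cases \<phi>; simp)

text \<open>The diagonal of a composite can be computed from one diagonal and one component, in two
  ways. This is why changing a representative on either side leaves the class of the composite
  unchanged.\<close>

lemma Arr_comp:
  assumes "\<phi> \<in> Obj (Arr Q)" "\<psi> \<in> Obj (Arr Q)" "\<chi> \<in> Obj (Arr Q)"
    "p \<in> Arrows (Arr Q) \<phi> \<psi>" "q \<in> Arrows (Arr Q) \<psi> \<chi>"
  shows "Cmp (Arr Q) \<phi> \<psi> \<chi> q p \<in> Arrows (Arr Q) \<phi> \<chi>"
    and "diagonal Q \<phi> \<chi> (Cmp (Arr Q) \<phi> \<psi> \<chi> q p) =
      Cmp Q (fst \<phi>) (fst \<psi>) (fst (snd \<chi>)) (diagonal Q \<psi> \<chi> q) (fst p)"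
    and "diagonal Q \<phi> \<chi> (Cmp (Arr Q) \<phi> \<psi> \<chi> q p) =
      Cmp Q (fst \<phi>) (fst (snd \<psi>)) (fst (snd \<chi>)) (snd q) (diagonal Q \<phi> \<psi> p)"
proof -
  obtain X1 Y1 f where [simp]: "\<phi> = (X1, Y1, f)" by (cases \<phi>)
  obtain X2 Y2 g where [simp]: "\<psi> = (X2, Y2, g)" by (cases \<psi>)
  obtain X3 Y3 h where [simp]: "\<chi> = (X3, Y3, h)" by (cases \<chi>)
  obtain u v where [simp]: "p = (u, v)" by (cases p)
  obtain u' v' where [simp]: "q = (u', v')" by (cases q)
  have o [simp]: "X1 \<in> Obj Q" "X2 \<in> Obj Q" "X3 \<in> Obj Q" "Y1 \<in> Obj Q" "Y2 \<in> Obj Q" "Y3 \<in> Obj Q"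
    "f \<in> Arrows Q X1 Y1" "g \<in> Arrows Q X2 Y2" "h \<in> Arrows Q X3 Y3"
    "u \<in> Arrows Q X1 X2" "v \<in> Arrows Q Y1 Y2" "u' \<in> Arrows Q X2 X3" "v' \<in> Arrows Q Y2 Y3"
    and e: "Cmp Q X1 X2 Y2 g u = Cmp Q X1 Y1 Y2 v f" "Cmp Q X2 X3 Y3 h u' = Cmp Q X2 Y2 Y3 v' g"
    using assms by auto
  have 1: "Cmp Q X1 X3 Y3 h (Cmp Q X1 X2 X3 u' u) = Cmp Q X1 X2 Y3 (Cmp Q X2 Y2 Y3 v' g) u"
    by (simp flip: e(2) add: Cmp_assoc)
  have 2: "Cmp Q X1 X2 Y3 (Cmp Q X2 Y2 Y3 v' g) u = Cmp Q X1 Y2 Y3 v' (Cmp Q X1 X2 Y2 g u)"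
    by (simp add: Cmp_assoc)
  show "Cmp (Arr Q) \<phi> \<psi> \<chi> q p \<in> Arrows (Arr Q) \<phi> \<chi>"
    using 1 2 e(1) by (simp add: Cmp_assoc)
  show "diagonal Q \<phi> \<chi> (Cmp (Arr Q) \<phi> \<psi> \<chi> q p) =
      Cmp Q (fst \<phi>) (fst \<psi>) (fst (snd \<chi>)) (diagonal Q \<psi> \<chi> q) (fst p)"
    using 1 e by (simp add: diagonal_def)
  show "diagonal Q \<phi> \<chi> (Cmp (Arr Q) \<phi> \<psi> \<chi> q p) =
      Cmp Q (fst \<phi>) (fst (snd \<psi>)) (fst (snd \<chi>)) (snd q) (diagonal Q \<phi> \<psi> p)"
    using 1 2 by (simp add: diagonal_def)
qed

lemma Arr_unit_assoc:
  "\<phi> \<in> Obj (Arr Q) \<Longrightarrow> Idt (Arr Q) \<phi> \<in> Arrows (Arr Q) \<phi> \<phi>"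
  "\<lbrakk>\<phi> \<in> Obj (Arr Q); \<psi> \<in> Obj (Arr Q); p \<in> Arrows (Arr Q) \<phi> \<psi>\<rbrakk> \<Longrightarrow> Cmp (Arr Q) \<phi> \<phi> \<psi> p (Idt (Arr Q) \<phi>) = p"
  "\<lbrakk>\<phi> \<in> Obj (Arr Q); \<psi> \<in> Obj (Arr Q); p \<in> Arrows (Arr Q) \<phi> \<psi>\<rbrakk> \<Longrightarrow> Cmp (Arr Q) \<phi> \<psi> \<psi> (Idt (Arr Q) \<psi>) p = p"
  "\<lbrakk>\<phi> \<in> Obj (Arr Q); \<psi> \<in> Obj (Arr Q); \<chi> \<in> Obj (Arr Q); \<xi> \<in> Obj (Arr Q);
    p \<in> Arrows (Arr Q) \<phi> \<psi>; q \<in> Arrows (Arr Q) \<psi> \<chi>; r \<in> Arrows (Arr Q) \<chi> \<xi>\<rbrakk> \<Longrightarrow>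
    Cmp (Arr Q) \<phi> \<psi> \<xi> (Cmp (Arr Q) \<psi> \<chi> \<xi> r q) p = Cmp (Arr Q) \<phi> \<chi> \<xi> r (Cmp (Arr Q) \<phi> \<psi> \<chi> q p)"
  by (cases \<phi>; cases \<psi>; cases \<chi>; cases \<xi>; cases p; cases q; cases r; simp add: Cmp_assoc)+

definition Arr_Sup :: "'o \<times> 'o \<times> 'a \<Rightarrow> 'o \<times> 'o \<times> 'a \<Rightarrow> ('a \<times> 'a) set \<Rightarrow> 'a \<times> 'a" where
  "Arr_Sup \<phi> \<psi> S = (\<Squnion>\<^bsub>Hom Q (fst \<phi>) (fst \<psi>)\<^esub> (fst ` S), \<Squnion>\<^bsub>Hom Q (fst (snd \<phi>)) (fst (snd \<psi>))\<^esub> (snd ` S))"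

lemma Arr_Sup:
  assumes "\<phi> \<in> Obj (Arr Q)" "\<psi> \<in> Obj (Arr Q)" "S \<subseteq> Arrows (Arr Q) \<phi> \<psi>"
  shows "Arr_Sup \<phi> \<psi> S \<in> Arrows (Arr Q) \<phi> \<psi>"
    and "diagonal Q \<phi> \<psi> (Arr_Sup \<phi> \<psi> S) = \<Squnion>\<^bsub>Hom Q (fst \<phi>) (fst (snd \<psi>))\<^esub> (diagonal Q \<phi> \<psi> ` S)"
    and "p \<in> S \<Longrightarrow> p \<sqsubseteq>\<^bsub>Hom (Arr Q) \<phi> \<psi>\<^esub> Arr_Sup \<phi> \<psi> S"
proof -
  obtain X1 Y1 f where [simp]: "\<phi> = (X1, Y1, f)" by (cases \<phi>)
  obtain X2 Y2 g where [simp]: "\<psi> = (X2, Y2, g)" by (cases \<psi>)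
  have [simp]: "X1 \<in> Obj Q" "X2 \<in> Obj Q" "Y1 \<in> Obj Q" "Y2 \<in> Obj Q"
    "f \<in> Arrows Q X1 Y1" "g \<in> Arrows Q X2 Y2"
    using assms by auto
  have S [simp]: "fst ` S \<subseteq> Arrows Q X1 X2" "snd ` S \<subseteq> Arrows Q Y1 Y2"
    and e: "\<And>p. p \<in> S \<Longrightarrow> Cmp Q X1 X2 Y2 g (fst p) = Cmp Q X1 Y1 Y2 (snd p) f"
    using assms(3) by auto
  have e': "(\<lambda>p. Cmp Q X1 X2 Y2 g (fst p)) ` S = (\<lambda>p. Cmp Q X1 Y1 Y2 (snd p) f) ` S"
    by (rule image_cong) (use e in auto)
  show "Arr_Sup \<phi> \<psi> S \<in> Arrows (Arr Q) \<phi> \<psi>"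
    using e' by (simp add: Arr_Sup_def Cmp_sup_right Cmp_sup_left image_image)
  show "diagonal Q \<phi> \<psi> (Arr_Sup \<phi> \<psi> S) = \<Squnion>\<^bsub>Hom Q (fst \<phi>) (fst (snd \<psi>))\<^esub> (diagonal Q \<phi> \<psi> ` S)"
    by (simp add: Arr_Sup_def diagonal_def Cmp_sup_right image_image case_prod_unfold)
  show "p \<sqsubseteq>\<^bsub>Hom (Arr Q) \<phi> \<psi>\<^esub> Arr_Sup \<phi> \<psi> S" if "p \<in> S"
  proof -
    have "fst p \<preceq>[X1, X2] \<Squnion>\<^bsub>Hom Q X1 X2\<^esub> (fst ` S)" "snd p \<preceq>[Y1, Y2] \<Squnion>\<^bsub>Hom Q Y1 Y2\<^esub> (snd ` S)"
      using that by (simp_all add: Sup_upper)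
    then show ?thesis by (cases p) (simp add: Arr_Sup_def)
  qed
qed

text \<open>If the diagonals are comparable, \<open>q\<close> is replaced by the componentwise join
  of \<open>p\<close> and \<open>q\<close>: this still has the diagonal of \<open>q\<close>, and it
  lies above \<open>p\<close>.\<close>

lemma Diag_le_iff:
  assumes \<phi>: "\<phi> \<in> Obj (Arr Q)" "\<psi> \<in> Obj (Arr Q)" and p: "p \<in> Arrows (Arr Q) \<phi> \<psi>" and q: "q \<in> Arrows (Arr Q) \<phi> \<psi>"
  shows "dclass Q \<phi> \<psi> p \<sqsubseteq>\<^bsub>Hom (Diag Q) \<phi> \<psi>\<^esub> dclass Q \<phi> \<psi> q \<longleftrightarrow>
    diagonal Q \<phi> \<psi> p \<preceq>[fst \<phi>, fst (snd \<psi>)] diagonal Q \<phi> \<psi> q"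
proof -
  have le: "dclass Q \<phi> \<psi> p \<sqsubseteq>\<^bsub>Hom (Diag Q) \<phi> \<psi>\<^esub> dclass Q \<phi> \<psi> q \<longleftrightarrow>
      (\<exists>p' \<in> dclass Q \<phi> \<psi> p. \<exists>q' \<in> dclass Q \<phi> \<psi> q. p' \<sqsubseteq>\<^bsub>Hom (Arr Q) \<phi> \<psi>\<^esub> q')"
    by (simp add: Diag_def quotient_quantaloid_def)
  have mono: "diagonal Q \<phi> \<psi> p' \<preceq>[fst \<phi>, fst (snd \<psi>)] diagonal Q \<phi> \<psi> q'"
    if "p' \<in> Arrows (Arr Q) \<phi> \<psi>" "q' \<in> Arrows (Arr Q) \<phi> \<psi>" "p' \<sqsubseteq>\<^bsub>Hom (Arr Q) \<phi> \<psi>\<^esub> q'" for p' q'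
    using that \<phi> by (cases \<phi>; cases \<psi>; cases p'; cases q') (auto simp: diagonal_def intro!: Cmp_mono_left)
  show ?thesis
  proof
    assume "dclass Q \<phi> \<psi> p \<sqsubseteq>\<^bsub>Hom (Diag Q) \<phi> \<psi>\<^esub> dclass Q \<phi> \<psi> q"
    then obtain p' q' where *: "p' \<in> dclass Q \<phi> \<psi> p" "q' \<in> dclass Q \<phi> \<psi> q" "p' \<sqsubseteq>\<^bsub>Hom (Arr Q) \<phi> \<psi>\<^esub> q'"
      unfolding le by blast
    with mono[of p' q'] show "diagonal Q \<phi> \<psi> p \<preceq>[fst \<phi>, fst (snd \<psi>)] diagonal Q \<phi> \<psi> q"
      by (simp add: diag_rel_iff)
  next
    assume *: "diagonal Q \<phi> \<psi> p \<preceq>[fst \<phi>, fst (snd \<psi>)] diagonal Q \<phi> \<psi> q"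
    let ?s = "Arr_Sup \<phi> \<psi> {p, q}"
    have S: "{p, q} \<subseteq> Arrows (Arr Q) \<phi> \<psi>" using p q by simp
    have o: "fst \<phi> \<in> Obj Q" "fst (snd \<psi>) \<in> Obj Q" using Arr_arrow_components(2) \<phi> by auto
    have "diagonal Q \<phi> \<psi> ?s = diagonal Q \<phi> \<psi> q"
      unfolding Arr_Sup(2)[OF \<phi> S]
      by (rule complete_lattice.sup_eqI[OF hom_complete[OF o]])
        (use * p q \<phi> o in \<open>auto intro: hom_trans\<close>)
    then have "?s \<in> dclass Q \<phi> \<psi> q" "p \<in> dclass Q \<phi> \<psi> p"
      using Arr_Sup(1)[OF \<phi> S] p q by (auto simp: dclass_eq)
    then show "dclass Q \<phi> \<psi> p \<sqsubseteq>\<^bsub>Hom (Diag Q) \<phi> \<psi>\<^esub> dclass Q \<phi> \<psi> q"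
      unfolding le using Arr_Sup(3)[OF \<phi> S, of p] by blast
  qed
qed

text \<open>The representatives are exchanged one at a time, each time with the formula in which the
  exchanged arrow enters through its diagonal.\<close>

lemma Diag_Cmp:
  assumes "\<phi> \<in> Obj (Arr Q)" "\<psi> \<in> Obj (Arr Q)" "\<chi> \<in> Obj (Arr Q)"
    "p \<in> Arrows (Arr Q) \<phi> \<psi>" "q \<in> Arrows (Arr Q) \<psi> \<chi>"
  shows "Cmp (Diag Q) \<phi> \<psi> \<chi> (dclass Q \<psi> \<chi> q) (dclass Q \<phi> \<psi> p) =
    dclass Q \<phi> \<chi> (Cmp (Arr Q) \<phi> \<psi> \<chi> q p)"
proof -
  have "dclass Q \<phi> \<chi> (Cmp (Arr Q) \<phi> \<psi> \<chi> q' p') = dclass Q \<phi> \<chi> (Cmp (Arr Q) \<phi> \<psi> \<chi> q p)"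
    if p': "p' \<in> dclass Q \<phi> \<psi> p" and q': "q' \<in> dclass Q \<psi> \<chi> q" for p' q'
  proof -
    have *: "p' \<in> Arrows (Arr Q) \<phi> \<psi>" "diagonal Q \<phi> \<psi> p' = diagonal Q \<phi> \<psi> p"
      "q' \<in> Arrows (Arr Q) \<psi> \<chi>" "diagonal Q \<psi> \<chi> q' = diagonal Q \<psi> \<chi> q"
      using p' q' by (auto simp: diag_rel_iff)
    have "diagonal Q \<phi> \<chi> (Cmp (Arr Q) \<phi> \<psi> \<chi> q' p') = diagonal Q \<phi> \<chi> (Cmp (Arr Q) \<phi> \<psi> \<chi> q' p)"
      using assms * by (simp add: Arr_comp(3))
    also have "\<dots> = diagonal Q \<phi> \<chi> (Cmp (Arr Q) \<phi> \<psi> \<chi> q p)"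
      using assms * by (simp add: Arr_comp(2))
    finally show ?thesis using assms * by (simp add: dclass_eq_iff Arr_comp(1))
  qed
  moreover have "p \<in> dclass Q \<phi> \<psi> p" "q \<in> dclass Q \<psi> \<chi> q"
    using assms by (auto simp: diag_rel_iff)
  ultimately have "(\<Union>q' \<in> dclass Q \<psi> \<chi> q. \<Union>p' \<in> dclass Q \<phi> \<psi> p. dclass Q \<phi> \<chi> (Cmp (Arr Q) \<phi> \<psi> \<chi> q' p')) =
      dclass Q \<phi> \<chi> (Cmp (Arr Q) \<phi> \<psi> \<chi> q p)"
    by blast
  then show ?thesis by (simp add: Diag_def quotient_quantaloid_def)
qed

lemma Diag_Sup_le_iff:
  assumes \<phi>: "\<phi> \<in> Obj (Arr Q)" "\<psi> \<in> Obj (Arr Q)" and S: "S \<subseteq> Arrows (Arr Q) \<phi> \<psi>"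
    and c: "c \<in> Arrows (Diag Q) \<phi> \<psi>"
  shows "dclass Q \<phi> \<psi> (Arr_Sup \<phi> \<psi> S) \<sqsubseteq>\<^bsub>Hom (Diag Q) \<phi> \<psi>\<^esub> c \<longleftrightarrow>
    (\<forall>d \<in> dclass Q \<phi> \<psi> ` S. d \<sqsubseteq>\<^bsub>Hom (Diag Q) \<phi> \<psi>\<^esub> c)"
proof -
  from c obtain q where q: "q \<in> Arrows (Arr Q) \<phi> \<psi>" "c = dclass Q \<phi> \<psi> q" by auto
  have o: "fst \<phi> \<in> Obj Q" "fst (snd \<psi>) \<in> Obj Q" using Arr_arrow_components(2) \<phi> by auto
  have "diagonal Q \<phi> \<psi> (Arr_Sup \<phi> \<psi> S) \<preceq>[fst \<phi>, fst (snd \<psi>)] diagonal Q \<phi> \<psi> q \<longleftrightarrow>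
      (\<forall>p \<in> S. diagonal Q \<phi> \<psi> p \<preceq>[fst \<phi>, fst (snd \<psi>)] diagonal Q \<phi> \<psi> q)"
    unfolding Arr_Sup(2)[OF \<phi> S] using q(1) \<phi> o S by (subst Sup_le_iff) auto
  moreover have "dclass Q \<phi> \<psi> p \<sqsubseteq>\<^bsub>Hom (Diag Q) \<phi> \<psi>\<^esub> c \<longleftrightarrow>
      diagonal Q \<phi> \<psi> p \<preceq>[fst \<phi>, fst (snd \<psi>)] diagonal Q \<phi> \<psi> q" if "p \<in> Arrows (Arr Q) \<phi> \<psi>" for p
    using Diag_le_iff[OF \<phi> that q(1)] q(2) by simp
  moreover from this S have "(\<forall>p \<in> S. dclass Q \<phi> \<psi> p \<sqsubseteq>\<^bsub>Hom (Diag Q) \<phi> \<psi>\<^esub> c) \<longleftrightarrow>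
      (\<forall>p \<in> S. diagonal Q \<phi> \<psi> p \<preceq>[fst \<phi>, fst (snd \<psi>)] diagonal Q \<phi> \<psi> q)"
    by (intro ball_cong) blast+
  ultimately show ?thesis using Arr_Sup(1)[OF \<phi> S] by simp
qed

lemma Diag_hom_complete:
  assumes \<phi>: "\<phi> \<in> Obj (Arr Q)" "\<psi> \<in> Obj (Arr Q)"
  shows "complete_lattice (Hom (Diag Q) \<phi> \<psi>)"
proof (rule complete_latticeI)
  have o: "fst \<phi> \<in> Obj Q" "fst (snd \<psi>) \<in> Obj Q" using Arr_arrow_components(2) \<phi> by auto
  show "x \<sqsubseteq>\<^bsub>Hom (Diag Q) \<phi> \<psi>\<^esub> x" if "x \<in> Arrows (Diag Q) \<phi> \<psi>" for x
    using that \<phi> o by (auto simp: Diag_le_iff)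
  show "x = y" if "x \<in> Arrows (Diag Q) \<phi> \<psi>" "y \<in> Arrows (Diag Q) \<phi> \<psi>"
    "x \<sqsubseteq>\<^bsub>Hom (Diag Q) \<phi> \<psi>\<^esub> y" "y \<sqsubseteq>\<^bsub>Hom (Diag Q) \<phi> \<psi>\<^esub> x" for x y
  proof -
    from that obtain p q where *: "p \<in> Arrows (Arr Q) \<phi> \<psi>" "q \<in> Arrows (Arr Q) \<phi> \<psi>"
      and xy: "x = dclass Q \<phi> \<psi> p" "y = dclass Q \<phi> \<psi> q" by auto
    have "diagonal Q \<phi> \<psi> p = diagonal Q \<phi> \<psi> q"
      using that(3,4) * \<phi> o unfolding xy by (intro hom_antisym[OF _ _ o]) (simp_all add: Diag_le_iff)
    then show ?thesis unfolding xy using * by (simp add: dclass_eq_iff)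
  qed
  show "x \<sqsubseteq>\<^bsub>Hom (Diag Q) \<phi> \<psi>\<^esub> z" if "x \<in> Arrows (Diag Q) \<phi> \<psi>" "y \<in> Arrows (Diag Q) \<phi> \<psi>" "z \<in> Arrows (Diag Q) \<phi> \<psi>"
    "x \<sqsubseteq>\<^bsub>Hom (Diag Q) \<phi> \<psi>\<^esub> y" "y \<sqsubseteq>\<^bsub>Hom (Diag Q) \<phi> \<psi>\<^esub> z" for x y z
  proof -
    from that obtain p q r where *: "p \<in> Arrows (Arr Q) \<phi> \<psi>" "q \<in> Arrows (Arr Q) \<phi> \<psi>" "r \<in> Arrows (Arr Q) \<phi> \<psi>"
      and xy: "x = dclass Q \<phi> \<psi> p" "y = dclass Q \<phi> \<psi> q" "z = dclass Q \<phi> \<psi> r" by auto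
    show ?thesis
      using that(4,5) * \<phi> o unfolding xy
      by (simp add: Diag_le_iff) (rule hom_trans[where g = "diagonal Q \<phi> \<psi> q"], simp_all)
  qed
  fix S assume S: "S \<subseteq> Arrows (Diag Q) \<phi> \<psi>"
  then obtain P where P: "P \<subseteq> Arrows (Arr Q) \<phi> \<psi>" "S = dclass Q \<phi> \<psi> ` P"
    by (auto elim: subset_imageE)
  then show "\<exists>s \<in> Arrows (Diag Q) \<phi> \<psi>. \<forall>y \<in> Arrows (Diag Q) \<phi> \<psi>.
      s \<sqsubseteq>\<^bsub>Hom (Diag Q) \<phi> \<psi>\<^esub> y \<longleftrightarrow> (\<forall>x \<in> S. x \<sqsubseteq>\<^bsub>Hom (Diag Q) \<phi> \<psi>\<^esub> y)"
    using Diag_Sup_le_iff[OF \<phi> P(1)] Arr_Sup(1)[OF \<phi> P(1)]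
    by (intro bexI[of _ "dclass Q \<phi> \<psi> (Arr_Sup \<phi> \<psi> P)"]) auto
qed simp

lemma Diag_Sup:
  assumes \<phi>: "\<phi> \<in> Obj (Arr Q)" "\<psi> \<in> Obj (Arr Q)" and S: "S \<subseteq> Arrows (Arr Q) \<phi> \<psi>"
  shows "\<Squnion>\<^bsub>Hom (Diag Q) \<phi> \<psi>\<^esub> (dclass Q \<phi> \<psi> ` S) = dclass Q \<phi> \<psi> (Arr_Sup \<phi> \<psi> S)"
  by (rule complete_lattice.sup_eqI[OF Diag_hom_complete[OF \<phi>] _ _ Diag_Sup_le_iff[OF \<phi> S]])
    (use S Arr_Sup(1)[OF \<phi> S] in auto)

text \<open>Classes are compared through their diagonals. In a join law the varying argument enters
  the composite as its diagonal, so the law reduces to preservation of joins by composition in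
  Q.\<close>

lemma Diag_quantaloid: "quantaloid (Diag Q)"
proof (rule quantaloid.intro)
  fix \<phi> \<psi> \<chi> S d assume "\<phi> \<in> Obj (Diag Q)" "\<psi> \<in> Obj (Diag Q)" "\<chi> \<in> Obj (Diag Q)"
    "S \<subseteq> Arrows (Diag Q) \<phi> \<psi>" "d \<in> Arrows (Diag Q) \<psi> \<chi>"
  then obtain P q where o: "\<phi> \<in> Obj (Arr Q)" "\<psi> \<in> Obj (Arr Q)" "\<chi> \<in> Obj (Arr Q)"
    and P: "P \<subseteq> Arrows (Arr Q) \<phi> \<psi>" and S: "S = dclass Q \<phi> \<psi> ` P"
    and q: "q \<in> Arrows (Arr Q) \<psi> \<chi>" and d: "d = dclass Q \<psi> \<chi> q"
    by (auto elim!: subset_imageE)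
  have ob [simp]: "fst \<phi> \<in> Obj Q" "fst (snd \<psi>) \<in> Obj Q" "fst (snd \<chi>) \<in> Obj Q"
    using Arr_arrow_components(2) o by auto
  let ?c = "Cmp (Arr Q) \<phi> \<psi> \<chi> q"
  have cP: "?c ` P \<subseteq> Arrows (Arr Q) \<phi> \<chi>" by (rule image_subsetI, rule Arr_comp(1)[OF o]) (use P q in blast)+
  have "diagonal Q \<phi> \<chi> (?c (Arr_Sup \<phi> \<psi> P)) = diagonal Q \<phi> \<chi> (Arr_Sup \<phi> \<chi> (?c ` P))"
  proof -
    have "diagonal Q \<phi> \<chi> (?c (Arr_Sup \<phi> \<psi> P)) = Cmp Q (fst \<phi>) (fst (snd \<psi>)) (fst (snd \<chi>)) (snd q)
        (\<Squnion>\<^bsub>Hom Q (fst \<phi>) (fst (snd \<psi>))\<^esub> (diagonal Q \<phi> \<psi> ` P))"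
      by (simp add: Arr_comp(3)[OF o] Arr_Sup[OF o(1,2) P] q)
    also have "\<dots> = \<Squnion>\<^bsub>Hom Q (fst \<phi>) (fst (snd \<chi>))\<^esub>
        (Cmp Q (fst \<phi>) (fst (snd \<psi>)) (fst (snd \<chi>)) (snd q) ` diagonal Q \<phi> \<psi> ` P)"
      using o P Arr_arrow_components(1)[OF o(2,3) q] by (intro Cmp_sup_right) auto
    also have "Cmp Q (fst \<phi>) (fst (snd \<psi>)) (fst (snd \<chi>)) (snd q) ` diagonal Q \<phi> \<psi> ` P = diagonal Q \<phi> \<chi> ` ?c ` P"
      unfolding image_image by (rule image_cong[OF refl], rule Arr_comp(3)[OF o _ q, symmetric]) (use P in blast)
    finally show ?thesis by (simp add: Arr_Sup(2)[OF o(1,3) cP])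
  qed
  then have "dclass Q \<phi> \<chi> (?c (Arr_Sup \<phi> \<psi> P)) = dclass Q \<phi> \<chi> (Arr_Sup \<phi> \<chi> (?c ` P))"
    using Arr_comp(1)[OF o Arr_Sup(1)[OF o(1,2) P] q] Arr_Sup(1)[OF o(1,3) cP] by (simp add: dclass_eq_iff)
  moreover have "Cmp (Diag Q) \<phi> \<psi> \<chi> d ` S = dclass Q \<phi> \<chi> ` ?c ` P"
    unfolding S d image_image by (rule image_cong[OF refl], rule Diag_Cmp[OF o _ q]) (use P in blast)
  ultimately show "Cmp (Diag Q) \<phi> \<psi> \<chi> d (\<Squnion>\<^bsub>Hom (Diag Q) \<phi> \<psi>\<^esub> S) =
      \<Squnion>\<^bsub>Hom (Diag Q) \<phi> \<chi>\<^esub> (Cmp (Diag Q) \<phi> \<psi> \<chi> d ` S)"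
    by (simp add: Diag_Sup[OF o(1,3) cP] S d Diag_Sup[OF o(1,2) P] Diag_Cmp[OF o Arr_Sup(1)[OF o(1,2) P] q])
next
  fix \<phi> \<psi> \<chi> S c assume "\<phi> \<in> Obj (Diag Q)" "\<psi> \<in> Obj (Diag Q)" "\<chi> \<in> Obj (Diag Q)"
    "c \<in> Arrows (Diag Q) \<phi> \<psi>" "S \<subseteq> Arrows (Diag Q) \<psi> \<chi>"
  then obtain P p where o: "\<phi> \<in> Obj (Arr Q)" "\<psi> \<in> Obj (Arr Q)" "\<chi> \<in> Obj (Arr Q)"
    and P: "P \<subseteq> Arrows (Arr Q) \<psi> \<chi>" and S: "S = dclass Q \<psi> \<chi> ` P"
    and p: "p \<in> Arrows (Arr Q) \<phi> \<psi>" and c: "c = dclass Q \<phi> \<psi> p"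
    by (auto elim!: subset_imageE)
  have ob [simp]: "fst \<phi> \<in> Obj Q" "fst \<psi> \<in> Obj Q" "fst (snd \<psi>) \<in> Obj Q" "fst (snd \<chi>) \<in> Obj Q"
    using Arr_arrow_components(2) o by auto
  let ?c = "\<lambda>q. Cmp (Arr Q) \<phi> \<psi> \<chi> q p"
  have cP: "?c ` P \<subseteq> Arrows (Arr Q) \<phi> \<chi>" by (rule image_subsetI, rule Arr_comp(1)[OF o p]) (use P in blast)
  have "diagonal Q \<phi> \<chi> (?c (Arr_Sup \<psi> \<chi> P)) = diagonal Q \<phi> \<chi> (Arr_Sup \<phi> \<chi> (?c ` P))"
  proof -
    have "diagonal Q \<phi> \<chi> (?c (Arr_Sup \<psi> \<chi> P)) = Cmp Q (fst \<phi>) (fst \<psi>) (fst (snd \<chi>))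
        (\<Squnion>\<^bsub>Hom Q (fst \<psi>) (fst (snd \<chi>))\<^esub> (diagonal Q \<psi> \<chi> ` P)) (fst p)"
      by (simp add: Arr_comp(2)[OF o p] Arr_Sup[OF o(2,3) P])
    also have "\<dots> = \<Squnion>\<^bsub>Hom Q (fst \<phi>) (fst (snd \<chi>))\<^esub>
        ((\<lambda>d. Cmp Q (fst \<phi>) (fst \<psi>) (fst (snd \<chi>)) d (fst p)) ` diagonal Q \<psi> \<chi> ` P)"
      using o P Arr_arrow_components(1)[OF o(1,2) p] by (intro Cmp_sup_left) auto
    also have "(\<lambda>d. Cmp Q (fst \<phi>) (fst \<psi>) (fst (snd \<chi>)) d (fst p)) ` diagonal Q \<psi> \<chi> ` P = diagonal Q \<phi> \<chi> ` ?c ` P"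
      unfolding image_image by (rule image_cong[OF refl], rule Arr_comp(2)[OF o p, symmetric]) (use P in blast)
    finally show ?thesis by (simp add: Arr_Sup(2)[OF o(1,3) cP])
  qed
  then have "dclass Q \<phi> \<chi> (?c (Arr_Sup \<psi> \<chi> P)) = dclass Q \<phi> \<chi> (Arr_Sup \<phi> \<chi> (?c ` P))"
    using Arr_comp(1)[OF o p Arr_Sup(1)[OF o(2,3) P]] Arr_Sup(1)[OF o(1,3) cP] by (simp add: dclass_eq_iff)
  moreover have "(\<lambda>d. Cmp (Diag Q) \<phi> \<psi> \<chi> d c) ` S = dclass Q \<phi> \<chi> ` ?c ` P"
    unfolding S c image_image by (rule image_cong[OF refl], rule Diag_Cmp[OF o p]) (use P in blast)
  ultimately show "Cmp (Diag Q) \<phi> \<psi> \<chi> (\<Squnion>\<^bsub>Hom (Diag Q) \<psi> \<chi>\<^esub> S) c =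
      \<Squnion>\<^bsub>Hom (Diag Q) \<phi> \<chi>\<^esub> ((\<lambda>d. Cmp (Diag Q) \<phi> \<psi> \<chi> d c) ` S)"
    by (simp add: Diag_Sup[OF o(1,3) cP] S c Diag_Sup[OF o(2,3) P] Diag_Cmp[OF o p Arr_Sup(1)[OF o(2,3) P]])
next
  fix \<phi> \<psi> c assume "\<phi> \<in> Obj (Diag Q)" "\<psi> \<in> Obj (Diag Q)" "c \<in> Arrows (Diag Q) \<phi> \<psi>"
  then show "Cmp (Diag Q) \<phi> \<phi> \<psi> c (Idt (Diag Q) \<phi>) = c" "Cmp (Diag Q) \<phi> \<psi> \<psi> (Idt (Diag Q) \<psi>) c = c"
    by (auto simp: Diag_Cmp Arr_unit_assoc(1-3))
next
  fix \<xi> \<phi> \<psi> \<chi> b c d assume "\<xi> \<in> Obj (Diag Q)" "\<phi> \<in> Obj (Diag Q)" "\<psi> \<in> Obj (Diag Q)" "\<chi> \<in> Obj (Diag Q)"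
    "b \<in> Arrows (Diag Q) \<xi> \<phi>" "c \<in> Arrows (Diag Q) \<phi> \<psi>" "d \<in> Arrows (Diag Q) \<psi> \<chi>"
  then show "Cmp (Diag Q) \<xi> \<phi> \<chi> (Cmp (Diag Q) \<phi> \<psi> \<chi> d c) b = Cmp (Diag Q) \<xi> \<psi> \<chi> d (Cmp (Diag Q) \<xi> \<phi> \<psi> c b)"
    by (auto simp: Diag_Cmp Arr_comp(1) Arr_unit_assoc(4))
next
  fix \<phi> \<psi> \<chi> c d assume "\<phi> \<in> Obj (Diag Q)" "\<psi> \<in> Obj (Diag Q)" "\<chi> \<in> Obj (Diag Q)"
    "c \<in> Arrows (Diag Q) \<phi> \<psi>" "d \<in> Arrows (Diag Q) \<psi> \<chi>"
  then show "Cmp (Diag Q) \<phi> \<psi> \<chi> d c \<in> Arrows (Diag Q) \<phi> \<chi>"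
    by (auto simp: Diag_Cmp Arr_comp(1))
qed (auto simp: Diag_hom_complete Arr_unit_assoc(1))


section \<open>Functors between the categories \<open>K_obj\<close> induced by diagonals\<close>

text \<open>The composite \<open>l \<circ> \<phi>\<close> is the join of the rows of \<phi> with
  weights \<open>l\<close>, so it is bounded row by row.\<close>

lemma dist_comp_le_rows_iff:
  assumes [simp]: "qcat A" "qcat B" "X \<in> Obj Q" "dst A B \<phi>" "dst B (one X) l" "dst A (one X) \<chi>"
  shows "dle A (one X) (cmp A B (one X) l \<phi>) \<chi> \<longleftrightarrow>
    (\<forall>y \<in> objs B. dle A (one X) (cmp A (one (tp B y)) (one X) (arr (l y ())) (row A B \<phi> y)) \<chi>)"
proof -
  have l [simp]: "l y () \<in> Arrows Q (tp B y) X" if "y \<in> objs B" for y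
    using dist_arrow[OF assms(5) that, of "()"] by simp
  have "dle A (one X) (cmp A (one (tp B y)) (one X) (arr (l y ())) (row A B \<phi> y)) \<chi> \<longleftrightarrow>
      (\<forall>x \<in> objs A. Cmp Q (tp A x) (tp B y) X (l y ()) (\<phi> x y) \<preceq>[tp A x, X] \<chi> x ())"
    if "y \<in> objs B" for y
    using that by (subst dist_comp_dle_iff) simp_all
  then show ?thesis by (subst dist_comp_dle_iff) auto
qed

lemma dist_res_comp:
  assumes [simp]: "qcat A" "qcat B" "qcat C" "qcat Z" "dst A B \<zeta>" "dst B C \<psi>" "dst A Z \<chi>"
  shows "res A C Z \<chi> (cmp A B C \<psi> \<zeta>) = res B C Z (res A B Z \<chi> \<zeta>) \<psi>"
  by (rule dist_eq_if_same_lower[of C Z]) (simp_all flip: dist_res_adj add: dist_comp_assoc)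

text \<open>\<open>\<lambda> \<mapsto> \<lambda> \<circ> \<phi>\<close> identifies \<open>K_obj\<close> with the presheaves of the form \<open>\<lambda> \<circ> \<phi>\<close>; there the functor
  given by the diagonal \<open>d = \<psi> \<circ> \<zeta> = \<eta> \<circ> \<phi>\<close> is \<open>\<mu> \<mapsto> \<mu> \<circ> \<zeta>\<close> (\<open>K_map_comp\<close>).\<close>

definition K_map :: "('o, 'a, 'b) dist_arrow \<Rightarrow> ('o, 'a, 'b) dist_arrow \<Rightarrow> ('b \<Rightarrow> 'b \<Rightarrow> 'a)
    \<Rightarrow> ('o, 'a, 'b) presheaf \<Rightarrow> ('o, 'a, 'b) presheaf" where
  "K_map = (\<lambda>(A, B, \<phi>) (A', B', \<psi>) d. \<lambda>l \<in> objs (K_obj Q (A', B', \<psi>)).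
    (fst l, res A B (one (fst l)) (cmp A B' (one (fst l)) (snd l) d) \<phi>))"

context
  fixes A B :: "('o, 'a, 'b) qcat" and \<phi> and A' B' :: "('o, 'a, 'b) qcat" and \<psi>
  assumes AB [simp]: "qcat A" "qcat B" "dst A B \<phi>" "qcat A'" "qcat B'" "dst A' B' \<psi>"
begin

abbreviation (input) "K1 \<equiv> K_obj Q (A, B, \<phi>)"
abbreviation (input) "K2 \<equiv> K_obj Q (A', B', \<psi>)"
text \<open>The reflection of a presheaf into \<open>K2\<close>; the reflections of the
  representables generate \<open>K2\<close> under weighted joins.\<close>

abbreviation (input) "cl X l \<equiv> (X, res A' B' (one X) (cmp A' B' (one X) l \<psi>) \<psi>)"

lemma K12_props [simp]:
  "l \<in> objs K1 \<Longrightarrow> dst B (one (fst l)) (snd l)" "l \<in> objs K1 \<Longrightarrow> fst l \<in> Obj Q"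
  "l \<in> objs K2 \<Longrightarrow> dst B' (one (fst l)) (snd l)" "l \<in> objs K2 \<Longrightarrow> fst l \<in> Obj Q"
  using K_snd[of A B \<phi>] K_fst[of A B \<phi>] K_snd[of A' B' \<psi>] K_fst[of A' B' \<psi>] by simp_all

lemma cl_K: "l \<in> objs K2 \<Longrightarrow> cl (fst l) (snd l) = l"
  by (cases l) (simp add: K_obj_iff)

lemma cl_row: "y \<in> objs B' \<Longrightarrow> cmp A' B' (one (tp B' y)) (row B' B' (dist_id B') y) \<psi> = row A' B' \<psi> y"
  by (simp flip: row_comp)

context
  fixes \<zeta> \<eta> d
  assumes \<zeta> [simp]: "dst A A' \<zeta>" and \<eta> [simp]: "dst B B' \<eta>"
    and d_\<zeta>: "cmp A A' B' \<psi> \<zeta> = d" and d_\<eta>: "cmp A B B' \<eta> \<phi> = d"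
begin

lemma d_dist [simp]: "dst A B' d"
  unfolding d_\<eta>[symmetric] by simp

text \<open>Reassociating \<open>(l \<circ> \<eta>) \<circ> \<phi>\<close> leaves only
  \<open>d\<close>; this is the independence of the representative.\<close>

lemma K_pair_eq: "K_pair Q (A, B, \<phi>) (A', B', \<psi>) (\<zeta>, \<eta>) = K_map (A, B, \<phi>) (A', B', \<psi>) d"
  unfolding K_pair_def K_map_def prod.case
  by (rule restrict_ext) (simp add: push_def pull_def case_prod_unfold dist_comp_assoc d_\<eta>)

context
  fixes l assumes l [simp]: "l \<in> objs K2"
begin

lemma K_map_fst [simp]: "fst (K_map (A, B, \<phi>) (A', B', \<psi>) d l) = fst l"
  by (simp add: K_map_def)

lemma K_map_in [simp]: "K_map (A, B, \<phi>) (A', B', \<psi>) d l \<in> objs K1"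
  by (simp add: K_map_def res_in_K')

text \<open>The factorization through \<phi> is used here: \<open>l \<circ> d\<close> is
  \<open>(l \<circ> \<eta>) \<circ> \<phi>\<close>, an image, and residuation followed by
  composition restores it.\<close>

lemma K_map_comp: "cmp A B (one (fst l)) (snd (K_map (A, B, \<phi>) (A', B', \<psi>) d l)) \<phi> =
    cmp A B' (one (fst l)) (snd l) d"
  by (simp add: K_map_def flip: d_\<eta> dist_comp_assoc)

end

text \<open>The right adjoint sends \<open>n\<close> to the residual of
  \<open>n \<circ> \<phi>\<close> along \<open>d\<close>. It lands in \<open>K2\<close> by the other
  factorization: a residual along \<open>\<psi> \<circ> \<zeta>\<close> is in particular a residual
  along \<psi>.\<close>

lemma K_map_adjoint: "\<exists>G. adjoint Q K2 K1 (K_map (A, B, \<phi>) (A', B', \<psi>) d) G"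
proof -
  define R where "R = (\<lambda>n \<in> objs K1. (fst n, res A B' (one (fst n)) (cmp A B (one (fst n)) (snd n) \<phi>) d))"
  have R: "R n \<in> objs K2" if "n \<in> objs K1" for n
    using that by (simp add: R_def dist_res_comp res_in_K' flip: d_\<zeta>)
  have R_fst [simp]: "fst (R n) = fst n" if "n \<in> objs K1" for n
    using that by (simp add: R_def)
  have "adjoint Q K2 K1 (K_map (A, B, \<phi>) (A', B', \<psi>) d) R"
  proof (rule adjointI)
    fix l n f assume [simp]: "l \<in> objs K2" "n \<in> objs K1" and "f \<in> Arrows Q (tp K2 l) (tp K1 n)"
    then have [simp]: "f \<in> Arrows Q (fst l) (fst n)" by simp
    have "f \<preceq>[fst l, fst n] hm K1 (K_map (A, B, \<phi>) (A', B', \<psi>) d l) n \<longleftrightarrow>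
       dle A (one (fst n)) (cmp A (one (fst l)) (one (fst n)) (arr f) (cmp A B' (one (fst l)) (snd l) d))
         (cmp A B (one (fst n)) (snd n) \<phi>)"
      using K_hm_iff[of A B \<phi> "K_map (A, B, \<phi>) (A', B', \<psi>) d l" n f] by (simp add: K_map_comp)
    also have "\<dots> \<longleftrightarrow> dle B' (one (fst n)) (cmp B' (one (fst l)) (one (fst n)) (arr f) (snd l)) (snd (R n))"
      by (simp add: R_def flip: dist_res_adj) (simp add: dist_comp_assoc)
    also have "\<dots> \<longleftrightarrow> f \<preceq>[fst l, fst n] hm K2 l (R n)"
      using hm_Psh_iff[of B' "fst l" "fst n" "snd l" "snd (R n)" f] K_snd[OF _ _ _ R, of n]
      by (simp add: R prod_eq_iff[of "R n"]) (metis R_fst \<open>n \<in> objs K1\<close> prod.collapse)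
    finally show "f \<preceq>[tp K2 l, tp K1 n] hm K1 (K_map (A, B, \<phi>) (A', B', \<psi>) d l) n \<longleftrightarrow>
      f \<preceq>[tp K2 l, tp K1 n] hm K2 l (R n)" by simp
  next
    show "K_map (A, B, \<phi>) (A', B', \<psi>) d \<in> objs K2 \<rightarrow>\<^sub>E objs K1"
      by (rule PiE_I) (simp, simp add: K_map_def)
    show "R \<in> objs K1 \<rightarrow>\<^sub>E objs K2"
      by (rule PiE_I) (simp add: R, simp add: R_def)
  qed simp_all
  then show ?thesis by blast
qed

end

lemma K_map_le_iff:
  assumes [simp]: "dst A A' \<zeta>" "dst B B' \<eta>" and d: "cmp A A' B' \<psi> \<zeta> = d" "cmp A B B' \<eta> \<phi> = d"
    and [simp]: "dst A A' \<zeta>'" "dst B B' \<eta>'" and d': "cmp A A' B' \<psi> \<zeta>' = d'" "cmp A B B' \<eta>' \<phi> = d'"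
  shows "(\<forall>l \<in> objs K2. qle Q K1 (K_map (A, B, \<phi>) (A', B', \<psi>) d l) (K_map (A, B, \<phi>) (A', B', \<psi>) d' l)) \<longleftrightarrow>
    dle A B' d d'"
proof -
  have dist [simp]: "dst A B' d" "dst A B' d'"
    unfolding d(1)[symmetric] d'(1)[symmetric] by simp_all
  let ?K = "K_map (A, B, \<phi>) (A', B', \<psi>)"
  have *: "qle Q K1 (?K d l) (?K d' l) \<longleftrightarrow>
      dle A (one (fst l)) (cmp A B' (one (fst l)) (snd l) d) (cmp A B' (one (fst l)) (snd l) d')"
    if l [simp]: "l \<in> objs K2" for l
  proof -
    note [simp] = K_map_in[OF _ _ d l] K_map_in[OF _ _ d' l] K_map_fst[OF _ _ d l] K_map_fst[OF _ _ d' l]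
    show ?thesis
      using K_hm_iff[of A B \<phi> "?K d l" "?K d' l" "Idt Q (fst l)"]
      by (simp add: qle_def K_map_comp[OF _ _ d l] K_map_comp[OF _ _ d' l])
  qed
  show ?thesis
  proof
    assume "dle A B' d d'"
    then show "\<forall>l \<in> objs K2. qle Q K1 (?K d l) (?K d' l)"
      by (intro ballI, subst *) (simp_all add: dist_comp_mono_right)
  next
    assume le: "\<forall>l \<in> objs K2. qle Q K1 (?K d l) (?K d' l)"
    have "dle A (one (tp B' y)) (row A B' d y) (row A B' d' y)" if y [simp]: "y \<in> objs B'" for y
    proof -
      let ?l = "cl (tp B' y) (row B' B' (dist_id B') y)"
      have l [simp]: "?l \<in> objs K2" by (simp add: res_in_K)
      \<comment> \<open>By associativity the closure meets \<psi> before \<xi>, and there it cannot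
        be distinguished from the representable itself; evaluation at the closures thus recovers the
        rows of the diagonal.\<close>
      have row: "cmp A B' (one (tp B' y)) (snd ?l) (cmp A A' B' \<psi> \<xi>) = row A B' (cmp A A' B' \<psi> \<xi>) y"
        if [simp]: "dst A A' \<xi>" for \<xi>
      proof -
        have "cmp A B' (one (tp B' y)) (snd ?l) (cmp A A' B' \<psi> \<xi>) =
            cmp A A' (one (tp B' y)) (cmp A' B' (one (tp B' y)) (snd ?l) \<psi>) \<xi>"
          by (simp flip: dist_comp_assoc)
        also have "\<dots> = cmp A A' (one (tp B' y)) (row A' B' \<psi> y) \<xi>"
          by simp (simp add: cl_row)
        finally show ?thesis by (simp add: row_comp)
      qed
      show ?thesis using bspec[OF le l] row[of \<zeta>] row[of \<zeta>'] by (simp add: *[OF l] d d')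
    qed
    then show "dle A B' d d'" by (subst dist_le_rows_iff) simp
  qed
qed

text \<open>A left adjoint preserves weighted joins, and every element of \<open>K2\<close> is a
  weighted join of the closures \<open>?k y\<close>; so \<open>F\<close> is determined by the rows
  of \<open>d\<close>. It remains to factor \<open>d\<close> on both sides: residuation gives
  \<eta>, regularity gives \<zeta>.\<close>

lemma K_map_full:
  assumes F: "adjoint Q K2 K1 F G" and \<theta> [simp]: "dst B' A' \<theta>"
    and reg: "cmp A' A' B' \<psi> (cmp A' B' A' \<theta> \<psi>) = \<psi>"
  obtains \<zeta> \<eta> where "dst A A' \<zeta>" "dst B B' \<eta>" "cmp A A' B' \<psi> \<zeta> = cmp A B B' \<eta> \<phi>"
    "F = K_map (A, B, \<phi>) (A', B', \<psi>) (cmp A A' B' \<psi> \<zeta>)"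
proof -
  have K [simp]: "qcat K1" "qcat K2" by (rule K_qcat, simp_all)+
  note F_objs [simp] = adjoint_objs[OF K(2,1) F, simplified]
  let ?k = "\<lambda>y. cl (tp B' y) (row B' B' (dist_id B') y)"
  have k [simp]: "?k y \<in> objs K2" if "y \<in> objs B'" for y
    using that by (simp add: res_in_K)
  have k_comp: "cmp A' B' (one (tp B' y)) (snd (?k y)) \<psi> = row A' B' \<psi> y" if "y \<in> objs B'" for y
    using that by simp (simp add: cl_row)
  \<comment> \<open>The value of \<open>F\<close> is replaced by its image in \<open>psh A\<close>,
    so that the family transposes to a distributor from \<open>A\<close> to
    \<open>B'\<close>.\<close>
  define Fk where "Fk y = (tp B' y, cmp A B (one (tp B' y)) (snd (F (?k y))) \<phi>)" for y
  have Fk_dist [simp]: "dst B (one (tp B' y)) (snd (F (?k y)))" if "y \<in> objs B'" for y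
    using K_snd[of A B \<phi> "F (?k y)"] that by simp
  have hm_Fk: "f \<preceq>[tp B' y, X] hm K1 (F (?k y)) n \<longleftrightarrow>
      dle A (one X) (cmp A (one (tp B' y)) (one X) (arr f) (snd (Fk y))) (cmp A B (one X) (snd n) \<phi>)"
    if "y \<in> objs B'" "n \<in> objs K1" "fst n = X" "f \<in> Arrows Q (tp B' y) X" for y n X f
    using K_hm_iff[of A B \<phi> "F (?k y)" n f] that by (simp add: Fk_def)
  define d where "d = of_rows A B' Fk"
  have Fk: "Fk y \<in> objs (psh A)" "fst (Fk y) = tp B' y" if "y \<in> objs B'" for y
    using that by (simp_all add: Fk_def)
  have Fk_hm: "hm B' y y' \<preceq>[tp B' y, tp B' y'] hm (psh A) (Fk y) (Fk y')"
    if [simp]: "y \<in> objs B'" "y' \<in> objs B'" for y y'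
  proof -
    let ?f = "hm B' y y'"
    have "dle A' (one (tp B' y')) (cmp A' (one (tp B' y)) (one (tp B' y')) (arr ?f) (row A' B' \<psi> y)) (row A' B' \<psi> y')"
      by (subst dist_comp_dle_iff) (simp_all add: dist_act_left)
    then have 1: "?f \<preceq>[tp B' y, tp B' y'] hm K2 (?k y) (?k y')"
      using K_hm_iff[of A' B' \<psi> "?k y" "?k y'" ?f] k_comp[of y] k_comp[of y'] by simp
    have 2: "hm K2 (?k y) (?k y') \<preceq>[tp B' y, tp B' y'] hm K1 (F (?k y)) (F (?k y'))"
      using adjoint_fun_hm[OF K(2,1) F, of "?k y" "?k y'"] by simp
    have "?f \<preceq>[tp B' y, tp B' y'] hm K1 (F (?k y)) (F (?k y'))"
      by (rule hom_trans[OF 1 2])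
        (use qcat_hm[OF K(2), of "?k y" "?k y'"] qcat_hm[OF K(1), of "F (?k y)" "F (?k y')"] in simp_all)
    then show ?thesis
      using hm_Fk[of y "F (?k y')" "tp B' y'" ?f] by (simp add: Fk_def hm_Psh_iff)
  qed
  have d [simp]: "dst A B' d"
    unfolding d_def by (rule of_rows_dist) (simp_all add: Fk Fk_hm)
  have row_d: "row A B' d y = snd (Fk y)" if "y \<in> objs B'" for y
    unfolding d_def by (rule row_of_rows) (simp_all add: Fk Fk_hm that)
  \<comment> \<open>Each row of \<open>d\<close> is an image under composition with \<phi>, hence
    equal to its residual along \<phi> composed with \<phi>.\<close>
  define \<eta> where "\<eta> = res A B B' d \<phi>"
  have \<eta> [simp]: "dst B B' \<eta>" by (simp add: \<eta>_def)
  have \<eta>_d: "cmp A B B' \<eta> \<phi> = d"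
  proof (rule dist_eq_rows)
    fix y assume [simp]: "y \<in> objs B'"
    show "row A B' (cmp A B B' \<eta> \<phi>) y = row A B' d y"
      by (simp add: row_comp \<eta>_def row_res row_d) (simp add: Fk_def)
  qed simp_all
  \<comment> \<open>Preservation of weighted joins in terms of bounds: the tests of \<open>F\<close>
    at the generators move to \<open>G n\<close>, are collected there into one test of
    \<open>cl X l\<close>, and move back to \<open>F\<close>.\<close>
  have le_iff: "dle A (one X) (cmp A B' (one X) l d) (cmp A B (one X) (snd n) \<phi>) \<longleftrightarrow>
      dle A (one X) (cmp A B (one X) (snd (F (cl X l))) \<phi>) (cmp A B (one X) (snd n) \<phi>)"
    if [simp]: "X \<in> Obj Q" "dst B' (one X) l" and n [simp]: "n \<in> objs K1" "fst n = X" for X l n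
  proof -
    have cl [simp]: "cl X l \<in> objs K2" by (rule res_in_K) simp_all
    have n' [simp]: "dst B (one X) (snd n)" "dst B' (one X) (snd (G n))"
      using K_snd[of A B \<phi> n] K_snd[of A' B' \<psi> "G n"] by simp_all
    have Fcl [simp]: "dst B (one X) (snd (F (cl X l)))"
      using K_snd[of A B \<phi> "F (cl X l)"] by simp
    have l [simp]: "l y () \<in> Arrows Q (tp B' y) X" if "y \<in> objs B'" for y
      using dist_arrow[OF \<open>dst B' (one X) l\<close> that, of "()"] by simp
    have "dle A (one X) (cmp A B' (one X) l d) (cmp A B (one X) (snd n) \<phi>) \<longleftrightarrow>
        (\<forall>y \<in> objs B'. l y () \<preceq>[tp B' y, X] hm K1 (F (?k y)) n)"
      by (subst dist_comp_le_rows_iff) (simp_all add: row_d hm_Fk del: K_obj_hm)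
    also have "\<dots> \<longleftrightarrow> (\<forall>y \<in> objs B'. l y () \<preceq>[tp B' y, X] hm K2 (?k y) (G n))"
      using adjoint_hm_eq[OF K(2,1) F k n(1)] by (simp del: K_obj_hm)
    also have "\<dots> \<longleftrightarrow> (\<forall>y \<in> objs B'. dle A' (one X) (cmp A' (one (tp B' y)) (one X) (arr (l y ())) (row A' B' \<psi> y))
        (cmp A' B' (one X) (snd (G n)) \<psi>))"
    proof (rule ball_cong[OF refl])
      fix y assume [simp]: "y \<in> objs B'"
      show "l y () \<preceq>[tp B' y, X] hm K2 (?k y) (G n) \<longleftrightarrow>
        dle A' (one X) (cmp A' (one (tp B' y)) (one X) (arr (l y ())) (row A' B' \<psi> y)) (cmp A' B' (one X) (snd (G n)) \<psi>)"
        using K_hm_iff[of A' B' \<psi> "?k y" "G n" "l y ()"] k_comp[of y] by simp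
    qed
    also have "\<dots> \<longleftrightarrow> dle A' (one X) (cmp A' B' (one X) l \<psi>) (cmp A' B' (one X) (snd (G n)) \<psi>)"
      by (subst dist_comp_le_rows_iff[of A' B' X \<psi> l]) simp_all
    also have "\<dots> \<longleftrightarrow> Idt Q X \<preceq>[X, X] hm K2 (cl X l) (G n)"
      using K_hm_iff[of A' B' \<psi> "cl X l" "G n" "Idt Q X"] by simp
    also have "\<dots> \<longleftrightarrow> Idt Q X \<preceq>[X, X] hm K1 (F (cl X l)) n"
      using adjoint_hm_eq[OF K(2,1) F cl n(1)] by simp
    also have "\<dots> \<longleftrightarrow> dle A (one X) (cmp A B (one X) (snd (F (cl X l))) \<phi>) (cmp A B (one X) (snd n) \<phi>)"
      using K_hm_iff[of A B \<phi> "F (cl X l)" n "Idt Q X"] by simp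
    finally show ?thesis .
  qed
  have F_comp: "cmp A B (one X) (snd (F (cl X l))) \<phi> = cmp A B' (one X) l d"
    if [simp]: "X \<in> Obj Q" "dst B' (one X) l" for X l
  proof -
    have cl [simp]: "cl X l \<in> objs K2" by (rule res_in_K) simp_all
    have Fcl [simp]: "dst B (one X) (snd (F (cl X l)))"
      using K_snd[of A B \<phi> "F (cl X l)"] by simp
    \<comment> \<open>The composite \<open>l \<circ> d\<close> is itself the image of the closed
      presheaf \<open>?n\<close>, so both sides of the claim may serve as bounds in
      \<open>le_iff\<close>.\<close>
    let ?n = "(X, res A B (one X) (cmp A B' (one X) l d) \<phi>)"
    have "cmp A B' (one X) l d = cmp A B (one X) (cmp B B' (one X) l \<eta>) \<phi>"
      by (simp add: dist_comp_assoc \<eta>_d)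
    then have n: "cmp A B (one X) (snd ?n) \<phi> = cmp A B' (one X) l d" by simp
    have "?n \<in> objs K1" by (rule res_in_K') simp_all
    then show ?thesis
      using le_iff[of X l ?n] le_iff[of X l "F (cl X l)"] n
      by (intro dist_le_antisym[of A "one X"]) simp_all
  qed
  \<comment> \<open>By regularity the row of \<open>\<psi> \<circ> \<theta>\<close> at
    \<open>y\<close> and the representable of \<open>y\<close> have the same composite with \<psi>,
    hence the same closure; and by \<open>F_comp\<close> the composite \<open>l \<circ> d\<close>
    depends only on the closure of \<open>l\<close>.\<close>
  have d_\<theta>: "cmp A A' B' \<psi> (cmp A B' A' \<theta> d) = d"
  proof (rule dist_eq_rows)
    fix y assume y [simp]: "y \<in> objs B'"
    let ?l = "row B' B' (cmp B' A' B' \<psi> \<theta>) y"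
    have "cmp A' B' (one (tp B' y)) ?l \<psi> = row A' B' (cmp A' B' B' (cmp B' A' B' \<psi> \<theta>) \<psi>) y"
      by (simp add: row_comp)
    also have "\<dots> = cmp A' B' (one (tp B' y)) (row B' B' (dist_id B') y) \<psi>"
      by (simp add: dist_comp_assoc reg cl_row)
    finally have "cl (tp B' y) ?l = ?k y" by simp
    then have "cmp A B' (one (tp B' y)) ?l d = row A B' d y"
      using F_comp[of "tp B' y" ?l] by (simp add: row_d Fk_def)
    then show "row A B' (cmp A A' B' \<psi> (cmp A B' A' \<theta> d)) y = row A B' d y"
      by (simp add: row_comp flip: dist_comp_assoc)
  qed simp_all
  have "F = K_map (A, B, \<phi>) (A', B', \<psi>) d"
  proof (rule extensionalityI[of _ "objs K2"])
    fix l assume l [simp]: "l \<in> objs K2"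
    have "K_map (A, B, \<phi>) (A', B', \<psi>) d l =
        (fst l, res A B (one (fst l)) (cmp A B (one (fst l)) (snd (F (cl (fst l) (snd l)))) \<phi>) \<phi>)"
      by (simp add: K_map_def F_comp)
    also have "\<dots> = F l"
      unfolding cl_K[OF l] using K_closed[of A B \<phi> "F l"] by (simp add: prod_eq_iff)
    finally show "F l = K_map (A, B, \<phi>) (A', B', \<psi>) d l" ..
  qed (use F in \<open>auto simp: adjoint_def qfunctor_def PiE_iff K_map_def\<close>)
  then show thesis
    by (intro that[of "cmp A B' A' \<theta> d" \<eta>]) (simp_all add: d_\<theta> \<eta>_d)
qed

end

declare K12_props [simp del] d_dist [simp del] K_map_fst [simp del] K_map_in [simp del]

end

lemma order_iso_sup:
  assumes L: "complete_lattice L" and M: "complete_lattice M"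
    and h: "bij_betw h (carrier L) (carrier M)"
    and le: "\<And>x y. x \<in> carrier L \<Longrightarrow> y \<in> carrier L \<Longrightarrow> h x \<sqsubseteq>\<^bsub>M\<^esub> h y \<longleftrightarrow> x \<sqsubseteq>\<^bsub>L\<^esub> y"
    and S: "S \<subseteq> carrier L"
  shows "h (\<Squnion>\<^bsub>L\<^esub> S) = \<Squnion>\<^bsub>M\<^esub> (h ` S)"
proof (rule complete_lattice.sup_eqI[OF M, symmetric])
  interpret L: complete_lattice L by (rule L)
  have sup: "\<Squnion>\<^bsub>L\<^esub> S \<in> carrier L" by (rule L.sup_closed[OF S])
  show "h ` S \<subseteq> carrier M" "h (\<Squnion>\<^bsub>L\<^esub> S) \<in> carrier M"
    using S h sup by (auto simp: bij_betw_def)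
  fix y assume "y \<in> carrier M"
  then obtain x where x: "x \<in> carrier L" "y = h x" using h by (auto simp: bij_betw_def)
  have "h (\<Squnion>\<^bsub>L\<^esub> S) \<sqsubseteq>\<^bsub>M\<^esub> y \<longleftrightarrow> (\<forall>z \<in> S. z \<sqsubseteq>\<^bsub>L\<^esub> x)"
    unfolding x(2) le[OF sup x(1)] by (rule complete_lattice.sup_le_iff[OF L S x(1)])
  also have "\<dots> \<longleftrightarrow> (\<forall>z \<in> S. h z \<sqsubseteq>\<^bsub>M\<^esub> y)"
    unfolding x(2) using S le x(1) by (intro ball_cong) blast+
  finally show "h (\<Squnion>\<^bsub>L\<^esub> S) \<sqsubseteq>\<^bsub>M\<^esub> y \<longleftrightarrow> (\<forall>z \<in> h ` S. z \<sqsubseteq>\<^bsub>M\<^esub> y)" by simp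
qed

lemma full_sub_simps [simp]:
  "Obj (full_sub C P) = {X \<in> Obj C. P X}" "Hom (full_sub C P) = Hom C"
  "Idt (full_sub C P) = Idt C" "Cmp (full_sub C P) = Cmp C"
  by (simp_all add: full_sub_def)

lemma op_quantaloid_simps [simp]:
  "Obj (op_quantaloid C) = Obj C" "Hom (op_quantaloid C) X Y = Hom C Y X"
  "Idt (op_quantaloid C) = Idt C" "Cmp (op_quantaloid C) X Y Z g f = Cmp C Z Y X f g"
  by (simp_all add: op_quantaloid_def)

context quantaloid
begin

section \<open>The homomorphism \<open>K_reg\<close>\<close>

lemma DDist_reg_simps [simp]:
  "(A, B, \<phi>) \<in> Obj (DDist sm) \<longleftrightarrow>
     qcat A \<and> sm (objs A) \<and> qcat B \<and> sm (objs B) \<and> dst A B \<phi> \<and>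
     (\<exists>\<theta>. dst B A \<theta> \<and> cmp A A B \<phi> (cmp A B A \<theta> \<phi>) = \<phi>)"
  "Hom (DDist sm) = Hom (Diag (Dist sm))"
  "Idt (DDist sm) = Idt (Diag (Dist sm))"
  "Cmp (DDist sm) = Cmp (Diag (Dist sm))"
  by (auto simp: DDist_reg_def regular_arrow_def)

lemma DDist_reg_obj_Arr: "\<phi> \<in> Obj (DDist sm) \<Longrightarrow> \<phi> \<in> Obj (Arr (Dist sm))"
  by (cases \<phi>) simp

lemma DDist_reg_quantaloid: "quantaloid (DDist sm)"
  unfolding DDist_reg_def by (intro quantaloid_full_sub quantaloid.Diag_quantaloid QDist_quantaloid)

lemma QSup_ccd_simps [simp]:
  "Obj (QSup_ccd Q sm) = {A. qcat A \<and> sm (objs A) \<and> skeletal Q A \<and> ccd Q A}"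
  "Hom (QSup_ccd Q sm) = Hom (QSup Q sm)" "Idt (QSup_ccd Q sm) = Idt (QSup Q sm)"
  "Cmp (QSup_ccd Q sm) = Cmp (QSup Q sm)"
  by (auto simp: QSup_ccd_def ccd_def complete_def)

lemma QSup_ccd_quantaloid: "quantaloid (QSup_ccd Q sm)"
  unfolding QSup_ccd_def by (intro quantaloid_full_sub QSup_quantaloid)

lemma K_obj_ccd:
  assumes "\<phi> \<in> Obj (DDist sm)" "sm' (objs (K_obj Q \<phi>))"
  shows "K_obj Q \<phi> \<in> Obj (Sccd sm')"
  using assms by (cases \<phi>) (auto simp: K_skeletal intro: K_ccd)

lemma K_arr_eq:
  assumes \<phi>: "\<phi> \<in> Obj (DDist sm)" "\<psi> \<in> Obj (DDist sm)"
    and p: "p \<in> Arrows (Arr (Dist sm)) \<phi> \<psi>"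
  shows "K_arr Q \<phi> \<psi> (dclass (Dist sm) \<phi> \<psi> p) = K_map \<phi> \<psi> (diagonal (Dist sm) \<phi> \<psi> p)"
proof -
  have "K_pair Q \<phi> \<psi> q = K_map \<phi> \<psi> (diagonal (Dist sm) \<phi> \<psi> q)"
    if "q \<in> Arrows (Arr (Dist sm)) \<phi> \<psi>" for q
    using that \<phi> by (cases \<phi>; cases \<psi>; cases q) (simp add: diagonal_def K_pair_eq)
  then have "K_pair Q \<phi> \<psi> ` dclass (Dist sm) \<phi> \<psi> p = {K_map \<phi> \<psi> (diagonal (Dist sm) \<phi> \<psi> p)}"
    using p unfolding dclass_eq[OF p] by (auto intro!: image_eqI[of _ _ p])
  then show ?thesis by (simp add: K_arr_def)
qed

lemma K_arr_le_iff:
  assumes \<phi>: "\<phi> \<in> Obj (DDist sm)" "\<psi> \<in> Obj (DDist sm)"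
    and c: "c \<in> Arrows (DDist sm) \<phi> \<psi>" "d \<in> Arrows (DDist sm) \<phi> \<psi>"
  shows "K_arr Q \<phi> \<psi> c \<sqsubseteq>\<^bsub>Hom (Sccd sm') (K_obj Q \<psi>) (K_obj Q \<phi>)\<^esub> K_arr Q \<phi> \<psi> d \<longleftrightarrow>
    c \<sqsubseteq>\<^bsub>Hom (DDist sm) \<phi> \<psi>\<^esub> d"
proof -
  interpret QD: quantaloid "Dist sm" by (rule QDist_quantaloid)
  from c obtain p q where p: "p \<in> Arrows (Arr (Dist sm)) \<phi> \<psi>" "c = dclass (Dist sm) \<phi> \<psi> p"
    and q: "q \<in> Arrows (Arr (Dist sm)) \<phi> \<psi>" "d = dclass (Dist sm) \<phi> \<psi> q"
    by auto
  obtain A B f where \<phi>_eq: "\<phi> = (A, B, f)" by (cases \<phi>)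
  obtain A' B' g where \<psi>_eq: "\<psi> = (A', B', g)" by (cases \<psi>)
  obtain \<zeta> \<eta> where p_eq: "p = (\<zeta>, \<eta>)" by (cases p)
  obtain \<zeta>' \<eta>' where q_eq: "q = (\<zeta>', \<eta>')" by (cases q)
  have o: "qcat A" "qcat B" "dst A B f" "qcat A'" "qcat B'" "dst A' B' g"
    using \<phi> by (auto simp: \<phi>_eq \<psi>_eq)
  have a: "dst A A' \<zeta>" "dst B B' \<eta>" "cmp A A' B' g \<zeta> = cmp A B B' \<eta> f"
    and a': "dst A A' \<zeta>'" "dst B B' \<eta>'" "cmp A A' B' g \<zeta>' = cmp A B B' \<eta>' f"
    using p(1) q(1) by (simp_all add: \<phi>_eq \<psi>_eq p_eq q_eq)
  have "K_arr Q \<phi> \<psi> c \<sqsubseteq>\<^bsub>Hom (Sccd sm') (K_obj Q \<psi>) (K_obj Q \<phi>)\<^esub> K_arr Q \<phi> \<psi> d \<longleftrightarrow>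
      dle A B' (diagonal (Dist sm) \<phi> \<psi> p) (diagonal (Dist sm) \<phi> \<psi> q)"
    unfolding p(2) q(2) K_arr_eq[OF \<phi> p(1)] K_arr_eq[OF \<phi> q(1)]
    using K_map_le_iff[OF o a(1,2) refl a(3)[symmetric] a'(1,2) refl a'(3)[symmetric]]
    by (simp add: \<phi>_eq \<psi>_eq p_eq q_eq diagonal_def)
  also have "\<dots> \<longleftrightarrow> c \<sqsubseteq>\<^bsub>Hom (DDist sm) \<phi> \<psi>\<^esub> d"
    using QD.Diag_le_iff[OF \<phi>[THEN DDist_reg_obj_Arr] p(1) q(1)]
    by (simp add: p(2) q(2) \<phi>_eq \<psi>_eq)
  finally show ?thesis .
qed

lemma K_arr_closed:
  assumes \<phi>: "\<phi> \<in> Obj (DDist sm)" "\<psi> \<in> Obj (DDist sm)" and c: "c \<in> Arrows (DDist sm) \<phi> \<psi>"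
  shows "K_arr Q \<phi> \<psi> c \<in> Arrows (Sccd sm') (K_obj Q \<psi>) (K_obj Q \<phi>)"
proof -
  from c obtain p where p: "p \<in> Arrows (Arr (Dist sm)) \<phi> \<psi>" "c = dclass (Dist sm) \<phi> \<psi> p" by auto
  show ?thesis
    unfolding p(2) K_arr_eq[OF \<phi> p(1)]
    using \<phi> p(1) by (cases \<phi>; cases \<psi>; cases p) (auto simp: diagonal_def intro!: K_map_adjoint)
qed

text \<open>Injectivity follows from the order embedding by antisymmetry. Surjectivity is
  \<open>K_map_full\<close>, with the witness of regularity taken from \<psi>, whose
  \<open>K_obj\<close> is the domain of the functors.\<close>

lemma K_arr_bij:
  assumes \<phi>: "\<phi> \<in> Obj (DDist sm)" "\<psi> \<in> Obj (DDist sm)"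
  shows "bij_betw (K_arr Q \<phi> \<psi>) (Arrows (DDist sm) \<phi> \<psi>)
    (Arrows (Sccd sm') (K_obj Q \<psi>) (K_obj Q \<phi>))"
proof (rule bij_betw_imageI)
  interpret D: quantaloid "DDist sm" by (rule DDist_reg_quantaloid)
  obtain A B f where \<phi>_eq: "\<phi> = (A, B, f)" by (cases \<phi>)
  obtain A' B' g where \<psi>_eq: "\<psi> = (A', B', g)" by (cases \<psi>)
  have K: "qcat (K_obj Q \<phi>)" using \<phi>(1) by (simp add: \<phi>_eq)
  show "inj_on (K_arr Q \<phi> \<psi>) (Arrows (DDist sm) \<phi> \<psi>)"
  proof (rule inj_onI)
    fix c d assume c: "c \<in> Arrows (DDist sm) \<phi> \<psi>" "d \<in> Arrows (DDist sm) \<phi> \<psi>"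
      and eq: "K_arr Q \<phi> \<psi> c = K_arr Q \<phi> \<psi> d"
    obtain G where "adjoint Q (K_obj Q \<psi>) (K_obj Q \<phi>) (K_arr Q \<phi> \<psi> c) G"
      using K_arr_closed[OF \<phi> c(1)] by auto
    then have le: "K_arr Q \<phi> \<psi> c \<sqsubseteq>\<^bsub>Hom (Sccd sm') (K_obj Q \<psi>) (K_obj Q \<phi>)\<^esub> K_arr Q \<phi> \<psi> c"
      for sm' :: "_ \<Rightarrow> bool"
      by (simp add: adjoint_def qfunctor_def) (metis K PiE_mem qle_refl)
    have "c \<sqsubseteq>\<^bsub>Hom (DDist sm) \<phi> \<psi>\<^esub> d" "d \<sqsubseteq>\<^bsub>Hom (DDist sm) \<phi> \<psi>\<^esub> c"
      using K_arr_le_iff[OF \<phi> c] K_arr_le_iff[OF \<phi> c(2,1)] le by (simp_all add: eq)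
    then show "c = d" by (rule D.hom_antisym[OF _ _ \<phi> c])
  qed
  show "K_arr Q \<phi> \<psi> ` Arrows (DDist sm) \<phi> \<psi> = Arrows (Sccd sm') (K_obj Q \<psi>) (K_obj Q \<phi>)"
  proof (intro equalityI subsetI)
    fix F assume "F \<in> Arrows (Sccd sm') (K_obj Q \<psi>) (K_obj Q \<phi>)"
    then obtain G where F: "adjoint Q (K_obj Q \<psi>) (K_obj Q \<phi>) F G" by auto
    obtain \<theta> where o: "qcat A" "qcat B" "dst A B f" "qcat A'" "qcat B'" "dst A' B' g"
      and \<theta>: "dst B' A' \<theta>" "cmp A' A' B' g (cmp A' B' A' \<theta> g) = g"
      using \<phi> by (auto simp: \<phi>_eq \<psi>_eq)
    obtain \<zeta> \<eta> where z: "dst A A' \<zeta>" "dst B B' \<eta>" "cmp A A' B' g \<zeta> = cmp A B B' \<eta> f"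
      "F = K_map (A, B, f) (A', B', g) (cmp A A' B' g \<zeta>)"
      by (rule K_map_full[OF o F[unfolded \<phi>_eq \<psi>_eq] \<theta>])
    then have p: "(\<zeta>, \<eta>) \<in> Arrows (Arr (Dist sm)) \<phi> \<psi>" by (simp add: \<phi>_eq \<psi>_eq)
    have "F = K_arr Q \<phi> \<psi> (dclass (Dist sm) \<phi> \<psi> (\<zeta>, \<eta>))"
      unfolding K_arr_eq[OF \<phi> p] z(4) by (simp add: diagonal_def \<phi>_eq \<psi>_eq)
    with p show "F \<in> K_arr Q \<phi> \<psi> ` Arrows (DDist sm) \<phi> \<psi>" by simp
  qed (use K_arr_closed[OF \<phi>] in auto)
qed

text \<open>The diagonal of the identity of \<phi> is the distributor itself, and closedness says
  that \<open>K_map\<close> by it fixes every element.\<close>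

lemma K_arr_Idt:
  assumes \<phi>: "\<phi> \<in> Obj (DDist sm)"
  shows "K_arr Q \<phi> \<phi> (Idt (DDist sm) \<phi>) = (\<lambda>x \<in> objs (K_obj Q \<phi>). x)"
proof -
  interpret QD: quantaloid "Dist sm" by (rule QDist_quantaloid)
  obtain A B f where \<phi>_eq: "\<phi> = (A, B, f)" by (cases \<phi>)
  have o: "qcat A" "qcat B" "dst A B f" using \<phi> by (auto simp: \<phi>_eq)
  have "K_arr Q \<phi> \<phi> (Idt (DDist sm) \<phi>) = K_map \<phi> \<phi> (diagonal (Dist sm) \<phi> \<phi> (Idt (Arr (Dist sm)) \<phi>))"
    using K_arr_eq[OF \<phi> \<phi> QD.Arr_unit_assoc(1)[OF DDist_reg_obj_Arr[OF \<phi>]]] by simp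
  also have "\<dots> = K_map \<phi> \<phi> f"
    using o by (simp add: \<phi>_eq diagonal_def)
  also have "\<dots> = (\<lambda>x \<in> objs (K_obj Q \<phi>). x)"
    unfolding K_map_def \<phi>_eq prod.case
    by (rule restrict_ext) (use K_closed[OF o] in \<open>simp add: prod_eq_iff\<close>)
  finally show ?thesis .
qed

lemma K_arr_Cmp:
  assumes \<phi>: "\<phi> \<in> Obj (DDist sm)" "\<psi> \<in> Obj (DDist sm)" "\<chi> \<in> Obj (DDist sm)"
    and c: "c \<in> Arrows (DDist sm) \<phi> \<psi>" and d: "d \<in> Arrows (DDist sm) \<psi> \<chi>"
  shows "K_arr Q \<phi> \<chi> (Cmp (DDist sm) \<phi> \<psi> \<chi> d c) =
    compose (objs (K_obj Q \<chi>)) (K_arr Q \<phi> \<psi> c) (K_arr Q \<psi> \<chi> d)"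
proof -
  interpret QD: quantaloid "Dist sm" by (rule QDist_quantaloid)
  note ob = \<phi>[THEN DDist_reg_obj_Arr]
  from c obtain p where p: "p \<in> Arrows (Arr (Dist sm)) \<phi> \<psi>" "c = dclass (Dist sm) \<phi> \<psi> p" by auto
  from d obtain q where q: "q \<in> Arrows (Arr (Dist sm)) \<psi> \<chi>" "d = dclass (Dist sm) \<psi> \<chi> q" by auto
  obtain A1 B1 f where \<phi>_eq: "\<phi> = (A1, B1, f)" by (cases \<phi>)
  obtain A2 B2 g where \<psi>_eq: "\<psi> = (A2, B2, g)" by (cases \<psi>)
  obtain A3 B3 h where \<chi>_eq: "\<chi> = (A3, B3, h)" by (cases \<chi>)
  obtain \<zeta> \<eta> where p_eq: "p = (\<zeta>, \<eta>)" by (cases p)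
  obtain \<zeta>' \<eta>' where q_eq: "q = (\<zeta>', \<eta>')" by (cases q)
  have o [simp]: "qcat A1" "qcat B1" "dst A1 B1 f" "qcat A2" "qcat B2" "dst A2 B2 g"
    "qcat A3" "qcat B3" "dst A3 B3 h" using \<phi> by (auto simp: \<phi>_eq \<psi>_eq \<chi>_eq)
  have a [simp]: "dst A1 A2 \<zeta>" "dst B1 B2 \<eta>" "dst A2 A3 \<zeta>'" "dst B2 B3 \<eta>'"
    and e: "cmp A1 A2 B2 g \<zeta> = cmp A1 B1 B2 \<eta> f" "cmp A2 A3 B3 h \<zeta>' = cmp A2 B2 B3 \<eta>' g"
    using p(1) q(1) by (simp_all add: \<phi>_eq \<psi>_eq \<chi>_eq p_eq q_eq)
  let ?d = "cmp A1 A2 B2 g \<zeta>" and ?d' = "cmp A2 A3 B3 h \<zeta>'"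
  have "K_arr Q \<phi> \<chi> (Cmp (DDist sm) \<phi> \<psi> \<chi> d c) =
      K_map \<phi> \<chi> (diagonal (Dist sm) \<phi> \<chi> (Cmp (Arr (Dist sm)) \<phi> \<psi> \<chi> q p))"
    using K_arr_eq[OF \<phi>(1,3) QD.Arr_comp(1)[OF ob p(1) q(1)]] QD.Diag_Cmp[OF ob p(1) q(1)] by (simp add: p(2) q(2))
  also have "\<dots> = K_map \<phi> \<chi> (cmp A1 A2 B3 ?d' \<zeta>)"
    by (simp add: \<phi>_eq \<psi>_eq \<chi>_eq p_eq q_eq diagonal_def dist_comp_assoc)
  also have "\<dots> = compose (objs (K_obj Q \<chi>)) (K_map \<phi> \<psi> ?d) (K_map \<psi> \<chi> ?d')"
    unfolding compose_def
  proof (rule extensionalityI[of _ "objs (K_obj Q \<chi>)"])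
    fix l assume l: "l \<in> objs (K_obj Q \<chi>)"
    then have l' [simp]: "dst B3 (one (fst l)) (snd l)" "fst l \<in> Obj Q"
      by (simp_all add: \<chi>_eq K_snd[of A3 B3 h] K_fst[of A3 B3 h])
    let ?l = "K_map \<psi> \<chi> ?d' l"
    have l2: "?l \<in> objs (K_obj Q \<psi>)" and fst_l [simp]: "fst ?l = fst l"
      and comp: "cmp A2 B2 (one (fst l)) (snd ?l) g = cmp A2 B3 (one (fst l)) (snd l) ?d'"
      using K_map_in[OF o(4-9) a(3,4) refl e(2)[symmetric] l[unfolded \<chi>_eq]]
        K_map_fst[OF o(4-9) a(3,4) refl e(2)[symmetric] l[unfolded \<chi>_eq]]
        K_map_comp[OF o(4-9) a(3,4) refl e(2)[symmetric] l[unfolded \<chi>_eq]]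
      unfolding \<psi>_eq \<chi>_eq .
    have [simp]: "dst B2 (one (fst l)) (snd ?l)"
      using l2 K_snd[of A2 B2 g ?l] fst_l unfolding \<psi>_eq by simp
    \<comment> \<open>On images the first functor is composition with \<zeta>' and the second
      composition with \<zeta>; together they give the diagonal of the composite.\<close>
    have "cmp A1 B2 (one (fst l)) (snd ?l) ?d = cmp A1 A2 (one (fst l)) (cmp A2 B2 (one (fst l)) (snd ?l) g) \<zeta>"
      by (simp add: dist_comp_assoc)
    also have "\<dots> = cmp A1 B3 (one (fst l)) (snd l) (cmp A1 A2 B3 ?d' \<zeta>)"
      unfolding comp by (simp add: dist_comp_assoc)
    finally show "K_map \<phi> \<chi> (cmp A1 A2 B3 ?d' \<zeta>) l = (\<lambda>x \<in> objs (K_obj Q \<chi>). K_map \<phi> \<psi> ?d (K_map \<psi> \<chi> ?d' x)) l"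
      using l l2 by (simp add: K_map_def \<phi>_eq \<psi>_eq \<chi>_eq)
  qed (simp_all add: K_map_def \<phi>_eq \<chi>_eq)
  also have "K_map \<phi> \<psi> ?d = K_arr Q \<phi> \<psi> c"
    using K_arr_eq[OF \<phi>(1,2) p(1)] by (simp add: p(2)) (simp add: p_eq \<phi>_eq \<psi>_eq diagonal_def)
  also have "K_map \<psi> \<chi> ?d' = K_arr Q \<psi> \<chi> d"
    using K_arr_eq[OF \<phi>(2,3) q(1)] by (simp add: q(2)) (simp add: q_eq \<psi>_eq \<chi>_eq diagonal_def)
  finally show ?thesis .
qed

text \<open>The size predicates \<open>sm\<close> and \<open>sm'\<close> are tied only by the
  hypothesis; they are instantiated by smallness and by the predicate that always holds.\<close>

lemma K_reg_quantaloid_hom: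
  fixes sm :: "'b set \<Rightarrow> bool"
  assumes sm': "\<And>\<phi>. \<phi> \<in> Obj (DDist sm) \<Longrightarrow> sm' (objs (K_obj Q \<phi>))"
  shows "quantaloid_hom (op_quantaloid (DDist sm)) (Sccd sm') (K_obj Q) (\<lambda>\<psi> \<phi>. K_arr Q \<phi> \<psi>)"
proof (intro quantaloid_hom.intro quantaloid_hom_axioms.intro quantaloid_op DDist_reg_quantaloid QSup_ccd_quantaloid)
  interpret D: quantaloid "DDist sm" by (rule DDist_reg_quantaloid)
  interpret S: quantaloid "Sccd sm'" by (rule QSup_ccd_quantaloid)
  fix \<psi> \<phi> S assume o: "\<psi> \<in> Obj (op_quantaloid (DDist sm))" "\<phi> \<in> Obj (op_quantaloid (DDist sm))"
    and S: "S \<subseteq> Arrows (op_quantaloid (DDist sm)) \<psi> \<phi>"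
  then have o: "\<psi> \<in> Obj (DDist sm)" "\<phi> \<in> Obj (DDist sm)"
    and S: "S \<subseteq> Arrows (DDist sm) \<phi> \<psi>" by simp_all
  have "K_arr Q \<phi> \<psi> (\<Squnion>\<^bsub>Hom (DDist sm) \<phi> \<psi>\<^esub> S) =
      \<Squnion>\<^bsub>Hom (Sccd sm') (K_obj Q \<psi>) (K_obj Q \<phi>)\<^esub> (K_arr Q \<phi> \<psi> ` S)"
    by (intro order_iso_sup D.hom_complete S.hom_complete K_obj_ccd[where sm = sm]
        K_arr_bij[OF o(2,1)] K_arr_le_iff[OF o(2,1)] o S sm')
  then show "K_arr Q \<phi> \<psi> (\<Squnion>\<^bsub>Hom (op_quantaloid (DDist sm)) \<psi> \<phi>\<^esub> S) =
      \<Squnion>\<^bsub>Hom (Sccd sm') (K_obj Q \<psi>) (K_obj Q \<phi>)\<^esub> (K_arr Q \<phi> \<psi> ` S)"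
    by simp
next
  fix \<psi> \<phi> c assume "\<psi> \<in> Obj (op_quantaloid (DDist sm))" "\<phi> \<in> Obj (op_quantaloid (DDist sm))"
    "c \<in> Arrows (op_quantaloid (DDist sm)) \<psi> \<phi>"
  then show "K_arr Q \<phi> \<psi> c \<in> Arrows (Sccd sm') (K_obj Q \<psi>) (K_obj Q \<phi>)"
    by (intro K_arr_closed[where sm = sm]) simp_all
next
  fix \<phi> assume "\<phi> \<in> Obj (op_quantaloid (DDist sm))"
  then show "K_arr Q \<phi> \<phi> (Idt (op_quantaloid (DDist sm)) \<phi>) = Idt (Sccd sm') (K_obj Q \<phi>)"
    using K_arr_Idt[of \<phi> sm] by simp
next
  fix \<chi> \<psi> \<phi> d c assume "\<chi> \<in> Obj (op_quantaloid (DDist sm))" "\<psi> \<in> Obj (op_quantaloid (DDist sm))"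
    "\<phi> \<in> Obj (op_quantaloid (DDist sm))" "d \<in> Arrows (op_quantaloid (DDist sm)) \<chi> \<psi>"
    "c \<in> Arrows (op_quantaloid (DDist sm)) \<psi> \<phi>"
  then show "K_arr Q \<phi> \<chi> (Cmp (op_quantaloid (DDist sm)) \<chi> \<psi> \<phi> c d) =
      Cmp (Sccd sm') (K_obj Q \<chi>) (K_obj Q \<psi>) (K_obj Q \<phi>) (K_arr Q \<phi> \<psi> c) (K_arr Q \<psi> \<chi> d)"
    using K_arr_Cmp[of \<phi> sm \<psi> \<chi> c d] by simp
next
  fix \<phi> assume "\<phi> \<in> Obj (op_quantaloid (DDist sm))"
  then show "K_obj Q \<phi> \<in> Obj (Sccd sm')"
    using sm' by (intro K_obj_ccd) simp_all
qed

lemma K_reg_fully_faithful: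
  "fully_faithful (op_quantaloid (DDist sm)) (Sccd sm') (K_obj Q) (\<lambda>\<psi> \<phi>. K_arr Q \<phi> \<psi>)"
  unfolding fully_faithful_def op_quantaloid_simps by (intro ballI K_arr_bij)


section \<open>Every completely distributive category is of the form \<open>K_obj\<close>\<close>

text \<open>Composition with an isomorphism has composition with the inverse as right
  adjoint.\<close>

lemma dist_res_iso:
  assumes [simp]: "qcat A" "qcat B" "qcat Z" "dst A B \<alpha>" "dst B A \<beta>" "dst A Z \<chi>"
    and "cmp A B A \<beta> \<alpha> = dist_id A" "cmp B A B \<alpha> \<beta> = dist_id B"
  shows "res A B Z \<chi> \<alpha> = cmp B A Z \<chi> \<beta>"
proof (rule dist_le_antisym[of B Z])
  have "cmp B A Z (cmp A B Z (res A B Z \<chi> \<alpha>) \<alpha>) \<beta> = res A B Z \<chi> \<alpha>"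
    by (simp add: dist_comp_assoc assms(8))
  moreover have "dle B Z (cmp B A Z (cmp A B Z (res A B Z \<chi> \<alpha>) \<alpha>) \<beta>) (cmp B A Z \<chi> \<beta>)"
    by (intro dist_comp_mono_left dist_res_counit) simp_all
  ultimately show "dle B Z (res A B Z \<chi> \<alpha>) (cmp B A Z \<chi> \<beta>)" by simp
  show "dle B Z (cmp B A Z \<chi> \<beta>) (res A B Z \<chi> \<alpha>)"
    by (simp flip: dist_res_adj add: dist_comp_assoc assms(7))
qed simp_all

context
  fixes C :: "('o, 'a, 'c) qcat" and s t
  assumes C [simp]: "qcat C" and sk: "skeletal Q C"
    and s: "adjoint Q (psh C) C s (yoneda Q C)" and t: "adjoint Q C (psh C) t s"
begin

lemma t_in: "y \<in> objs C \<Longrightarrow> t y \<in> objs (psh C)" "y \<in> objs C \<Longrightarrow> fst (t y) = tp C y"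
  using adjoint_objs(1,3)[OF C Psh_qcat[OF C] t] by simp_all

text \<open>The totally below relation of \<open>C\<close>.\<close>

definition below :: "'c \<Rightarrow> 'c \<Rightarrow> 'a" where
  "below = of_rows C C t"

lemma below_dist [simp]: "dst C C below"
  unfolding below_def using adjoint_fun_hm[OF C Psh_qcat[OF C] t] by (intro of_rows_dist) (simp_all add: t_in)

lemma row_below: "y \<in> objs C \<Longrightarrow> row C C below y = snd (t y)"
  unfolding below_def using adjoint_fun_hm[OF C Psh_qcat[OF C] t] by (intro row_of_rows) (simp_all add: t_in)

lemma t_eq: "y \<in> objs C \<Longrightarrow> t y = (tp C y, row C C below y)"
  using t_in(2)[of y] by (simp add: row_below prod_eq_iff)

context
  fixes X \<Theta>
  assumes \<Theta> [simp]: "X \<in> Obj Q" "dst C (one X) \<Theta>"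
begin

lemma s_in [simp]: "s (X, \<Theta>) \<in> objs C" "tp C (s (X, \<Theta>)) = X"
  using sup_in[OF C s \<Theta>] by simp_all

lemma row_s_dist [simp]: "dst C (one X) (row C C (dist_id C) (s (X, \<Theta>)))"
  using row_dist[of C C "dist_id C" "s (X, \<Theta>)"] by simp

text \<open>Testing with \<nu> turns \<open>\<nu> \<circ> below\<close> into the presheaves
  \<open>t y\<close> scaled by \<open>\<nu> y ()\<close>, and the adjunction of \<open>t\<close> and
  \<open>s\<close> moves each of these tests to the hom-arrow from \<open>y\<close> to
  \<open>s (X, \<Theta>)\<close>.\<close>

lemma res_below: "res C C (one X) \<Theta> below = row C C (dist_id C) (s (X, \<Theta>))"
proof (rule dist_eq_if_same_lower[of C "one X"])
  fix \<nu> assume [simp]: "dst C (one X) \<nu>"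
  have \<nu> [simp]: "\<nu> y () \<in> Arrows Q (tp C y) X" if "y \<in> objs C" for y
    using dist_arrow[OF \<open>dst C (one X) \<nu>\<close> that, of "()"] by simp
  have "dle C (one X) \<nu> (res C C (one X) \<Theta> below) \<longleftrightarrow> (\<forall>y \<in> objs C.
      dle C (one X) (cmp C (one (tp C y)) (one X) (arr (\<nu> y ())) (row C C below y)) \<Theta>)"
    by (simp flip: dist_res_adj add: dist_comp_le_rows_iff)
  also have "\<dots> \<longleftrightarrow> (\<forall>y \<in> objs C. \<nu> y () \<preceq>[tp C y, X] hm C y (s (X, \<Theta>)))"
    using adjoint_hm_eq[OF C Psh_qcat[OF C] t, where y = "(X, \<Theta>)"]
    by (intro ball_cong) (simp_all add: t_eq flip: hm_Psh_iff)
  also have "\<dots> \<longleftrightarrow> dle C (one X) \<nu> (row C C (dist_id C) (s (X, \<Theta>)))"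
    by (simp add: dist_le_def)
  finally show "dle C (one X) \<nu> (res C C (one X) \<Theta> below) \<longleftrightarrow>
      dle C (one X) \<nu> (row C C (dist_id C) (s (X, \<Theta>)))" .
qed simp_all

end

lemma eq_if_same_hm:
  assumes "y \<in> objs C" "z \<in> objs C" "tp C y = tp C z"
    and hm: "\<And>w. w \<in> objs C \<Longrightarrow> hm C y w = hm C z w"
  shows "y = z"
  using sk assms qcat_id[OF C, of y] qcat_id[OF C, of z] by (auto simp: skeletal_def qle_def)

text \<open>The Yoneda embedding is fully faithful, so its left adjoint inverts it up to
  isomorphism; skeletality makes this an equality.\<close>

lemma s_row: 
  assumes [simp]: "y \<in> objs C"
  shows "s (tp C y, row C C (dist_id C) y) = y"
proof (rule eq_if_same_hm)
  fix w assume [simp]: "w \<in> objs C"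
  have [simp]: "dst C (one (tp C w)) (row C C (dist_id C) w)" by simp
  show "hm C (s (tp C y, row C C (dist_id C) y)) w = hm C y w"
    by (rule eq_if_same_lower[of "tp C y" "tp C w"])
      (use qcat_hm[OF C, of "s (tp C y, row C C (dist_id C) y)" w] in
        \<open>simp_all add: sup_hm_iff[OF C s] yoneda_lemma\<close>)
qed simp_all

text \<open>In an adjoint triple the outer functors are fully faithful together. Here
  \<open>t y\<close> lies below the representable of \<open>y\<close>, since \<open>y\<close> is the
  supremum of the latter; the unit of \<open>t\<close> gives the other inequality.\<close>

lemma s_t:
  assumes [simp]: "y \<in> objs C"
  shows "s (t y) = y"
proof -
  let ?sty = "s (t y)"
  have sty [simp]: "?sty \<in> objs C" "tp C ?sty = tp C y" by (simp_all add: t_eq)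
  have tid: "dle C (one (tp C y)) (row C C below y) (row C C (dist_id C) y)"
  proof -
    have "Idt Q (tp C y) \<preceq>[tp C y, tp C y] hm (psh C) (t y) (tp C y, row C C (dist_id C) y)"
      using adjoint_hm_eq[OF C Psh_qcat[OF C] t, where x = y and y = "(tp C y, row C C (dist_id C) y)"]
      by (simp add: s_row qcat_id)
    then show ?thesis by (simp add: t_eq hm_Psh_iff)
  qed
  have "qle Q C ?sty y"
    using sup_hm_iff[OF C s, of "tp C y" "row C C below y" y "Idt Q (tp C y)"] tid
    by (simp add: qle_def t_eq)
  moreover have "qle Q C y ?sty"
    using adjoint_unit[OF C Psh_qcat[OF C] t, of y] by simp
  ultimately show ?thesis using sk by (auto simp: skeletal_def)
qed

text \<open>The interpolation property of the totally below relation. For a bound \<Theta>, both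
  sides are tested by \<open>y\<close> lying below the supremum of \<Theta>: on the left by
  \<open>res_below\<close> and \<open>s_t\<close>, on the right by adjunction.\<close>

lemma below_idem: "cmp C C C below below = below"
proof (rule dist_eq_rows)
  fix y assume [simp]: "y \<in> objs C"
  have "cmp C C (one (tp C y)) (row C C below y) below = row C C below y"
  proof (rule dist_eq_if_same_upper[of C "one (tp C y)"])
    fix \<Theta> assume [simp]: "dst C (one (tp C y)) \<Theta>"
    have "dle C (one (tp C y)) (cmp C C (one (tp C y)) (row C C below y) below) \<Theta> \<longleftrightarrow>
        dle C (one (tp C y)) (row C C below y) (row C C (dist_id C) (s (tp C y, \<Theta>)))"
      by (simp add: dist_res_adj res_below)
    also have "\<dots> \<longleftrightarrow> Idt Q (tp C y) \<preceq>[tp C y, tp C y] hm C (s (t y)) (s (tp C y, \<Theta>))"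
      using sup_hm_iff[OF C s, of "tp C y" "row C C below y" "s (tp C y, \<Theta>)" "Idt Q (tp C y)"]
      by (simp add: t_eq)
    also have "\<dots> \<longleftrightarrow> Idt Q (tp C y) \<preceq>[tp C y, tp C y] hm (psh C) (t y) (tp C y, \<Theta>)"
      using adjoint_hm_eq[OF C Psh_qcat[OF C] t, where x = y and y = "(tp C y, \<Theta>)"] by (simp add: s_t)
    also have "\<dots> \<longleftrightarrow> dle C (one (tp C y)) (row C C below y) \<Theta>"
      by (simp add: t_eq hm_Psh_iff)
    finally show "dle C (one (tp C y)) (cmp C C (one (tp C y)) (row C C below y) below) \<Theta> \<longleftrightarrow>
      dle C (one (tp C y)) (row C C below y) \<Theta>" .
  qed simp_all
  then show "row C C (cmp C C C below below) y = row C C below y" by (simp add: row_comp)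
qed simp_all

context
  fixes A :: "('o, 'a, 'b) qcat" and \<alpha> \<beta>
  assumes A [simp]: "qcat A" "dst A C \<alpha>" "dst C A \<beta>"
    and \<beta>\<alpha>: "cmp A C A \<beta> \<alpha> = dist_id A" and \<alpha>\<beta>: "cmp C A C \<alpha> \<beta> = dist_id C"
begin

text \<open>The transport of \<open>below\<close> along an isomorphism of \<open>A\<close> and \<open>C\<close> in the category of
  distributors; it lives on the object type of \<open>A\<close>.\<close>

abbreviation (input) "below' \<equiv> cmp A C A \<beta> (cmp A C C below \<alpha>)"

lemma below'_idem: "cmp A A A below' below' = below'"
proof -
  have "cmp A A A below' below' = cmp A C A \<beta> (cmp A C C below (cmp A C C (cmp C A C \<alpha> \<beta>) (cmp A C C below \<alpha>)))"
    by (simp add: dist_comp_assoc)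
  also have "\<dots> = cmp A C A \<beta> (cmp A C C (cmp C C C below below) \<alpha>)"
    unfolding \<alpha>\<beta> by (simp add: dist_comp_assoc)
  finally show ?thesis by (simp add: below_idem)
qed

text \<open>Residuals along \<alpha> and \<beta> are composites with their inverses, which reduces
  the claim to \<open>res_below\<close> on \<open>C\<close>.\<close>

lemma res_below':
  assumes [simp]: "X \<in> Obj Q" "dst A (one X) m"
  shows "res A A (one X) m below' = row A C \<alpha> (s (X, cmp C A (one X) m \<beta>))"
proof -
  have r\<alpha>: "res A C (one X) m' \<alpha> = cmp C A (one X) m' \<beta>" if "dst A (one X) m'" for m'
    using that by (intro dist_res_iso) (simp_all add: \<alpha>\<beta> \<beta>\<alpha>)
  have r\<beta>: "res C A (one X) m' \<beta> = cmp A C (one X) m' \<alpha>" if "dst C (one X) m'" for m'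
    using that by (intro dist_res_iso) (simp_all add: \<alpha>\<beta> \<beta>\<alpha>)
  let ?c = "s (X, cmp C A (one X) m \<beta>)"
  have c [simp]: "?c \<in> objs C" "tp C ?c = X" by simp_all
  have "res A A (one X) m below' = cmp A C (one X) (row C C (dist_id C) ?c) \<alpha>"
    by (simp add: dist_res_comp r\<alpha> r\<beta> res_below)
  also have "\<dots> = row A C \<alpha> ?c"
    using row_comp[of A C C \<alpha> "dist_id C" ?c] by simp
  finally show ?thesis .
qed

lemma row_\<alpha>:
  assumes [simp]: "c \<in> objs C"
  shows "row A C \<alpha> c = cmp A C (one (tp C c)) (row C C (dist_id C) c) \<alpha>"
    and "cmp C A (one (tp C c)) (row A C \<alpha> c) \<beta> = row C C (dist_id C) c"
  by (simp_all flip: row_comp add: \<alpha>\<beta>)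

text \<open>Up to the isomorphism, the composite of the representable of \<open>c\<close> with
  \<open>below\<close> is \<open>t c\<close>, whose supremum is \<open>c\<close> again.\<close>

lemma row_\<alpha>_K: 
  assumes [simp]: "c \<in> objs C"
  shows "(tp C c, row A C \<alpha> c) \<in> objs (K_obj Q (A, A, below'))"
proof -
  have "cmp C A (one (tp C c)) (cmp A A (one (tp C c)) (row A C \<alpha> c) below') \<beta> =
      cmp C C (one (tp C c)) (cmp C A (one (tp C c)) (row A C \<alpha> c) \<beta>) (cmp C A C (cmp A C C below \<alpha>) \<beta>)"
    by (simp add: dist_comp_assoc)
  also have "\<dots> = row C C (cmp C C C (dist_id C) below) c"
    unfolding row_\<alpha>(2)[OF assms] by (simp add: dist_comp_assoc \<alpha>\<beta>) (simp flip: row_comp)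
  also have "\<dots> = row C C below c" by simp
  finally show ?thesis
    using s_t[OF assms] by (simp add: K_obj_iff res_below' t_eq)
qed

text \<open>A fixed presheaf is a residual along \<open>below'\<close>, hence a transported
  representable by \<open>res_below'\<close>; its supremum returns the representing object by
  \<open>s_row\<close>.\<close>

lemma K_elem:
  assumes "(X, l) \<in> objs (K_obj Q (A, A, below'))"
  shows "s (X, cmp C A (one X) l \<beta>) \<in> objs C" "tp C (s (X, cmp C A (one X) l \<beta>)) = X"
    "row A C \<alpha> (s (X, cmp C A (one X) l \<beta>)) = l"
proof -
  have [simp]: "X \<in> Obj Q" "dst A (one X) l" and eq: "res A A (one X) (cmp A A (one X) l below') below' = l"
    using assms by (simp_all add: K_obj_iff)
  show c: "s (X, cmp C A (one X) l \<beta>) \<in> objs C" "tp C (s (X, cmp C A (one X) l \<beta>)) = X"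
    by simp_all
  define c where "c = s (X, cmp C A (one X) (cmp A A (one X) l below') \<beta>)"
  have c [simp]: "c \<in> objs C" "tp C c = X" by (simp_all add: c_def)
  have l: "l = row A C \<alpha> c"
    using eq res_below'[of X "cmp A A (one X) l below'"] by (simp add: c_def)
  have "cmp C A (one X) l \<beta> = row C C (dist_id C) c"
    using row_\<alpha>(2)[of c] by (simp add: l)
  then show "row A C \<alpha> (s (X, cmp C A (one X) l \<beta>)) = l"
    using s_row[of c] by (simp add: l)
qed

text \<open>Composition with \<alpha> is invertible and so reflects inequalities; what remains on
  \<open>C\<close> is the Yoneda lemma.\<close>

lemma hm_row_\<alpha>:
  assumes [simp]: "c \<in> objs C" "c' \<in> objs C"
  shows "hm (psh A) (tp C c, row A C \<alpha> c) (tp C c', row A C \<alpha> c') = hm C c c'"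
proof (rule eq_if_same_lower[of "tp C c" "tp C c'"])
  fix f assume f [simp]: "f \<in> Arrows Q (tp C c) (tp C c')"
  let ?X = "tp C c" and ?Y = "tp C c'" and ?r = "row C C (dist_id C)"
  have r [simp]: "dst C (one ?X) (?r c)" "dst C (one ?Y) (?r c')" by simp_all
  have "f \<preceq>[?X, ?Y] hm (psh A) (?X, row A C \<alpha> c) (?Y, row A C \<alpha> c') \<longleftrightarrow>
      dle A (one ?Y) (cmp A C (one ?Y) (cmp C (one ?X) (one ?Y) (arr f) (?r c)) \<alpha>) (cmp A C (one ?Y) (?r c') \<alpha>)"
    by (simp add: hm_Psh_iff row_\<alpha>(1) dist_comp_assoc)
  also have "\<dots> \<longleftrightarrow> dle C (one ?Y) (cmp C (one ?X) (one ?Y) (arr f) (?r c)) (?r c')"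
  proof
    assume "dle A (one ?Y) (cmp A C (one ?Y) (cmp C (one ?X) (one ?Y) (arr f) (?r c)) \<alpha>) (cmp A C (one ?Y) (?r c') \<alpha>)"
    then have "dle C (one ?Y) (cmp C A (one ?Y) (cmp A C (one ?Y) (cmp C (one ?X) (one ?Y) (arr f) (?r c)) \<alpha>) \<beta>)
        (cmp C A (one ?Y) (cmp A C (one ?Y) (?r c') \<alpha>) \<beta>)"
      by (rule dist_comp_mono_left) simp_all
    then show "dle C (one ?Y) (cmp C (one ?X) (one ?Y) (arr f) (?r c)) (?r c')"
      by (simp add: dist_comp_assoc \<alpha>\<beta>)
  qed (rule dist_comp_mono_left, simp_all)
  also have "\<dots> \<longleftrightarrow> f \<preceq>[?X, ?Y] hm C c c'"
    by (simp add: yoneda_lemma)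
  finally show "f \<preceq>[?X, ?Y] hm (psh A) (?X, row A C \<alpha> c) (?Y, row A C \<alpha> c') \<longleftrightarrow>
      f \<preceq>[?X, ?Y] hm C c c'" .
qed simp_all

lemma K_iso: "qcat_isomorphic Q (K_obj Q (A, A, below')) C"
proof -
  let ?M = "K_obj Q (A, A, below')"
  define F where "F = (\<lambda>l \<in> objs ?M. s (fst l, cmp C A (one (fst l)) (snd l) \<beta>))"
  define G where "G = (\<lambda>c \<in> objs C. (tp C c, row A C \<alpha> c))"
  have F: "F l \<in> objs C" "tp C (F l) = fst l" "row A C \<alpha> (F l) = snd l" if "l \<in> objs ?M" for l
    using that K_elem[of "fst l" "snd l"] by (simp_all add: F_def)
  have G: "G c \<in> objs ?M" if "c \<in> objs C" for c
    using that by (simp add: G_def row_\<alpha>_K)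
  have GF: "G (F l) = l" if "l \<in> objs ?M" for l
    using F[OF that] by (simp add: G_def prod_eq_iff)
  have FG: "F (G c) = c" if "c \<in> objs C" for c
    using that G[OF that] by (simp add: F_def) (simp add: G_def row_\<alpha>(2) s_row)
  have hm: "hm ?M (G c) (G c') = hm C c c'" if "c \<in> objs C" "c' \<in> objs C" for c c'
    using that by (simp add: G_def hm_row_\<alpha>)
  have "qfunctor Q ?M C F"
    unfolding qfunctor_def
  proof (intro conjI ballI)
    show "F \<in> objs ?M \<rightarrow>\<^sub>E objs C" by (rule PiE_I) (simp add: F, simp add: F_def)
    show "tp C (F l) = tp ?M l" if "l \<in> objs ?M" for l using F[OF that] by simp
    fix l l' assume l: "l \<in> objs ?M" "l' \<in> objs ?M"
    then have "hm ?M l l' = hm C (F l) (F l')" using hm[of "F l" "F l'"] F GF by simp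
    then show "hm ?M l l' \<preceq>[tp ?M l, tp ?M l'] hm C (F l) (F l')"
      using qcat_hm[OF C, of "F l" "F l'"] F l K_fst[of A A below'] by simp
  qed
  moreover have "qfunctor Q C ?M G"
    unfolding qfunctor_def
  proof (intro conjI ballI)
    show "G \<in> objs C \<rightarrow>\<^sub>E objs ?M" by (rule PiE_I) (simp add: G, simp add: G_def)
    show "tp ?M (G c) = tp C c" if "c \<in> objs C" for c using that by (simp add: G_def)
    fix c c' assume "c \<in> objs C" "c' \<in> objs C"
    then show "hm C c c' \<preceq>[tp C c, tp C c'] hm ?M (G c) (G c')"
      using hm[of c c'] by simp
  qed
  ultimately show ?thesis
    unfolding qcat_isomorphic_def using FG GF by blast
qed

end

end

text \<open>\<open>S\<close> and \<open>e\<close> leave the object type of the distributor free: one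
  use takes a copy of the objects of \<open>C\<close> inside the universe type, the other one the
  identity.\<close>

lemma K_reg_surjective:
  fixes C :: "('o, 'a, 'c) qcat" and S :: "'b set" and e :: "'b \<Rightarrow> 'c"
  assumes [simp]: "qcat C" and sk: "skeletal Q C" and "ccd Q C" and e: "bij_betw e S (objs C)"
  obtains A and \<phi> :: "'b \<Rightarrow> 'b \<Rightarrow> 'a" where "qcat A" "objs A = S" "dst A A \<phi>" "cmp A A A \<phi> \<phi> = \<phi>"
    "qcat_isomorphic Q (K_obj Q (A, A, \<phi>)) C"
proof -
  from \<open>ccd Q C\<close> obtain s t where s: "adjoint Q (psh C) C s (yoneda Q C)" and t: "adjoint Q C (psh C) t s"
    unfolding ccd_def by blast
  define A where "A = \<lparr>objs = S, tp = (\<lambda>x. tp C (e x)), hm = (\<lambda>x y. hm C (e x) (e y))\<rparr>"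
  have e_in [simp]: "e x \<in> objs C" if "x \<in> S" for x using e that by (auto simp: bij_betw_def)
  have A_simps [simp]: "objs A = S" "tp A x = tp C (e x)" "hm A x y = hm C (e x) (e y)" for x y
    by (simp_all add: A_def)
  have A [simp]: "qcat A"
    unfolding is_qcat_def by (intro conjI ballI) (simp_all add: qcat_id qcat_comp)
  \<comment> \<open>The graph and cograph of \<open>e\<close>; they are mutually inverse because
    \<open>e\<close> is a fully faithful bijection.\<close>
  define \<alpha> where "\<alpha> = on_objs A C (\<lambda>a c. hm C (e a) c)"
  define \<beta> where "\<beta> = on_objs C A (\<lambda>c a. hm C c (e a))"
  have \<alpha> [simp]: "dst A C \<alpha>"
    by (rule distributorI) (auto simp: \<alpha>_def on_objs_undef qcat_comp)
  have \<beta> [simp]: "dst C A \<beta>"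
    by (rule distributorI) (auto simp: \<beta>_def on_objs_undef qcat_comp)
  have \<beta>\<alpha>: "cmp A C A \<beta> \<alpha> = dist_id A"
  proof (rule dist_ext[of Q A A])
    fix x y assume "x \<in> objs A" "y \<in> objs A"
    then have [simp]: "x \<in> S" "y \<in> S" by simp_all
    have "cmp A C A \<beta> \<alpha> x y = cmp C C C (dist_id C) (dist_id C) (e x) (e y)"
      by (simp add: dist_comp_apply \<alpha>_def \<beta>_def cong: image_cong_simp
          del: dist_comp_id_left dist_comp_id_right)
    then show "cmp A C A \<beta> \<alpha> x y = dist_id A x y" by simp
  qed simp_all
  have \<alpha>\<beta>: "cmp C A C \<alpha> \<beta> = dist_id C"
  proof (rule dist_ext[of Q C C])
    fix x y assume [simp]: "x \<in> objs C" "y \<in> objs C"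
    have e_S: "e ` S = objs C" using e by (simp add: bij_betw_def)
    let ?f = "\<lambda>c. Cmp Q (tp C x) (tp C c) (tp C y) (hm C c y) (hm C x c)"
    \<comment> \<open>The join over \<open>S\<close> is reindexed along \<open>e\<close>, whose
      image is all of \<open>objs C\<close>.\<close>
    have "cmp C A C \<alpha> \<beta> x y = \<Squnion>\<^bsub>Hom Q (tp C x) (tp C y)\<^esub> (?f ` e ` S)"
      by (simp add: dist_comp_apply \<alpha>_def \<beta>_def image_image cong: image_cong_simp)
    also have "\<dots> = cmp C C C (dist_id C) (dist_id C) x y"
      unfolding e_S by (simp add: dist_comp_apply cong: image_cong_simp del: dist_comp_id_left dist_comp_id_right)
    finally have "cmp C A C \<alpha> \<beta> x y = cmp C C C (dist_id C) (dist_id C) x y" .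
    then show "cmp C A C \<alpha> \<beta> x y = dist_id C x y" by simp
  qed simp_all
  note ctx = \<open>qcat C\<close> sk s t A \<alpha> \<beta> \<beta>\<alpha> \<alpha>\<beta>
  show thesis
    by (rule that[OF A A_simps(1) _ below'_idem[OF ctx] K_iso[OF ctx]])
      (simp add: below_dist[OF \<open>qcat C\<close> sk s t])
qed

end

section \<open>Small sets\<close>

lemma small_lepoll: "S \<lesssim> T \<Longrightarrow> small U T \<Longrightarrow> small U S"
  unfolding small_def by (rule lesspoll_trans1)

text \<open>A universe of n elements would have a small set of n - 1 elements, but the power set of
  that set has at least n elements. For n = 1 this is the empty set, whose power set is a
  singleton.\<close>

lemma universe_infinite:
  assumes "universe TYPE('u)"
  shows "infinite (UNIV :: 'u set)"
proof
  assume fin: "finite (UNIV :: 'u set)"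
  define x :: 'u where "x = undefined"
  have card: "card (UNIV :: 'u set) = Suc (card (UNIV - {x}))"
    by (rule card.remove[OF fin UNIV_I])
  then have "small TYPE('u) (UNIV - {x})"
    using fin by (auto simp: small_def lesspoll_def eqpoll_iff_card intro: subset_imp_lepoll)
  then have "small TYPE('u) (Pow (UNIV - {x}))"
    using assms by (auto simp: universe_def)
  moreover have "(UNIV :: 'u set) \<lesssim> Pow (UNIV - {x})"
  proof (subst lepoll_iff_card_le)
    show "card (UNIV :: 'u set) \<le> card (Pow (UNIV - {x}))"
      unfolding card card_Pow[OF finite_Diff[OF fin]] by (rule Suc_leI[OF less_exp])
  qed (use fin in simp_all)
  ultimately show False
    unfolding small_def by (metis lesspoll_trans1 lesspoll_not_refl)
qed

text \<open>\<open>universe\<close> speaks of subsets of \<open>'u\<close>; injecting a small set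
  into \<open>'u\<close> carries the closure property to all types.\<close>

lemma small_Pow:
  assumes U: "universe TYPE('u)" and S: "small TYPE('u) S"
  shows "small TYPE('u) (Pow S)"
proof -
  from S obtain f :: "_ \<Rightarrow> 'u" where f: "inj_on f S"
    unfolding small_def lesspoll_def lepoll_def by blast
  have "small TYPE('u) (f ` S)"
    using S by (rule small_lepoll[OF image_lepoll])
  then have "small TYPE('u) (Pow (f ` S))" using U by (simp add: universe_def)
  moreover have "Pow S \<lesssim> Pow (f ` S)"
    unfolding lepoll_def using f by (intro exI[of _ "image f"]) (auto simp: inj_on_image_Pow)
  ultimately show ?thesis by (rule small_lepoll[rotated])
qed

lemma Times_lepoll_infinite:
  assumes "infinite S" "T \<lesssim> S"
  shows "S \<times> T \<lesssim> S"
proof (cases "T = {}")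
  case False
  have "ordLeq3 (card_of T) (card_of S)"
    using assms(2) unfolding lepoll_def card_of_ordLeq .
  then have "S \<times> T \<approx> S"
    using card_of_Times_infinite[OF assms(1) False] by (simp add: eqpoll_iff_card_of_ordIso)
  then show ?thesis by (rule eqpoll_imp_lepoll)
qed simp

text \<open>Cardinals are comparable, so apart from the finite case one factor is infinite and
  absorbs the other.\<close>

lemma small_Times:
  assumes "infinite (UNIV :: 'u set)" and S: "small TYPE('u) S" and T: "small TYPE('u) T"
  shows "small TYPE('u) (S \<times> T)"
proof -
  have total: "S \<lesssim> T \<or> T \<lesssim> S"
    using ordLeq_total[OF card_of_Well_order card_of_Well_order, of S T]
    by (simp add: lepoll_def card_of_ordLeq)
  consider "finite S" "finite T" | "infinite S" "T \<lesssim> S" | "infinite T" "S \<lesssim> T"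
    using total finite_lepoll_infinite finite_surj lepoll_iff by metis
  then show ?thesis
  proof cases
    case 1
    then show ?thesis using assms(1) by (simp add: small_def finite_lesspoll_infinite)
  next
    case 2
    then show ?thesis using small_lepoll[OF Times_lepoll_infinite S] by blast
  next
    case 3
    have "S \<times> T \<lesssim> T"
      using lepoll_trans1[OF times_commute_eqpoll Times_lepoll_infinite[OF 3]] .
    then show ?thesis using T by (rule small_lepoll)
  qed
qed

section \<open>Smallness of \<open>K_obj\<close> and the equivalence\<close>

context quantaloid
begin

text \<open>A presheaf is encoded by its type and its graph, a subset of \<open>objs B\<close> times
  the set of all arrows. The encoding is injective because distributors are \<open>undefined\<close>
  outside the object sets.\<close>

lemma small_K_obj:
  fixes \<phi> :: "('o, 'a, 'b) dist_arrow"
  assumes U: "universe TYPE('u)" and Q: "small_quantaloid TYPE('u) Q"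
    and \<phi>: "\<phi> \<in> Obj (DDist_reg Q (small TYPE('u)))"
  shows "small TYPE('u) (objs (K_obj Q \<phi>))"
proof -
  obtain A B f where \<phi>_eq: "\<phi> = (A, B, f)" by (cases \<phi>)
  define R where "R = (\<Union>X \<in> Obj Q. \<Union>Y \<in> Obj Q. Arrows Q X Y)"
  have B: "qcat B" "small TYPE('u) (objs B)" and R: "small TYPE('u) R" and O: "small TYPE('u) (Obj Q)"
    using \<phi> Q by (auto simp: \<phi>_eq small_quantaloid_def R_def)
  define h :: "('o, 'a, 'b) presheaf \<Rightarrow> 'o \<times> ('b \<times> 'a) set"
    where "h = (\<lambda>(X, l). (X, (\<lambda>b. (b, l b ())) ` objs B))"
  have "inj_on h (objs (K_obj Q \<phi>))"
  proof (rule inj_onI)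
    fix p q assume p: "p \<in> objs (K_obj Q \<phi>)" "q \<in> objs (K_obj Q \<phi>)" and eq: "h p = h q"
    obtain X l where p_eq: "p = (X, l)" by (cases p)
    obtain Y m where q_eq: "q = (Y, m)" by (cases q)
    have XY: "X = Y" and im: "(\<lambda>b. (b, l b ())) ` objs B = (\<lambda>b. (b, m b ())) ` objs B"
      using eq by (simp_all add: h_def p_eq q_eq)
    have "l b () = m b ()" if "b \<in> objs B" for b
    proof -
      have "(b, l b ()) \<in> (\<lambda>b. (b, m b ())) ` objs B" using that unfolding im[symmetric] by blast
      then show ?thesis by auto
    qed
    then have "l = m"
      using p by (intro dist_ext[of Q B "one X" l m]) (auto simp: p_eq q_eq \<phi>_eq K_obj_iff XY)
    then show "p = q" by (simp add: p_eq q_eq XY)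
  qed
  moreover have "h ` objs (K_obj Q \<phi>) \<subseteq> Obj Q \<times> Pow (objs B \<times> R)"
  proof
    fix z assume "z \<in> h ` objs (K_obj Q \<phi>)"
    then obtain X l where z: "z = h (X, l)" and l: "X \<in> Obj Q" "dst B (one X) l"
      by (auto simp: \<phi>_eq K_obj_iff)
    have "l b () \<in> R" if "b \<in> objs B" for b
      using dist_arrow[OF l(2) that, of "()"] qcat_tp[OF B(1) that] l(1) by (auto simp: R_def)
    then show "z \<in> Obj Q \<times> Pow (objs B \<times> R)" using l(1) by (auto simp: z h_def)
  qed
  ultimately have "objs (K_obj Q \<phi>) \<lesssim> Obj Q \<times> Pow (objs B \<times> R)"
    unfolding lepoll_def by blast
  then show ?thesis
    by (rule small_lepoll) (intro small_Times small_Pow universe_infinite U O B R)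
qed

text \<open>Mutually inverse functors are adjoint on both sides, so both are arrows of the
  quantaloid.\<close>

lemma QSup_isomorphicI:
  assumes o: "A \<in> Obj (QSup_ccd Q sm)" "B \<in> Obj (QSup_ccd Q sm)" and "qcat_isomorphic Q A B"
  shows "isomorphic_in (QSup_ccd Q sm) A B"
proof -
  from assms obtain F G where F: "qfunctor Q A B F" and G: "qfunctor Q B A G"
    and GF: "\<And>x. x \<in> objs A \<Longrightarrow> G (F x) = x" and FG: "\<And>y. y \<in> objs B \<Longrightarrow> F (G y) = y"
    unfolding qcat_isomorphic_def by blast
  have [simp]: "qcat A" "qcat B" using o by auto
  have "adjoint Q A B F G" "adjoint Q B A G F"
    using F G FG GF by (simp_all add: adjoint_def qle_refl)
  moreover have "compose (objs A) G F = (\<lambda>x \<in> objs A. x)" "compose (objs B) F G = (\<lambda>x \<in> objs B. x)"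
    unfolding compose_def by (rule restrict_ext, simp add: FG GF)+
  ultimately show ?thesis unfolding isomorphic_in_def by auto
qed

lemma K_reg_equivalence:
  assumes U: "universe TYPE('u)" and Q: "small_quantaloid TYPE('u) Q"
  shows "quantaloid_equivalence (op_quantaloid (DDist_reg Q (small TYPE('u) :: 'u set \<Rightarrow> bool)))
    (QSup_ccd Q (small TYPE('u))) (K_obj Q) (\<lambda>\<psi> \<phi>. K_arr Q \<phi> \<psi>)"
  unfolding quantaloid_equivalence_def
proof (intro conjI K_reg_quantaloid_hom K_reg_fully_faithful small_K_obj U Q)
  show "essentially_surjective (op_quantaloid (DDist_reg Q (small TYPE('u) :: 'u set \<Rightarrow> bool)))
    (QSup_ccd Q (small TYPE('u))) (K_obj Q)"
    unfolding essentially_surjective_def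
  proof
    fix C :: "('o, 'a, ('o, 'a, 'u) presheaf) qcat"
    assume C: "C \<in> Obj (QSup_ccd Q (small TYPE('u)))"
    then have C': "qcat C" "skeletal Q C" "ccd Q C" "small TYPE('u) (objs C)" by auto
    \<comment> \<open>The objects of \<open>C\<close> have the type of presheaves over
      \<open>'u\<close>. As a small set they embed into \<open>'u\<close>, and the representing
      distributor is built on the image.\<close>
    then obtain f :: "_ \<Rightarrow> 'u" where f: "inj_on f (objs C)"
      unfolding small_def lesspoll_def lepoll_def by blast
    let ?S = "f ` objs C"
    have e: "bij_betw (inv_into (objs C) f) ?S (objs C)"
      by (rule bij_betw_inv_into[OF inj_on_imp_bij_betw[OF f]])
    have S: "small TYPE('u) ?S" by (rule small_lepoll[OF image_lepoll C'(4)])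
    obtain A and \<phi> :: "'u \<Rightarrow> 'u \<Rightarrow> 'a" where \<phi>: "qcat A" "objs A = ?S" "dst A A \<phi>" "cmp A A A \<phi> \<phi> = \<phi>"
      and iso: "qcat_isomorphic Q (K_obj Q (A, A, \<phi>)) C"
      by (rule K_reg_surjective[OF C'(1-3) e])
    have o: "(A, A, \<phi>) \<in> Obj (DDist_reg Q (small TYPE('u)))"
      using \<phi> S by auto
    then have "K_obj Q (A, A, \<phi>) \<in> Obj (QSup_ccd Q (small TYPE('u)))"
      by (rule K_obj_ccd) (rule small_K_obj[OF U Q o])
    then show "\<exists>X \<in> Obj (op_quantaloid (DDist_reg Q (small TYPE('u)))). isomorphic_in (QSup_ccd Q (small TYPE('u))) (K_obj Q X) C"
      using o C iso by (intro bexI[of _ "(A, A, \<phi>)"] QSup_isomorphicI) simp_all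
  qed
qed

end

theorem theorem5p5:
  fixes Q :: "('o, 'q) quantaloid"
  assumes "quantaloid Q"
  shows
    "(universe TYPE('u) \<and> small_quantaloid TYPE('u) Q \<longrightarrow>
        quantaloid_equivalence
          (op_quantaloid (DDist_reg Q (small TYPE('u) :: 'u set \<Rightarrow> bool)))
          (QSup_ccd Q (small TYPE('u)))
          (K_obj Q) (\<lambda>\<psi> \<phi>. K_arr Q \<phi> \<psi>) \<and>
        dually_equivalent
          (DDist_reg Q (small TYPE('u) :: 'u set \<Rightarrow> bool))
          (QSup_ccd Q (small TYPE('u) :: ('o, 'q, 'u) presheaf set \<Rightarrow> bool)))
     \<and>
     (quantaloid_hom
        (op_quantaloid (DDist_reg Q (\<lambda>_ :: 'a set. True))) (QSup_ccd Q (\<lambda>_. True))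
        (K_obj Q) (\<lambda>\<psi> \<phi>. K_arr Q \<phi> \<psi>) \<and>
      fully_faithful
        (op_quantaloid (DDist_reg Q (\<lambda>_ :: 'a set. True))) (QSup_ccd Q (\<lambda>_. True))
        (K_obj Q) (\<lambda>\<psi> \<phi>. K_arr Q \<phi> \<psi>) \<and>
      (\<forall>C \<in> Obj (QSup_ccd Q (\<lambda>_ :: 'c set. True)).
         \<exists>\<phi> \<in> Obj (DDist_reg Q (\<lambda>_ :: 'c set. True)). qcat_isomorphic Q (K_obj Q \<phi>) C))"
proof -
  interpret quantaloid Q by fact
  have "\<exists>\<phi> \<in> Obj (DDist_reg Q (\<lambda>_ :: 'c set. True)). qcat_isomorphic Q (K_obj Q \<phi>) C"
    if "C \<in> Obj (QSup_ccd Q (\<lambda>_ :: 'c set. True))" for C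
  proof -
    have C: "is_qcat Q C" "skeletal Q C" "ccd Q C" using that by auto
    \<comment> \<open>No bound on size is imposed here, so the representing distributor is taken on
      the objects of \<open>C\<close> themselves.\<close>
    obtain A and \<phi> :: "'c \<Rightarrow> 'c \<Rightarrow> 'q" where \<phi>: "is_qcat Q A" "objs A = objs C" "dst A A \<phi>" "cmp A A A \<phi> \<phi> = \<phi>"
      and iso: "qcat_isomorphic Q (K_obj Q (A, A, \<phi>)) C"
      by (rule K_reg_surjective[OF C bij_betw_id])
    then show ?thesis by (intro bexI[of _ "(A, A, \<phi>)"]) auto
  qed
  moreover have "quantaloid_hom (op_quantaloid (DDist_reg Q (\<lambda>_ :: 'a set. True))) (QSup_ccd Q (\<lambda>_. True))
      (K_obj Q) (\<lambda>\<psi> \<phi>. K_arr Q \<phi> \<psi>)"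
    by (rule K_reg_quantaloid_hom) simp
  moreover have "fully_faithful (op_quantaloid (DDist_reg Q (\<lambda>_ :: 'a set. True))) (QSup_ccd Q (\<lambda>_. True))
      (K_obj Q) (\<lambda>\<psi> \<phi>. K_arr Q \<phi> \<psi>)"
    by (rule K_reg_fully_faithful)
  ultimately show ?thesis
    unfolding dually_equivalent_def by (intro conjI impI ballI exI; (elim conjE)?) (rule K_reg_equivalence | assumption)+
qed

end
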